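(* Let $\mathcal B$ be a category. To each pseudo-functor $\Xi\colon\mathcal B^{op}\to\mathit{FIB}_c$ there corresponds, by the 2-level Grothendieck construction, a composable pair of fibrations $\mathcal E_\Xi\xrightarrow{Q_\Xi}\mathcal D_\Xi\xrightarrow{P_\Xi}\mathcal B$. Moreover, if $\Xi_Q\colon\mathcal B^{op}\to\mathit{FIB}_c$ is the pseudo-functor associated to a composable pair of fibrations $\mathcal E\xrightarrow{Q}\mathcal D\xrightarrow{P}\mathcal B$ (equipped with cleavages), then the composable pair of fibrations over $\mathcal B$ corresponding to $\Xi_Q$ is isomorphic to $\mathcal E\xrightarrow{Q}\mathcal D\xrightarrow{P}\mathcal B$.
   Context: $\mathit{FIB}_c$: the 2-category of Grothendieck fibrations (over arbitrary bases), Cartesian morphisms of fibrations (commutative squares of functors whose total component preserves Cartesian arrows), and pairs of natural transformations, one between the total functors lying over one between the base functors. 2-level Grothendieck construction. Let $\mathrm{dom},\mathrm{cod}\colon\mathit{CAT}^{\mathbb 2}\to\mathit{CAT}$ be the domain and codomain 2-functors on the strict arrow 2-category of $\mathit{CAT}$. A pseudo-functor $\Xi\colon\mathcal B^{op}\to\mathit{FIB}_c$ yields pseudo-functors $\mathrm{dom}\circ\Xi,\mathrm{cod}\circ\Xi\colon\mathcal B^{op}\to\mathit{CAT}$ and a strict transformation $\mathrm{dom}\circ\Xi\Rightarrow\mathrm{cod}\circ\Xi$ with component $\Xi(A)$ at $A$. The usual Grothendieck construction applied to this transformation gives fibrations $\mathcal E_\Xi\to\mathcal B$, $P_\Xi\colon\mathcal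 D_\Xi\to\mathcal B$ and a functor $Q_\Xi\colon\mathcal E_\Xi\to\mathcal D_\Xi$ over $\mathcal B$, with $P_\Xi Q_\Xi$ the first fibration. (In the Grothendieck construction of $\Phi\colon\mathcal B^{op}\to\mathit{CAT}$, objects are pairs $(B,E)$ with $E\in\Phi(B)$ and arrows $(A,D)\to(B,E)$ are pairs $(f\colon A\to B,\ h\colon D\to\Phi(f)(E))$.) The pseudo-functor $\Xi_Q$: choose cleavages of $P$ and $Q$ and give $P\circ Q$ the composite cleavage (lift $f$ at $Q(E)$ by the cleavage of $P$, then lift the result at $E$ by the cleavage of $Q$). Then $\Xi_Q(A)=(Q_A\colon\mathcal E_A\to\mathcal D_A)$, the restriction of $Q$ to the fibres over $A$, and $\Xi_Q(f\colon A\to B)$ is the square formed by the inverse image functors $f^*\colon\mathcal E_B\to\mathcal E_A$ and $f^*\colon\mathcal D_B\to\mathcal D_A$, with structure isomorphisms induced by universality. An isomorphism between composable pairs $\mathcal E\xrightarrow{Q}\mathcal D\xrightarrow{P}\mathcal B$ and $\mathcal E'\xrightarrow{Q'}\mathcal D'\xrightarrow{P'}\mathcal B$ is a pair of isomorphisms of categories $F\colon\mathcal E\to\mathcal E'$, $G\colon\mathcal D\to\mathcal D'$ with $GQ=Q'F$ and $P'G=P$. *)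

theory Defs
  imports "HOL-Library.FuncSet"
begin

section \<open>Categories, functors, natural transformations\<close>

text \<open>
  Categories are carried by sets of objects and arrows; \<open>Comp C g f\<close> is \<open>g\<close> after \<open>f\<close>. The maps of
  functors and the components of natural transformations are extensional
  (\<open>undefined\<close> off the carrier), so that HOL equality of functors and of natural transformations is
  the mathematical one, and 1-cells and 2-cells can be compared strictly.
\<close>

record ('o, 'a) cat =
  Obj :: "'o set"
  Arr :: "'a set"
  Dom :: "'a \<Rightarrow> 'o"
  Cod :: "'a \<Rightarrow> 'o"
  Ide :: "'o \<Rightarrow> 'a"
  Comp :: "'a \<Rightarrow> 'a \<Rightarrow> 'a"

definition Hom :: "('o, 'a) cat \<Rightarrow> 'o \<Rightarrow> 'o \<Rightarrow> 'a set" where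
  "Hom C x y = {f \<in> Arr C. Dom C f = x \<and> Cod C f = y}"

locale category =
  fixes C :: "('o, 'a) cat"
  assumes dom_obj: "f \<in> Arr C \<Longrightarrow> Dom C f \<in> Obj C"
    and cod_obj: "f \<in> Arr C \<Longrightarrow> Cod C f \<in> Obj C"
    and ide_hom: "x \<in> Obj C \<Longrightarrow> Ide C x \<in> Hom C x x"
    and comp_hom: "f \<in> Hom C x y \<Longrightarrow> g \<in> Hom C y z \<Longrightarrow> Comp C g f \<in> Hom C x z"
    and comp_ide_right: "f \<in> Hom C x y \<Longrightarrow> Comp C f (Ide C x) = f"
    and comp_ide_left: "f \<in> Hom C x y \<Longrightarrow> Comp C (Ide C y) f = f"
    and comp_assoc: "f \<in> Hom C w x \<Longrightarrow> g \<in> Hom C x y \<Longrightarrow> h \<in> Hom C y z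
      \<Longrightarrow> Comp C h (Comp C g f) = Comp C (Comp C h g) f"

definition op_cat :: "('o, 'a) cat \<Rightarrow> ('o, 'a) cat" where
  "op_cat C = \<lparr>Obj = Obj C, Arr = Arr C, Dom = Cod C, Cod = Dom C,
     Ide = Ide C, Comp = (\<lambda>g f. Comp C f g)\<rparr>"

record ('o1, 'a1, 'o2, 'a2) funct =
  Src :: "('o1, 'a1) cat"
  Tgt :: "('o2, 'a2) cat"
  OMap :: "'o1 \<Rightarrow> 'o2"
  AMap :: "'a1 \<Rightarrow> 'a2"

locale cat_functor =
  fixes F :: "('o1, 'a1, 'o2, 'a2) funct"
  assumes src_category: "category (Src F)"
    and tgt_category: "category (Tgt F)"
    and omap_obj: "x \<in> Obj (Src F) \<Longrightarrow> OMap F x \<in> Obj (Tgt F)"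
    and amap_hom: "f \<in> Hom (Src F) x y \<Longrightarrow> AMap F f \<in> Hom (Tgt F) (OMap F x) (OMap F y)"
    and amap_ide: "x \<in> Obj (Src F) \<Longrightarrow> AMap F (Ide (Src F) x) = Ide (Tgt F) (OMap F x)"
    and amap_comp: "f \<in> Hom (Src F) x y \<Longrightarrow> g \<in> Hom (Src F) y z
      \<Longrightarrow> AMap F (Comp (Src F) g f) = Comp (Tgt F) (AMap F g) (AMap F f)"
    and omap_extensional: "OMap F \<in> extensional (Obj (Src F))"
    and amap_extensional: "AMap F \<in> extensional (Arr (Src F))"

definition fid :: "('o, 'a) cat \<Rightarrow> ('o, 'a, 'o, 'a) funct" where
  "fid C = \<lparr>Src = C, Tgt = C, OMap = (\<lambda>x\<in>Obj C. x), AMap = (\<lambda>f\<in>Arr C. f)\<rparr>"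

definition fcomp :: "('o2, 'a2, 'o3, 'a3) funct \<Rightarrow> ('o1, 'a1, 'o2, 'a2) funct
    \<Rightarrow> ('o1, 'a1, 'o3, 'a3) funct" where
  "fcomp G F = \<lparr>Src = Src F, Tgt = Tgt G,
     OMap = compose (Obj (Src F)) (OMap G) (OMap F),
     AMap = compose (Arr (Src F)) (AMap G) (AMap F)\<rparr>"

definition cat_iso :: "('o1, 'a1, 'o2, 'a2) funct \<Rightarrow> bool" where
  "cat_iso F \<longleftrightarrow> cat_functor F \<and>
     (\<exists>F'. cat_functor F' \<and> Src F' = Tgt F \<and> Tgt F' = Src F \<and>
        fcomp F' F = fid (Src F) \<and> fcomp F F' = fid (Tgt F))"

record ('o1, 'a1, 'o2, 'a2) nattr =
  NSrc :: "('o1, 'a1, 'o2, 'a2) funct"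
  NTgt :: "('o1, 'a1, 'o2, 'a2) funct"
  NComp :: "'o1 \<Rightarrow> 'a2"

locale nat_trans =
  fixes t :: "('o1, 'a1, 'o2, 'a2) nattr"
  assumes nsrc_functor: "cat_functor (NSrc t)"
    and ntgt_functor: "cat_functor (NTgt t)"
    and parallel_src: "Src (NTgt t) = Src (NSrc t)"
    and parallel_tgt: "Tgt (NTgt t) = Tgt (NSrc t)"
    and ncomp_hom: "x \<in> Obj (Src (NSrc t))
      \<Longrightarrow> NComp t x \<in> Hom (Tgt (NSrc t)) (OMap (NSrc t) x) (OMap (NTgt t) x)"
    and naturality: "f \<in> Hom (Src (NSrc t)) x y
      \<Longrightarrow> Comp (Tgt (NSrc t)) (NComp t y) (AMap (NSrc t) f)
        = Comp (Tgt (NSrc t)) (AMap (NTgt t) f) (NComp t x)"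
    and ncomp_extensional: "NComp t \<in> extensional (Obj (Src (NSrc t)))"

definition nid :: "('o1, 'a1, 'o2, 'a2) funct \<Rightarrow> ('o1, 'a1, 'o2, 'a2) nattr" where
  "nid F = \<lparr>NSrc = F, NTgt = F, NComp = (\<lambda>x\<in>Obj (Src F). Ide (Tgt F) (OMap F x))\<rparr>"

definition nvcomp :: "('o1, 'a1, 'o2, 'a2) nattr \<Rightarrow> ('o1, 'a1, 'o2, 'a2) nattr
    \<Rightarrow> ('o1, 'a1, 'o2, 'a2) nattr" where
  "nvcomp t s = \<lparr>NSrc = NSrc s, NTgt = NTgt t,
     NComp = (\<lambda>x\<in>Obj (Src (NSrc s)). Comp (Tgt (NSrc s)) (NComp t x) (NComp s x))\<rparr>"

definition nhcomp :: "('o2, 'a2, 'o3, 'a3) nattr \<Rightarrow> ('o1, 'a1, 'o2, 'a2) nattr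
    \<Rightarrow> ('o1, 'a1, 'o3, 'a3) nattr" where
  "nhcomp t s = \<lparr>NSrc = fcomp (NSrc t) (NSrc s), NTgt = fcomp (NTgt t) (NTgt s),
     NComp = (\<lambda>x\<in>Obj (Src (NSrc s)).
       Comp (Tgt (NSrc t)) (NComp t (OMap (NTgt s) x)) (AMap (NSrc t) (NComp s x)))\<rparr>"


section \<open>Strict 2-categories and pseudo-functors\<close>

record ('x, 'f, 't) two_cat =
  Cell0 :: "'x set"
  Cell1 :: "'f set"
  Cell2 :: "'t set"
  Dom1 :: "'f \<Rightarrow> 'x"
  Cod1 :: "'f \<Rightarrow> 'x"
  Dom2 :: "'t \<Rightarrow> 'f"
  Cod2 :: "'t \<Rightarrow> 'f"
  Id1 :: "'x \<Rightarrow> 'f"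
  Id2 :: "'f \<Rightarrow> 't"
  Comp1 :: "'f \<Rightarrow> 'f \<Rightarrow> 'f"
  VComp :: "'t \<Rightarrow> 't \<Rightarrow> 't"
  HComp :: "'t \<Rightarrow> 't \<Rightarrow> 't"

definition ucat :: "('x, 'f, 't) two_cat \<Rightarrow> ('x, 'f) cat" where
  "ucat K = \<lparr>Obj = Cell0 K, Arr = Cell1 K, Dom = Dom1 K, Cod = Cod1 K,
     Ide = Id1 K, Comp = Comp1 K\<rparr>"

definition vcat :: "('x, 'f, 't) two_cat \<Rightarrow> ('f, 't) cat" where
  "vcat K = \<lparr>Obj = Cell1 K, Arr = Cell2 K, Dom = Dom2 K, Cod = Cod2 K,
     Ide = Id2 K, Comp = VComp K\<rparr>"

definition hcat :: "('x, 'f, 't) two_cat \<Rightarrow> ('x, 't) cat" where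
  "hcat K = \<lparr>Obj = Cell0 K, Arr = Cell2 K,
     Dom = (\<lambda>t. Dom1 K (Dom2 K t)), Cod = (\<lambda>t. Cod1 K (Dom2 K t)),
     Ide = (\<lambda>x. Id2 K (Id1 K x)), Comp = HComp K\<rparr>"

locale two_category =
  fixes K :: "('x, 'f, 't) two_cat"
  assumes ucat_category: "category (ucat K)"
    and vcat_category: "category (vcat K)"
    and hcat_category: "category (hcat K)"
    and globular: "t \<in> Cell2 K \<Longrightarrow> Dom1 K (Cod2 K t) = Dom1 K (Dom2 K t)
      \<and> Cod1 K (Cod2 K t) = Cod1 K (Dom2 K t)"
    and hcomp_boundary: "s \<in> Cell2 K \<Longrightarrow> t \<in> Cell2 K
      \<Longrightarrow> Cod1 K (Dom2 K s) = Dom1 K (Dom2 K t)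
      \<Longrightarrow> Dom2 K (HComp K t s) = Comp1 K (Dom2 K t) (Dom2 K s)
        \<and> Cod2 K (HComp K t s) = Comp1 K (Cod2 K t) (Cod2 K s)"
    and hcomp_id2: "f \<in> Cell1 K \<Longrightarrow> g \<in> Cell1 K \<Longrightarrow> Cod1 K f = Dom1 K g
      \<Longrightarrow> HComp K (Id2 K g) (Id2 K f) = Id2 K (Comp1 K g f)"
    and interchange: "s \<in> Cell2 K \<Longrightarrow> s' \<in> Cell2 K \<Longrightarrow> t \<in> Cell2 K \<Longrightarrow> t' \<in> Cell2 K
      \<Longrightarrow> Cod2 K s = Dom2 K s' \<Longrightarrow> Cod2 K t = Dom2 K t'
      \<Longrightarrow> Cod1 K (Dom2 K s) = Dom1 K (Dom2 K t)
      \<Longrightarrow> HComp K (VComp K t' t) (VComp K s' s) = VComp K (HComp K t' s') (HComp K t s)"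

definition invertible2 :: "('x, 'f, 't) two_cat \<Rightarrow> 't \<Rightarrow> bool" where
  "invertible2 K t \<longleftrightarrow> t \<in> Cell2 K \<and>
     (\<exists>s\<in>Cell2 K. Dom2 K s = Cod2 K t \<and> Cod2 K s = Dom2 K t \<and>
        VComp K s t = Id2 K (Dom2 K t) \<and> VComp K t s = Id2 K (Cod2 K t))"

record ('o, 'a, 'x, 'f, 't) psfun =
  Ps0 :: "'o \<Rightarrow> 'x"
  Ps1 :: "'a \<Rightarrow> 'f"
  PsUnit :: "'o \<Rightarrow> 't"
  PsComp :: "'a \<Rightarrow> 'a \<Rightarrow> 't"

text \<open>
  A pseudo-functor from a category \<open>C\<close>, seen as a locally discrete 2-category (so that there is no
  action on 2-cells beyond identities), to a 2-category \<open>K\<close>. The structure cells are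
  \<open>PsUnit \<Phi> x : 1 \<Rightarrow> \<Phi> 1\<^sub>x\<close> and \<open>PsComp \<Phi> g f : \<Phi> g \<circ> \<Phi> f \<Rightarrow> \<Phi> (g \<circ> f)\<close>.
\<close>

locale pseudo_functor =
  fixes C :: "('o, 'a) cat"
    and K :: "('x, 'f, 't) two_cat"
    and \<Phi> :: "('o, 'a, 'x, 'f, 't) psfun"
  assumes source_category: "category C"
    and target_two_category: "two_category K"
    and ps0: "x \<in> Obj C \<Longrightarrow> Ps0 \<Phi> x \<in> Cell0 K"
    and ps1: "f \<in> Arr C \<Longrightarrow> Ps1 \<Phi> f \<in> Cell1 K
      \<and> Dom1 K (Ps1 \<Phi> f) = Ps0 \<Phi> (Dom C f) \<and> Cod1 K (Ps1 \<Phi> f) = Ps0 \<Phi> (Cod C f)"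
    and ps_unit: "x \<in> Obj C \<Longrightarrow> invertible2 K (PsUnit \<Phi> x)
      \<and> Dom2 K (PsUnit \<Phi> x) = Id1 K (Ps0 \<Phi> x) \<and> Cod2 K (PsUnit \<Phi> x) = Ps1 \<Phi> (Ide C x)"
    and ps_comp: "f \<in> Hom C x y \<Longrightarrow> g \<in> Hom C y z \<Longrightarrow> invertible2 K (PsComp \<Phi> g f)
      \<and> Dom2 K (PsComp \<Phi> g f) = Comp1 K (Ps1 \<Phi> g) (Ps1 \<Phi> f)
      \<and> Cod2 K (PsComp \<Phi> g f) = Ps1 \<Phi> (Comp C g f)"
    and ps_unit_right: "f \<in> Hom C x y \<Longrightarrow>
      VComp K (PsComp \<Phi> f (Ide C x)) (HComp K (Id2 K (Ps1 \<Phi> f)) (PsUnit \<Phi> x)) = Id2 K (Ps1 \<Phi> f)"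
    and ps_unit_left: "f \<in> Hom C x y \<Longrightarrow>
      VComp K (PsComp \<Phi> (Ide C y) f) (HComp K (PsUnit \<Phi> y) (Id2 K (Ps1 \<Phi> f))) = Id2 K (Ps1 \<Phi> f)"
    and ps_assoc: "f \<in> Hom C w x \<Longrightarrow> g \<in> Hom C x y \<Longrightarrow> h \<in> Hom C y z \<Longrightarrow>
      VComp K (PsComp \<Phi> h (Comp C g f)) (HComp K (Id2 K (Ps1 \<Phi> h)) (PsComp \<Phi> g f))
      = VComp K (PsComp \<Phi> (Comp C h g) f) (HComp K (PsComp \<Phi> h g) (Id2 K (Ps1 \<Phi> f)))"

record ('x, 'f, 't, 'x', 'f', 't') two_funct =
  Map0 :: "'x \<Rightarrow> 'x'"
  Map1 :: "'f \<Rightarrow> 'f'"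
  Map2 :: "'t \<Rightarrow> 't'"

definition ps_postcomp :: "('x, 'f, 't, 'x', 'f', 't') two_funct
    \<Rightarrow> ('o, 'a, 'x, 'f, 't) psfun \<Rightarrow> ('o, 'a, 'x', 'f', 't') psfun" where
  "ps_postcomp T \<Phi> = \<lparr>Ps0 = (\<lambda>x. Map0 T (Ps0 \<Phi> x)), Ps1 = (\<lambda>f. Map1 T (Ps1 \<Phi> f)),
     PsUnit = (\<lambda>x. Map2 T (PsUnit \<Phi> x)), PsComp = (\<lambda>g f. Map2 T (PsComp \<Phi> g f))\<rparr>"


section \<open>The 2-category of categories and its strict arrow 2-category\<close>

definition CAT :: "(('o, 'a) cat, ('o, 'a, 'o, 'a) funct, ('o, 'a, 'o, 'a) nattr) two_cat" where
  "CAT = \<lparr>Cell0 = {C. category C}, Cell1 = {F. cat_functor F}, Cell2 = {t. nat_trans t},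
     Dom1 = Src, Cod1 = Tgt, Dom2 = NSrc, Cod2 = NTgt,
     Id1 = fid, Id2 = nid, Comp1 = fcomp, VComp = nvcomp, HComp = nhcomp\<rparr>"

record ('e, 'u, 'd, 'v) square =
  SqSrc :: "('e, 'u, 'd, 'v) funct"
  SqTgt :: "('e, 'u, 'd, 'v) funct"
  SqTop :: "('e, 'u, 'e, 'u) funct"
  SqBot :: "('d, 'v, 'd, 'v) funct"

definition comm_square :: "('e, 'u, 'd, 'v) square \<Rightarrow> bool" where
  "comm_square S \<longleftrightarrow>
     cat_functor (SqSrc S) \<and> cat_functor (SqTgt S) \<and> cat_functor (SqTop S) \<and> cat_functor (SqBot S) \<and>
     Src (SqTop S) = Src (SqSrc S) \<and> Tgt (SqTop S) = Src (SqTgt S) \<and>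
     Src (SqBot S) = Tgt (SqSrc S) \<and> Tgt (SqBot S) = Tgt (SqTgt S) \<and>
     fcomp (SqTgt S) (SqTop S) = fcomp (SqBot S) (SqSrc S)"

record ('e, 'u, 'd, 'v) square2 =
  Sq2Src :: "('e, 'u, 'd, 'v) square"
  Sq2Tgt :: "('e, 'u, 'd, 'v) square"
  Sq2Top :: "('e, 'u, 'e, 'u) nattr"
  Sq2Bot :: "('d, 'v, 'd, 'v) nattr"

definition square_cell :: "('e, 'u, 'd, 'v) square2 \<Rightarrow> bool" where
  "square_cell t \<longleftrightarrow>
     comm_square (Sq2Src t) \<and> comm_square (Sq2Tgt t) \<and>
     SqSrc (Sq2Tgt t) = SqSrc (Sq2Src t) \<and> SqTgt (Sq2Tgt t) = SqTgt (Sq2Src t) \<and>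
     nat_trans (Sq2Top t) \<and> NSrc (Sq2Top t) = SqTop (Sq2Src t) \<and> NTgt (Sq2Top t) = SqTop (Sq2Tgt t) \<and>
     nat_trans (Sq2Bot t) \<and> NSrc (Sq2Bot t) = SqBot (Sq2Src t) \<and> NTgt (Sq2Bot t) = SqBot (Sq2Tgt t) \<and>
     nhcomp (nid (SqTgt (Sq2Src t))) (Sq2Top t) = nhcomp (Sq2Bot t) (nid (SqSrc (Sq2Src t)))"

definition sq_id :: "('e, 'u, 'd, 'v) funct \<Rightarrow> ('e, 'u, 'd, 'v) square" where
  "sq_id Q = \<lparr>SqSrc = Q, SqTgt = Q, SqTop = fid (Src Q), SqBot = fid (Tgt Q)\<rparr>"

definition sq_comp :: "('e, 'u, 'd, 'v) square \<Rightarrow> ('e, 'u, 'd, 'v) square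
    \<Rightarrow> ('e, 'u, 'd, 'v) square" where
  "sq_comp T S = \<lparr>SqSrc = SqSrc S, SqTgt = SqTgt T,
     SqTop = fcomp (SqTop T) (SqTop S), SqBot = fcomp (SqBot T) (SqBot S)\<rparr>"

definition sq2_id :: "('e, 'u, 'd, 'v) square \<Rightarrow> ('e, 'u, 'd, 'v) square2" where
  "sq2_id S = \<lparr>Sq2Src = S, Sq2Tgt = S, Sq2Top = nid (SqTop S), Sq2Bot = nid (SqBot S)\<rparr>"

definition sq2_vcomp :: "('e, 'u, 'd, 'v) square2 \<Rightarrow> ('e, 'u, 'd, 'v) square2
    \<Rightarrow> ('e, 'u, 'd, 'v) square2" where
  "sq2_vcomp t s = \<lparr>Sq2Src = Sq2Src s, Sq2Tgt = Sq2Tgt t,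
     Sq2Top = nvcomp (Sq2Top t) (Sq2Top s), Sq2Bot = nvcomp (Sq2Bot t) (Sq2Bot s)\<rparr>"

definition sq2_hcomp :: "('e, 'u, 'd, 'v) square2 \<Rightarrow> ('e, 'u, 'd, 'v) square2
    \<Rightarrow> ('e, 'u, 'd, 'v) square2" where
  "sq2_hcomp t s = \<lparr>Sq2Src = sq_comp (Sq2Src t) (Sq2Src s), Sq2Tgt = sq_comp (Sq2Tgt t) (Sq2Tgt s),
     Sq2Top = nhcomp (Sq2Top t) (Sq2Top s), Sq2Bot = nhcomp (Sq2Bot t) (Sq2Bot s)\<rparr>"

definition CAT2 :: "(('e, 'u, 'd, 'v) funct, ('e, 'u, 'd, 'v) square, ('e, 'u, 'd, 'v) square2) two_cat" where
  "CAT2 = \<lparr>Cell0 = {Q. cat_functor Q}, Cell1 = {S. comm_square S}, Cell2 = {t. square_cell t},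
     Dom1 = SqSrc, Cod1 = SqTgt, Dom2 = Sq2Src, Cod2 = Sq2Tgt,
     Id1 = sq_id, Id2 = sq2_id, Comp1 = sq_comp, VComp = sq2_vcomp, HComp = sq2_hcomp\<rparr>"

definition dom_2functor :: "(('e, 'u, 'd, 'v) funct, ('e, 'u, 'd, 'v) square, ('e, 'u, 'd, 'v) square2,
    ('e, 'u) cat, ('e, 'u, 'e, 'u) funct, ('e, 'u, 'e, 'u) nattr) two_funct" where
  "dom_2functor = \<lparr>Map0 = Src, Map1 = SqTop, Map2 = Sq2Top\<rparr>"

definition cod_2functor :: "(('e, 'u, 'd, 'v) funct, ('e, 'u, 'd, 'v) square, ('e, 'u, 'd, 'v) square2,
    ('d, 'v) cat, ('d, 'v, 'd, 'v) funct, ('d, 'v, 'd, 'v) nattr) two_funct" where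
  "cod_2functor = \<lparr>Map0 = Tgt, Map1 = SqBot, Map2 = Sq2Bot\<rparr>"


section \<open>Fibrations\<close>

definition cartesian :: "('e, 'u, 'd, 'v) funct \<Rightarrow> 'u \<Rightarrow> bool" where
  "cartesian Q u \<longleftrightarrow> u \<in> Arr (Src Q) \<and>
     (\<forall>v\<in>Arr (Src Q). \<forall>w\<in>Hom (Tgt Q) (OMap Q (Dom (Src Q) v)) (OMap Q (Dom (Src Q) u)).
        Cod (Src Q) v = Cod (Src Q) u \<and> Comp (Tgt Q) (AMap Q u) w = AMap Q v \<longrightarrow>
        (\<exists>!x. x \<in> Hom (Src Q) (Dom (Src Q) v) (Dom (Src Q) u) \<and> AMap Q x = w \<and> Comp (Src Q) u x = v))"

definition fibration :: "('e, 'u, 'd, 'v) funct \<Rightarrow> bool" where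
  "fibration Q \<longleftrightarrow> cat_functor Q \<and>
     (\<forall>y\<in>Obj (Src Q). \<forall>f\<in>Arr (Tgt Q). Cod (Tgt Q) f = OMap Q y \<longrightarrow>
        (\<exists>u. cartesian Q u \<and> Cod (Src Q) u = y \<and> AMap Q u = f))"

definition FIBc :: "(('e, 'u, 'd, 'v) funct, ('e, 'u, 'd, 'v) square, ('e, 'u, 'd, 'v) square2) two_cat" where
  "FIBc =
    (let fibs = {Q. fibration Q};
         cart = {S \<in> Cell1 CAT2. SqSrc S \<in> fibs \<and> SqTgt S \<in> fibs \<and>
           (\<forall>u. cartesian (SqSrc S) u \<longrightarrow> cartesian (SqTgt S) (AMap (SqTop S) u))}
     in CAT2\<lparr>Cell0 := fibs, Cell1 := cart,
          Cell2 := {t \<in> Cell2 CAT2. Sq2Src t \<in> cart \<and> Sq2Tgt t \<in> cart}\<rparr>)"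

definition composable_fibrations ::
    "('b, 'w) cat \<Rightarrow> ('e, 'u, 'd, 'v) funct \<Rightarrow> ('d, 'v, 'b, 'w) funct \<Rightarrow> bool" where
  "composable_fibrations B Q P \<longleftrightarrow> fibration Q \<and> fibration P \<and> Tgt Q = Src P \<and> Tgt P = B"

definition isomorphic_pairs :: "('e, 'u, 'd, 'v) funct \<Rightarrow> ('d, 'v, 'b, 'w) funct
    \<Rightarrow> ('e', 'u', 'd', 'v') funct \<Rightarrow> ('d', 'v', 'b, 'w) funct \<Rightarrow> bool" where
  "isomorphic_pairs Q P Q' P' \<longleftrightarrow>
     (\<exists>F G. cat_iso F \<and> Src F = Src Q \<and> Tgt F = Src Q' \<and>
        cat_iso G \<and> Src G = Src P \<and> Tgt G = Src P' \<and>
        fcomp G Q = fcomp Q' F \<and> fcomp P' G = P)"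


section \<open>The 2-level Grothendieck construction\<close>

text \<open>
  For \<open>\<Phi> : B\<^sup>o\<^sup>p \<rightarrow> CAT\<close>, an arrow \<open>(A, D) \<rightarrow> (B, E)\<close> given by \<open>f : A \<rightarrow> B\<close> and \<open>h : D \<rightarrow> \<Phi> f E\<close> is
  represented by the triple \<open>(f, h, E)\<close>: the pair \<open>(f, h)\<close> alone does not determine \<open>E\<close>. Since
  \<open>\<Phi>\<close> is contravariant on \<open>B\<close>, the cell \<open>\<Phi> f \<circ> \<Phi> g \<Rightarrow> \<Phi> (g \<circ> f)\<close> (composites taken in \<open>CAT\<close> and in
  \<open>B\<close>) is \<open>PsComp \<Phi> f g\<close>.
\<close>

definition groth :: "('b, 'w) cat
    \<Rightarrow> ('b, 'w, ('o, 'a) cat, ('o, 'a, 'o, 'a) funct, ('o, 'a, 'o, 'a) nattr) psfun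
    \<Rightarrow> ('b \<times> 'o, 'w \<times> 'a \<times> 'o) cat" where
  "groth B \<Phi> = \<lparr>
     Obj = {(A, E). A \<in> Obj B \<and> E \<in> Obj (Ps0 \<Phi> A)},
     Arr = {(f, h, E). f \<in> Arr B \<and> E \<in> Obj (Ps0 \<Phi> (Cod B f)) \<and>
        h \<in> Arr (Ps0 \<Phi> (Dom B f)) \<and> Cod (Ps0 \<Phi> (Dom B f)) h = OMap (Ps1 \<Phi> f) E},
     Dom = (\<lambda>(f, h, E). (Dom B f, Dom (Ps0 \<Phi> (Dom B f)) h)),
     Cod = (\<lambda>(f, h, E). (Cod B f, E)),
     Ide = (\<lambda>(A, E). (Ide B A, NComp (PsUnit \<Phi> A) E, E)),
     Comp = (\<lambda>(g, k, F) (f, h, E). (Comp B g f,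
        Comp (Ps0 \<Phi> (Dom B f)) (NComp (PsComp \<Phi> f g) F)
          (Comp (Ps0 \<Phi> (Dom B f)) (AMap (Ps1 \<Phi> f) k) h), F))\<rparr>"

definition groth_proj :: "('b, 'w) cat
    \<Rightarrow> ('b, 'w, ('o, 'a) cat, ('o, 'a, 'o, 'a) funct, ('o, 'a, 'o, 'a) nattr) psfun
    \<Rightarrow> ('b \<times> 'o, 'w \<times> 'a \<times> 'o, 'b, 'w) funct" where
  "groth_proj B \<Phi> = \<lparr>Src = groth B \<Phi>, Tgt = B,
     OMap = restrict fst (Obj (groth B \<Phi>)), AMap = restrict fst (Arr (groth B \<Phi>))\<rparr>"

text \<open>The functor induced by a strict transformation \<open>\<tau> : \<Phi> \<Rightarrow> \<Psi>\<close> with components \<open>\<tau> A : \<Phi> A \<rightarrow> \<Psi> A\<close>.\<close>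

definition groth_map :: "('b, 'w) cat
    \<Rightarrow> ('b, 'w, ('e, 'u) cat, ('e, 'u, 'e, 'u) funct, ('e, 'u, 'e, 'u) nattr) psfun
    \<Rightarrow> ('b, 'w, ('d, 'v) cat, ('d, 'v, 'd, 'v) funct, ('d, 'v, 'd, 'v) nattr) psfun
    \<Rightarrow> ('b \<Rightarrow> ('e, 'u, 'd, 'v) funct)
    \<Rightarrow> ('b \<times> 'e, 'w \<times> 'u \<times> 'e, 'b \<times> 'd, 'w \<times> 'v \<times> 'd) funct" where
  "groth_map B \<Phi> \<Psi> \<tau> = \<lparr>Src = groth B \<Phi>, Tgt = groth B \<Psi>,
     OMap = (\<lambda>(A, E)\<in>Obj (groth B \<Phi>). (A, OMap (\<tau> A) E)),
     AMap = (\<lambda>(f, h, E)\<in>Arr (groth B \<Phi>).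
       (f, AMap (\<tau> (Dom B f)) h, OMap (\<tau> (Cod B f)) E))\<rparr>"

definition Q_of :: "('b, 'w) cat
    \<Rightarrow> ('b, 'w, ('e, 'u, 'd, 'v) funct, ('e, 'u, 'd, 'v) square, ('e, 'u, 'd, 'v) square2) psfun
    \<Rightarrow> ('b \<times> 'e, 'w \<times> 'u \<times> 'e, 'b \<times> 'd, 'w \<times> 'v \<times> 'd) funct" where
  "Q_of B \<Xi> = groth_map B (ps_postcomp dom_2functor \<Xi>) (ps_postcomp cod_2functor \<Xi>) (Ps0 \<Xi>)"

definition P_of :: "('b, 'w) cat
    \<Rightarrow> ('b, 'w, ('e, 'u, 'd, 'v) funct, ('e, 'u, 'd, 'v) square, ('e, 'u, 'd, 'v) square2) psfun
    \<Rightarrow> ('b \<times> 'd, 'w \<times> 'v \<times> 'd, 'b, 'w) funct" where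
  "P_of B \<Xi> = groth_proj B (ps_postcomp cod_2functor \<Xi>)"


section \<open>The pseudo-functor of a cloven composable pair\<close>

definition cleavage :: "('d, 'v, 'b, 'w) funct \<Rightarrow> ('w \<Rightarrow> 'd \<Rightarrow> 'v) \<Rightarrow> bool" where
  "cleavage P c \<longleftrightarrow>
     (\<forall>y\<in>Obj (Src P). \<forall>f\<in>Arr (Tgt P). Cod (Tgt P) f = OMap P y \<longrightarrow>
        cartesian P (c f y) \<and> Cod (Src P) (c f y) = y \<and> AMap P (c f y) = f)"

definition comp_cleavage ::
    "('e, 'u, 'd, 'v) funct \<Rightarrow> ('w \<Rightarrow> 'd \<Rightarrow> 'v) \<Rightarrow> ('v \<Rightarrow> 'e \<Rightarrow> 'u) \<Rightarrow> 'w \<Rightarrow> 'e \<Rightarrow> 'u" where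
  "comp_cleavage Q cP cQ f y = cQ (cP f (OMap Q y)) y"

definition fibre :: "('d, 'v, 'b, 'w) funct \<Rightarrow> 'b \<Rightarrow> ('d, 'v) cat" where
  "fibre P A = (Src P)\<lparr>Obj := {y \<in> Obj (Src P). OMap P y = A},
     Arr := {u \<in> Arr (Src P). AMap P u = Ide (Tgt P) A}\<rparr>"

text \<open>The vertical arrow through which \<open>v\<close> factors over a Cartesian \<open>u\<close> with \<open>P u = P v\<close>.\<close>

definition vfactor :: "('d, 'v, 'b, 'w) funct \<Rightarrow> 'v \<Rightarrow> 'v \<Rightarrow> 'v" where
  "vfactor P u v = (THE x. x \<in> Hom (Src P) (Dom (Src P) v) (Dom (Src P) u) \<and>
     AMap P x = Ide (Tgt P) (OMap P (Dom (Src P) u)) \<and> Comp (Src P) u x = v)"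

definition inverse_image :: "('d, 'v, 'b, 'w) funct \<Rightarrow> ('w \<Rightarrow> 'd \<Rightarrow> 'v) \<Rightarrow> 'w
    \<Rightarrow> ('d, 'v, 'd, 'v) funct" where
  "inverse_image P c f = \<lparr>Src = fibre P (Cod (Tgt P) f), Tgt = fibre P (Dom (Tgt P) f),
     OMap = (\<lambda>y\<in>Obj (fibre P (Cod (Tgt P) f)). Dom (Src P) (c f y)),
     AMap = (\<lambda>h\<in>Arr (fibre P (Cod (Tgt P) f)).
       vfactor P (c f (Cod (Src P) h)) (Comp (Src P) h (c f (Dom (Src P) h))))\<rparr>"

definition inverse_image_unit :: "('d, 'v, 'b, 'w) funct \<Rightarrow> ('w \<Rightarrow> 'd \<Rightarrow> 'v) \<Rightarrow> 'b
    \<Rightarrow> ('d, 'v, 'd, 'v) nattr" where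
  "inverse_image_unit P c A = \<lparr>NSrc = fid (fibre P A), NTgt = inverse_image P c (Ide (Tgt P) A),
     NComp = (\<lambda>y\<in>Obj (fibre P A). vfactor P (c (Ide (Tgt P) A) y) (Ide (Src P) y))\<rparr>"

text \<open>For \<open>f : A \<rightarrow> B\<close> and \<open>g : B \<rightarrow> C\<close>, this is \<open>f\<^sup>* \<circ> g\<^sup>* \<Rightarrow> (g \<circ> f)\<^sup>*\<close>.\<close>

definition inverse_image_comp :: "('d, 'v, 'b, 'w) funct \<Rightarrow> ('w \<Rightarrow> 'd \<Rightarrow> 'v) \<Rightarrow> 'w \<Rightarrow> 'w
    \<Rightarrow> ('d, 'v, 'd, 'v) nattr" where
  "inverse_image_comp P c f g = \<lparr>
     NSrc = fcomp (inverse_image P c f) (inverse_image P c g),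
     NTgt = inverse_image P c (Comp (Tgt P) g f),
     NComp = (\<lambda>y\<in>Obj (fibre P (Cod (Tgt P) g)).
       vfactor P (c (Comp (Tgt P) g f) y) (Comp (Src P) (c g y) (c f (Dom (Src P) (c g y)))))\<rparr>"

definition fibre_functor :: "('e, 'u, 'd, 'v) funct \<Rightarrow> ('d, 'v, 'b, 'w) funct \<Rightarrow> 'b
    \<Rightarrow> ('e, 'u, 'd, 'v) funct" where
  "fibre_functor Q P A = \<lparr>Src = fibre (fcomp P Q) A, Tgt = fibre P A,
     OMap = restrict (OMap Q) (Obj (fibre (fcomp P Q) A)),
     AMap = restrict (AMap Q) (Arr (fibre (fcomp P Q) A))\<rparr>"

definition Xi_sq :: "('e, 'u, 'd, 'v) funct \<Rightarrow> ('d, 'v, 'b, 'w) funct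
    \<Rightarrow> ('w \<Rightarrow> 'd \<Rightarrow> 'v) \<Rightarrow> ('v \<Rightarrow> 'e \<Rightarrow> 'u) \<Rightarrow> 'w \<Rightarrow> ('e, 'u, 'd, 'v) square" where
  "Xi_sq Q P cP cQ f = \<lparr>
     SqSrc = fibre_functor Q P (Cod (Tgt P) f), SqTgt = fibre_functor Q P (Dom (Tgt P) f),
     SqTop = inverse_image (fcomp P Q) (comp_cleavage Q cP cQ) f, SqBot = inverse_image P cP f\<rparr>"

definition Xi_of :: "('e, 'u, 'd, 'v) funct \<Rightarrow> ('d, 'v, 'b, 'w) funct
    \<Rightarrow> ('w \<Rightarrow> 'd \<Rightarrow> 'v) \<Rightarrow> ('v \<Rightarrow> 'e \<Rightarrow> 'u)
    \<Rightarrow> ('b, 'w, ('e, 'u, 'd, 'v) funct, ('e, 'u, 'd, 'v) square, ('e, 'u, 'd, 'v) square2) psfun" where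
  "Xi_of Q P cP cQ = \<lparr>
     Ps0 = fibre_functor Q P,
     Ps1 = Xi_sq Q P cP cQ,
     PsUnit = (\<lambda>A. \<lparr>
       Sq2Src = sq_id (fibre_functor Q P A),
       Sq2Tgt = Xi_sq Q P cP cQ (Ide (Tgt P) A),
       Sq2Top = inverse_image_unit (fcomp P Q) (comp_cleavage Q cP cQ) A,
       Sq2Bot = inverse_image_unit P cP A\<rparr>),
     PsComp = (\<lambda>f g. \<lparr>
       Sq2Src = sq_comp (Xi_sq Q P cP cQ f) (Xi_sq Q P cP cQ g),
       Sq2Tgt = Xi_sq Q P cP cQ (Comp (Tgt P) g f),
       Sq2Top = inverse_image_comp (fcomp P Q) (comp_cleavage Q cP cQ) f g,
       Sq2Bot = inverse_image_comp P cP f g\<rparr>)\<rparr>"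

end

theory Submission
  imports Defs
begin

text \<open>
  A pseudo-functor \<open>\<Xi>\<close> into the 2-category of fibrations amounts to two pseudo-functors into \<open>CAT\<close>,
  its domain and codomain parts, and a strict transformation between them whose components are
  fibrations and whose naturality squares preserve Cartesian arrows.

  The Grothendieck construction of each part is a category, and the projection of the codomain part
  is a fibration: \<open>(f, id, E)\<close> is Cartesian, because factoring through it only requires inverting a
  structure cell (\<open>groth_proj_fibration\<close>). For \<open>Q\<^sub>\<Xi>\<close>, an arrow \<open>(f, k, Q E)\<close> of the base is lifted by
  lifting \<open>k\<close> inside the fibre to a Cartesian \<open>h\<close> and taking \<open>(f, h, E)\<close>. A factorisation problem for
  this arrow, posed over an arrow \<open>p\<close>, becomes a factorisation problem for the reindexed arrow
  \<open>p\<^sup>* h\<close> in a single fibre. That problem has a unique solution because reindexing preserves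
  Cartesian arrows (\<open>groth_map_cartesian\<close>).

  Conversely, the fibres of a cloven fibration form a pseudo-functor into \<open>CAT\<close>
  (\<open>fibre_pseudo_functor\<close>). All its laws compare vertical arrows into the domain of a Cartesian arrow,
  and two such arrows are equal as soon as their composites with the Cartesian arrow are. For a
  composable pair this is applied to \<open>P\<close> and to \<open>P \<circ> Q\<close>, and \<open>\<Xi>\<^sub>Q\<close> has these two pseudo-functors as its parts. They fit together because
  \<open>Q\<close> sends the chosen lifts, and hence the factorisations through them, to the chosen lifts and
  factorisations for \<open>P\<close> (\<open>image_vfactor\<close>). Reindexing preserves Cartesian arrows of the fibres
  because these are exactly the \<open>Q\<close>-Cartesian arrows that lie in a fibre (\<open>cartesian_fibre_functor\<close>,
  \<open>fibre_cartesian_cartesian\<close>).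

  Finally, for a cloven fibration with cleavage \<open>c\<close>, the comparison \<open>(f, h, E) \<mapsto> c f E \<circ> h\<close> from the
  Grothendieck construction of its fibres to its total category is bijective on arrows, as every arrow
  is uniquely a vertical arrow followed by a chosen lift (\<open>fibre_comparison_iso\<close>). The comparisons for
  \<open>P \<circ> Q\<close> and for \<open>P\<close> form the required isomorphism of pairs.

  The target of a pseudo-functor has to be a 2-category, so \<open>FIBc\<close> is shown to be one: its equations
  hold separately for the two functors or transformations that make up a cell.
\<close>

section \<open>Equational calculus of functors and natural transformations\<close>

context category
begin

lemma ide_arr: "x \<in> Obj C \<Longrightarrow> Ide C x \<in> Arr C"
  and ide_dom: "x \<in> Obj C \<Longrightarrow> Dom C (Ide C x) = x"
  and ide_cod: "x \<in> Obj C \<Longrightarrow> Cod C (Ide C x) = x"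
  using ide_hom[of x] by (simp_all add: Hom_def)

lemma comp_arr: "f \<in> Arr C \<Longrightarrow> g \<in> Arr C \<Longrightarrow> Cod C f = Dom C g \<Longrightarrow> Comp C g f \<in> Arr C"
  and comp_dom: "f \<in> Arr C \<Longrightarrow> g \<in> Arr C \<Longrightarrow> Cod C f = Dom C g \<Longrightarrow> Dom C (Comp C g f) = Dom C f"
  and comp_cod: "f \<in> Arr C \<Longrightarrow> g \<in> Arr C \<Longrightarrow> Cod C f = Dom C g \<Longrightarrow> Cod C (Comp C g f) = Cod C g"
  using comp_hom[of f "Dom C f" "Cod C f" g "Cod C g"] by (simp_all add: Hom_def)

lemma comp_ide_dom: "f \<in> Arr C \<Longrightarrow> Dom C f = x \<Longrightarrow> Comp C f (Ide C x) = f"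
  and comp_ide_cod: "f \<in> Arr C \<Longrightarrow> Cod C f = x \<Longrightarrow> Comp C (Ide C x) f = f"
  using comp_ide_right[of f x "Cod C f"] comp_ide_left[of f "Dom C f" x] by (simp_all add: Hom_def)

lemma assoc: "f \<in> Arr C \<Longrightarrow> g \<in> Arr C \<Longrightarrow> h \<in> Arr C \<Longrightarrow> Cod C f = Dom C g \<Longrightarrow> Cod C g = Dom C h
   \<Longrightarrow> Comp C (Comp C h g) f = Comp C h (Comp C g f)"
  using comp_assoc[of f "Dom C f" "Cod C f" g "Cod C g" h "Cod C h"] by (simp add: Hom_def)

end

lemmas cat_rules = category.dom_obj category.cod_obj category.ide_arr category.ide_dom
  category.ide_cod category.comp_arr category.comp_dom category.comp_cod
  category.comp_ide_dom category.comp_ide_cod category.assoc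

lemmas cat_boundary = category.dom_obj category.cod_obj category.ide_arr category.ide_dom
  category.ide_cod category.comp_arr category.comp_dom category.comp_cod

text \<open>Replaces the left two factors of a right-nested composite along a commuting square.\<close>

lemma (in category) square_comp:
  assumes "Comp C a b = Comp C c d" "x \<in> Arr C" "b \<in> Arr C" "d \<in> Arr C" "a \<in> Arr C" "c \<in> Arr C"
    and "Cod C x = Dom C b" "Cod C b = Dom C a" "Cod C x = Dom C d" "Cod C d = Dom C c"
  shows "Comp C a (Comp C b x) = Comp C c (Comp C d x)"
  using assms by (simp flip: assoc)

lemma categoryI:
  assumes "\<And>f. f \<in> Arr C \<Longrightarrow> Dom C f \<in> Obj C" "\<And>f. f \<in> Arr C \<Longrightarrow> Cod C f \<in> Obj C"
    and "\<And>x. x \<in> Obj C \<Longrightarrow> Ide C x \<in> Arr C \<and> Dom C (Ide C x) = x \<and> Cod C (Ide C x) = x"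
    and "\<And>f g. f \<in> Arr C \<Longrightarrow> g \<in> Arr C \<Longrightarrow> Cod C f = Dom C g \<Longrightarrow>
      Comp C g f \<in> Arr C \<and> Dom C (Comp C g f) = Dom C f \<and> Cod C (Comp C g f) = Cod C g"
    and "\<And>f. f \<in> Arr C \<Longrightarrow> Comp C f (Ide C (Dom C f)) = f"
    and "\<And>f. f \<in> Arr C \<Longrightarrow> Comp C (Ide C (Cod C f)) f = f"
    and "\<And>f g h. f \<in> Arr C \<Longrightarrow> g \<in> Arr C \<Longrightarrow> h \<in> Arr C \<Longrightarrow> Cod C f = Dom C g \<Longrightarrow>
      Cod C g = Dom C h \<Longrightarrow> Comp C h (Comp C g f) = Comp C (Comp C h g) f"
  shows "category C"
  using assms by (intro category.intro) (auto simp: Hom_def)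

context cat_functor
begin

lemma amap_arr: "f \<in> Arr (Src F) \<Longrightarrow> AMap F f \<in> Arr (Tgt F)"
  and amap_dom: "f \<in> Arr (Src F) \<Longrightarrow> Dom (Tgt F) (AMap F f) = OMap F (Dom (Src F) f)"
  and amap_cod: "f \<in> Arr (Src F) \<Longrightarrow> Cod (Tgt F) (AMap F f) = OMap F (Cod (Src F) f)"
  using amap_hom[of f "Dom (Src F) f" "Cod (Src F) f"] by (simp_all add: Hom_def)

lemma amap_comp_arr: "f \<in> Arr (Src F) \<Longrightarrow> g \<in> Arr (Src F) \<Longrightarrow> Cod (Src F) f = Dom (Src F) g
   \<Longrightarrow> AMap F (Comp (Src F) g f) = Comp (Tgt F) (AMap F g) (AMap F f)"
  using amap_comp[of f "Dom (Src F) f" "Cod (Src F) f" g "Cod (Src F) g"] by (simp add: Hom_def)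

end

lemmas fun_rules = cat_functor.src_category cat_functor.tgt_category cat_functor.omap_obj
  cat_functor.amap_arr cat_functor.amap_dom cat_functor.amap_cod cat_functor.amap_ide
  cat_functor.amap_comp_arr

lemma cat_functorI:
  assumes "category (Src F)" "category (Tgt F)"
    and "\<And>x. x \<in> Obj (Src F) \<Longrightarrow> OMap F x \<in> Obj (Tgt F)"
    and "\<And>f. f \<in> Arr (Src F) \<Longrightarrow> AMap F f \<in> Arr (Tgt F) \<and>
      Dom (Tgt F) (AMap F f) = OMap F (Dom (Src F) f) \<and>
      Cod (Tgt F) (AMap F f) = OMap F (Cod (Src F) f)"
    and "\<And>x. x \<in> Obj (Src F) \<Longrightarrow> AMap F (Ide (Src F) x) = Ide (Tgt F) (OMap F x)"
    and "\<And>f g. f \<in> Arr (Src F) \<Longrightarrow> g \<in> Arr (Src F) \<Longrightarrow> Cod (Src F) f = Dom (Src F) g \<Longrightarrow>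
      AMap F (Comp (Src F) g f) = Comp (Tgt F) (AMap F g) (AMap F f)"
    and "OMap F \<in> extensional (Obj (Src F))" "AMap F \<in> extensional (Arr (Src F))"
  shows "cat_functor F"
  using assms by (intro cat_functor.intro) (auto simp: Hom_def)

lemma functor_eqI:
  assumes "cat_functor F" "cat_functor G" "Src F = Src G" "Tgt F = Tgt G"
    and "\<And>x. x \<in> Obj (Src G) \<Longrightarrow> OMap F x = OMap G x"
    and "\<And>f. f \<in> Arr (Src G) \<Longrightarrow> AMap F f = AMap G f"
  shows "F = G"
proof -
  have "OMap F = OMap G" "AMap F = AMap G"
    using assms cat_functor.omap_extensional[of F] cat_functor.omap_extensional[of G]
      cat_functor.amap_extensional[of F] cat_functor.amap_extensional[of G]
    by (auto intro: extensionalityI)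
  then show ?thesis using assms by (cases F, cases G) simp
qed

lemma fid_simps [simp]:
  "Src (fid C) = C" "Tgt (fid C) = C" "x \<in> Obj C \<Longrightarrow> OMap (fid C) x = x"
  "f \<in> Arr C \<Longrightarrow> AMap (fid C) f = f"
  by (simp_all add: fid_def)

lemma fcomp_simps [simp]:
  "Src (fcomp G F) = Src F" "Tgt (fcomp G F) = Tgt G"
  "x \<in> Obj (Src F) \<Longrightarrow> OMap (fcomp G F) x = OMap G (OMap F x)"
  "f \<in> Arr (Src F) \<Longrightarrow> AMap (fcomp G F) f = AMap G (AMap F f)"
  by (simp_all add: fcomp_def compose_def)

lemma fid_functor: "category C \<Longrightarrow> cat_functor (fid C)"
  by (rule cat_functorI) (auto simp: cat_rules, auto simp: fid_def)

lemma fcomp_functor: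
  assumes "cat_functor F" "cat_functor G" "Src G = Tgt F"
  shows "cat_functor (fcomp G F)"
proof (rule cat_functorI)
  show "OMap (fcomp G F) \<in> extensional (Obj (Src (fcomp G F)))"
    "AMap (fcomp G F) \<in> extensional (Arr (Src (fcomp G F)))"
    by (simp_all add: fcomp_def compose_def)
qed (use assms fun_rules[OF assms(1)] fun_rules[OF assms(2)] in
      \<open>auto simp: cat_rules\<close>)

lemma fcomp_fid_right: "cat_functor F \<Longrightarrow> Src F = C \<Longrightarrow> fcomp F (fid C) = F"
  by (rule functor_eqI) (auto intro!: fcomp_functor fid_functor simp: fun_rules)

lemma fcomp_fid_left: "cat_functor F \<Longrightarrow> Tgt F = C \<Longrightarrow> fcomp (fid C) F = F"
  by (rule functor_eqI) (auto intro!: fcomp_functor fid_functor simp: fun_rules)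

lemma fcomp_assoc:
  assumes "cat_functor F" "cat_functor G" "cat_functor H" "Src G = Tgt F" "Src H = Tgt G"
  shows "fcomp H (fcomp G F) = fcomp (fcomp H G) F"
  by (rule functor_eqI) (use assms in \<open>auto intro!: fcomp_functor simp: fun_rules\<close>)

context nat_trans
begin

lemma ncomp_arr: "x \<in> Obj (Src (NSrc t)) \<Longrightarrow> NComp t x \<in> Arr (Tgt (NSrc t))"
  and ncomp_dom: "x \<in> Obj (Src (NSrc t)) \<Longrightarrow> Dom (Tgt (NSrc t)) (NComp t x) = OMap (NSrc t) x"
  and ncomp_cod: "x \<in> Obj (Src (NSrc t)) \<Longrightarrow> Cod (Tgt (NSrc t)) (NComp t x) = OMap (NTgt t) x"
  using ncomp_hom[of x] by (simp_all add: Hom_def)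

lemma naturality_arr: "f \<in> Arr (Src (NSrc t)) \<Longrightarrow>
    Comp (Tgt (NSrc t)) (NComp t (Cod (Src (NSrc t)) f)) (AMap (NSrc t) f)
    = Comp (Tgt (NSrc t)) (AMap (NTgt t) f) (NComp t (Dom (Src (NSrc t)) f))"
  using naturality[of f "Dom (Src (NSrc t)) f" "Cod (Src (NSrc t)) f"] by (simp add: Hom_def)

lemma src_cat: "category (Src (NSrc t))"
  and tgt_cat: "category (Tgt (NSrc t))"
  using fun_rules[OF nsrc_functor] by simp_all

lemma nsrc_omap: "x \<in> Obj (Src (NSrc t)) \<Longrightarrow> OMap (NSrc t) x \<in> Obj (Tgt (NSrc t))"
  and nsrc_amap_arr: "f \<in> Arr (Src (NSrc t)) \<Longrightarrow> AMap (NSrc t) f \<in> Arr (Tgt (NSrc t))"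
  and nsrc_amap_dom: "f \<in> Arr (Src (NSrc t)) \<Longrightarrow>
    Dom (Tgt (NSrc t)) (AMap (NSrc t) f) = OMap (NSrc t) (Dom (Src (NSrc t)) f)"
  and nsrc_amap_cod: "f \<in> Arr (Src (NSrc t)) \<Longrightarrow>
    Cod (Tgt (NSrc t)) (AMap (NSrc t) f) = OMap (NSrc t) (Cod (Src (NSrc t)) f)"
  and nsrc_amap_ide: "x \<in> Obj (Src (NSrc t)) \<Longrightarrow>
    AMap (NSrc t) (Ide (Src (NSrc t)) x) = Ide (Tgt (NSrc t)) (OMap (NSrc t) x)"
  and nsrc_amap_comp: "f \<in> Arr (Src (NSrc t)) \<Longrightarrow> g \<in> Arr (Src (NSrc t)) \<Longrightarrow>
    Cod (Src (NSrc t)) f = Dom (Src (NSrc t)) g \<Longrightarrow>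
    AMap (NSrc t) (Comp (Src (NSrc t)) g f) = Comp (Tgt (NSrc t)) (AMap (NSrc t) g) (AMap (NSrc t) f)"
  using fun_rules[OF nsrc_functor] by simp_all

lemma ntgt_omap: "x \<in> Obj (Src (NSrc t)) \<Longrightarrow> OMap (NTgt t) x \<in> Obj (Tgt (NSrc t))"
  and ntgt_amap_arr: "f \<in> Arr (Src (NSrc t)) \<Longrightarrow> AMap (NTgt t) f \<in> Arr (Tgt (NSrc t))"
  and ntgt_amap_dom: "f \<in> Arr (Src (NSrc t)) \<Longrightarrow>
    Dom (Tgt (NSrc t)) (AMap (NTgt t) f) = OMap (NTgt t) (Dom (Src (NSrc t)) f)"
  and ntgt_amap_cod: "f \<in> Arr (Src (NSrc t)) \<Longrightarrow>
    Cod (Tgt (NSrc t)) (AMap (NTgt t) f) = OMap (NTgt t) (Cod (Src (NSrc t)) f)"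
  and ntgt_amap_ide: "x \<in> Obj (Src (NSrc t)) \<Longrightarrow>
    AMap (NTgt t) (Ide (Src (NSrc t)) x) = Ide (Tgt (NSrc t)) (OMap (NTgt t) x)"
  and ntgt_amap_comp: "f \<in> Arr (Src (NSrc t)) \<Longrightarrow> g \<in> Arr (Src (NSrc t)) \<Longrightarrow>
    Cod (Src (NSrc t)) f = Dom (Src (NSrc t)) g \<Longrightarrow>
    AMap (NTgt t) (Comp (Src (NSrc t)) g f) = Comp (Tgt (NSrc t)) (AMap (NTgt t) g) (AMap (NTgt t) f)"
  using fun_rules[OF ntgt_functor] by (simp_all add: parallel_src parallel_tgt)

end

lemmas nt_rules = nat_trans.nsrc_functor nat_trans.ntgt_functor nat_trans.parallel_src
  nat_trans.parallel_tgt nat_trans.src_cat nat_trans.tgt_cat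
  nat_trans.ncomp_arr nat_trans.ncomp_dom nat_trans.ncomp_cod
  nat_trans.nsrc_omap nat_trans.nsrc_amap_arr nat_trans.nsrc_amap_dom nat_trans.nsrc_amap_cod
  nat_trans.nsrc_amap_ide nat_trans.nsrc_amap_comp
  nat_trans.ntgt_omap nat_trans.ntgt_amap_arr nat_trans.ntgt_amap_dom nat_trans.ntgt_amap_cod
  nat_trans.ntgt_amap_ide nat_trans.ntgt_amap_comp

lemma nat_transI:
  assumes "cat_functor (NSrc t)" "cat_functor (NTgt t)"
    and "Src (NTgt t) = Src (NSrc t)" "Tgt (NTgt t) = Tgt (NSrc t)"
    and "\<And>x. x \<in> Obj (Src (NSrc t)) \<Longrightarrow> NComp t x \<in> Arr (Tgt (NSrc t)) \<and>
      Dom (Tgt (NSrc t)) (NComp t x) = OMap (NSrc t) x \<and>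
      Cod (Tgt (NSrc t)) (NComp t x) = OMap (NTgt t) x"
    and "\<And>f. f \<in> Arr (Src (NSrc t)) \<Longrightarrow>
      Comp (Tgt (NSrc t)) (NComp t (Cod (Src (NSrc t)) f)) (AMap (NSrc t) f)
      = Comp (Tgt (NSrc t)) (AMap (NTgt t) f) (NComp t (Dom (Src (NSrc t)) f))"
    and "NComp t \<in> extensional (Obj (Src (NSrc t)))"
  shows "nat_trans t"
  using assms by (intro nat_trans.intro) (auto simp: Hom_def)

lemma nat_trans_eqI:
  assumes "nat_trans s" "nat_trans t" "NSrc s = NSrc t" "NTgt s = NTgt t"
    and "\<And>x. x \<in> Obj (Src (NSrc t)) \<Longrightarrow> NComp s x = NComp t x"
  shows "s = t"
proof -
  have "NComp s = NComp t"
    using assms nat_trans.ncomp_extensional[of s] nat_trans.ncomp_extensional[of t]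
    by (auto intro: extensionalityI)
  then show ?thesis using assms by (cases s, cases t) simp
qed

lemma nid_simps [simp]:
  "NSrc (nid F) = F" "NTgt (nid F) = F"
  "x \<in> Obj (Src F) \<Longrightarrow> NComp (nid F) x = Ide (Tgt F) (OMap F x)"
  by (simp_all add: nid_def)

lemma nvcomp_simps [simp]:
  "NSrc (nvcomp t s) = NSrc s" "NTgt (nvcomp t s) = NTgt t"
  "x \<in> Obj (Src (NSrc s)) \<Longrightarrow>
    NComp (nvcomp t s) x = Comp (Tgt (NSrc s)) (NComp t x) (NComp s x)"
  by (simp_all add: nvcomp_def)

lemma nhcomp_simps [simp]:
  "NSrc (nhcomp t s) = fcomp (NSrc t) (NSrc s)" "NTgt (nhcomp t s) = fcomp (NTgt t) (NTgt s)"
  "x \<in> Obj (Src (NSrc s)) \<Longrightarrow> NComp (nhcomp t s) x =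
    Comp (Tgt (NSrc t)) (NComp t (OMap (NTgt s) x)) (AMap (NSrc t) (NComp s x))"
  by (simp_all add: nhcomp_def)

lemma nid_nat_trans: "cat_functor F \<Longrightarrow> nat_trans (nid F)"
  by (rule nat_transI) (auto simp: fun_rules cat_rules, auto simp: nid_def)

lemma nvcomp_nat_trans:
  assumes s: "nat_trans s" and t: "nat_trans t" and st: "NSrc t = NTgt s"
  shows "nat_trans (nvcomp t s)"
proof (rule nat_transI)
  note [simp] = nt_rules[OF s] nt_rules[OF t, unfolded st nt_rules(3,4)[OF s]]
  show "NComp (nvcomp t s) \<in> extensional (Obj (Src (NSrc (nvcomp t s))))"
    by (simp add: nvcomp_def)
  fix f assume "f \<in> Arr (Src (NSrc (nvcomp t s)))"
  then have f [simp]: "f \<in> Arr (Src (NSrc s))" by simp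
  let ?C = "Tgt (NSrc s)" and ?x = "Dom (Src (NSrc s)) f" and ?y = "Cod (Src (NSrc s)) f"
  have [simp]: "?x \<in> Obj (Src (NSrc s))" "?y \<in> Obj (Src (NSrc s))" by (simp_all add: cat_rules)
  have "Comp ?C (Comp ?C (NComp t ?y) (NComp s ?y)) (AMap (NSrc s) f)
      = Comp ?C (NComp t ?y) (Comp ?C (NComp s ?y) (AMap (NSrc s) f))"
    by (simp add: cat_rules)
  also have "\<dots> = Comp ?C (NComp t ?y) (Comp ?C (AMap (NTgt s) f) (NComp s ?x))"
    using nat_trans.naturality_arr[OF s] by simp
  also have "\<dots> = Comp ?C (Comp ?C (NComp t ?y) (AMap (NTgt s) f)) (NComp s ?x)"
    by (simp add: cat_rules)
  also have "\<dots> = Comp ?C (Comp ?C (AMap (NTgt t) f) (NComp t ?x)) (NComp s ?x)"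
    using nat_trans.naturality_arr[OF t] by (simp add: st)
  also have "\<dots> = Comp ?C (AMap (NTgt t) f) (Comp ?C (NComp t ?x) (NComp s ?x))"
    by (simp add: category.assoc)
  finally show "Comp (Tgt (NSrc (nvcomp t s))) (NComp (nvcomp t s) (Cod (Src (NSrc (nvcomp t s))) f))
        (AMap (NSrc (nvcomp t s)) f)
      = Comp (Tgt (NSrc (nvcomp t s))) (AMap (NTgt (nvcomp t s)) f)
        (NComp (nvcomp t s) (Dom (Src (NSrc (nvcomp t s))) f))"
    by simp
qed (use nt_rules[OF s] nt_rules[OF t, unfolded st nt_rules(3,4)[OF s]] in
    \<open>simp_all add: cat_rules\<close>)

lemma nhcomp_nat_trans:
  assumes s: "nat_trans s" and t: "nat_trans t" and st: "Src (NSrc t) = Tgt (NSrc s)"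
  shows "nat_trans (nhcomp t s)"
proof (rule nat_transI)
  note [simp] = nt_rules[OF s] nt_rules[OF t, unfolded st]
  show "NComp (nhcomp t s) \<in> extensional (Obj (Src (NSrc (nhcomp t s))))"
    by (simp add: nhcomp_def)
  show "cat_functor (NSrc (nhcomp t s))" "cat_functor (NTgt (nhcomp t s))"
    by (simp_all add: st fcomp_functor)
  fix f assume "f \<in> Arr (Src (NSrc (nhcomp t s)))"
  then have f [simp]: "f \<in> Arr (Src (NSrc s))" by simp
  let ?C = "Tgt (NSrc t)" and ?x = "Dom (Src (NSrc s)) f" and ?y = "Cod (Src (NSrc s)) f"
  have [simp]: "?x \<in> Obj (Src (NSrc s))" "?y \<in> Obj (Src (NSrc s))" by (simp_all add: cat_rules)
  have "Comp ?C (Comp ?C (NComp t (OMap (NTgt s) ?y)) (AMap (NSrc t) (NComp s ?y)))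
          (AMap (NSrc t) (AMap (NSrc s) f))
      = Comp ?C (NComp t (OMap (NTgt s) ?y))
          (AMap (NSrc t) (Comp (Tgt (NSrc s)) (NComp s ?y) (AMap (NSrc s) f)))"
    by (simp add: category.assoc)
  also have "\<dots> = Comp ?C (NComp t (OMap (NTgt s) ?y))
          (AMap (NSrc t) (Comp (Tgt (NSrc s)) (AMap (NTgt s) f) (NComp s ?x)))"
    using nat_trans.naturality_arr[OF s] by simp
  also have "\<dots> = Comp ?C (Comp ?C (NComp t (OMap (NTgt s) ?y)) (AMap (NSrc t) (AMap (NTgt s) f)))
         (AMap (NSrc t) (NComp s ?x))"
    by (simp add: category.assoc)
  also have "\<dots> = Comp ?C (Comp ?C (AMap (NTgt t) (AMap (NTgt s) f)) (NComp t (OMap (NTgt s) ?x)))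
         (AMap (NSrc t) (NComp s ?x))"
    using nat_trans.naturality_arr[OF t, of "AMap (NTgt s) f"] by (simp add: st)
  also have "\<dots> = Comp ?C (AMap (NTgt t) (AMap (NTgt s) f)) (Comp ?C (NComp t (OMap (NTgt s) ?x))
         (AMap (NSrc t) (NComp s ?x)))"
    by (simp add: category.assoc)
  finally show "Comp (Tgt (NSrc (nhcomp t s))) (NComp (nhcomp t s) (Cod (Src (NSrc (nhcomp t s))) f))
        (AMap (NSrc (nhcomp t s)) f)
      = Comp (Tgt (NSrc (nhcomp t s))) (AMap (NTgt (nhcomp t s)) f)
        (NComp (nhcomp t s) (Dom (Src (NSrc (nhcomp t s))) f))"
    by simp
qed (use st nt_rules[OF s] nt_rules[OF t, unfolded st] in \<open>simp_all add: cat_rules\<close>)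

lemma nvcomp_nid_right:
  assumes t: "nat_trans t" and "NSrc t = F" shows "nvcomp t (nid F) = t"
  by (rule nat_trans_eqI)
    (use assms nt_rules[OF t] in \<open>auto intro!: nvcomp_nat_trans nid_nat_trans simp: cat_rules\<close>)

lemma nvcomp_nid_left:
  assumes t: "nat_trans t" and "NTgt t = F" shows "nvcomp (nid F) t = t"
  by (rule nat_trans_eqI)
    (use assms nt_rules[OF t] in \<open>auto intro!: nvcomp_nat_trans nid_nat_trans simp: cat_rules\<close>)

lemma nvcomp_assoc:
  assumes r: "nat_trans r" and s: "nat_trans s" and t: "nat_trans t"
    and rs: "NSrc s = NTgt r" and st: "NSrc t = NTgt s"
  shows "nvcomp t (nvcomp s r) = nvcomp (nvcomp t s) r"
proof (rule nat_trans_eqI)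
  note s' = nt_rules[OF s, unfolded rs nt_rules(3,4)[OF r]]
  note t' = nt_rules[OF t, unfolded st s'(3,4)]
  fix x assume "x \<in> Obj (Src (NSrc (nvcomp (nvcomp t s) r)))"
  then show "NComp (nvcomp t (nvcomp s r)) x = NComp (nvcomp (nvcomp t s) r) x"
    using nt_rules[OF r] s' t' by (simp add: rs category.assoc)
qed (use assms in \<open>auto intro!: nvcomp_nat_trans\<close>)

lemma nhcomp_nid:
  assumes "cat_functor F" "cat_functor G" "Src G = Tgt F"
  shows "nhcomp (nid G) (nid F) = nid (fcomp G F)"
  by (rule nat_trans_eqI)
    (use assms fun_rules[OF assms(1)] fun_rules[OF assms(2)] in
      \<open>auto intro!: nhcomp_nat_trans nid_nat_trans fcomp_functor simp: cat_rules\<close>)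

lemma nhcomp_nid_right:
  assumes t: "nat_trans t" and "Src (NSrc t) = C"
  shows "nhcomp t (nid (fid C)) = t"
  by (rule nat_trans_eqI)
    (use assms nt_rules[OF t] in \<open>auto intro!: nhcomp_nat_trans nid_nat_trans fid_functor
      simp: cat_rules fcomp_fid_right fcomp_fid_left\<close>)

lemma nhcomp_nid_left:
  assumes t: "nat_trans t" and "Tgt (NSrc t) = D"
  shows "nhcomp (nid (fid D)) t = t"
  by (rule nat_trans_eqI)
    (use assms nt_rules[OF t] in \<open>auto intro!: nhcomp_nat_trans nid_nat_trans fid_functor
      simp: cat_rules fcomp_fid_right fcomp_fid_left\<close>)

lemma nhcomp_assoc:
  assumes r: "nat_trans r" and s: "nat_trans s" and t: "nat_trans t"
    and rs: "Src (NSrc s) = Tgt (NSrc r)" and st: "Src (NSrc t) = Tgt (NSrc s)"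
  shows "nhcomp t (nhcomp s r) = nhcomp (nhcomp t s) r"
proof (rule nat_trans_eqI)
  fix x assume "x \<in> Obj (Src (NSrc (nhcomp (nhcomp t s) r)))"
  then show "NComp (nhcomp t (nhcomp s r)) x = NComp (nhcomp (nhcomp t s) r) x"
    using nt_rules[OF r] nt_rules[OF s, unfolded rs] nt_rules[OF t, unfolded st]
    by (simp add: rs category.assoc)
qed (use assms nt_rules[OF r] nt_rules[OF s] nt_rules[OF t] in
    \<open>auto intro!: nhcomp_nat_trans fcomp_assoc\<close>)

lemma nat_interchange:
  assumes s: "nat_trans s" and s': "nat_trans s'" and t: "nat_trans t" and t': "nat_trans t'"
    and ss: "NSrc s' = NTgt s" and tt: "NSrc t' = NTgt t" and st: "Src (NSrc t) = Tgt (NSrc s)"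
  shows "nhcomp (nvcomp t' t) (nvcomp s' s) = nvcomp (nhcomp t' s') (nhcomp t s)"
proof (rule nat_trans_eqI)
  note [simp] = nt_rules[OF s] nt_rules[OF t, unfolded st]
    nt_rules[OF s', unfolded ss nt_rules(3,4)[OF s]]
    nt_rules[OF t', unfolded tt nt_rules(3,4)[OF t] st]
  show "nat_trans (nhcomp (nvcomp t' t) (nvcomp s' s))"
    "nat_trans (nvcomp (nhcomp t' s') (nhcomp t s))"
    using assms by (auto intro!: nhcomp_nat_trans nvcomp_nat_trans)
  fix x assume "x \<in> Obj (Src (NSrc (nvcomp (nhcomp t' s') (nhcomp t s))))"
  then have x [simp]: "x \<in> Obj (Src (NSrc s))" by simp
  let ?C = "Tgt (NSrc t)"
  \<comment> \<open>The middle square is naturality of \<open>t\<close> at the component of \<open>s'\<close>.\<close>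
  have "Comp ?C (NComp t (OMap (NTgt s') x)) (AMap (NSrc t) (NComp s' x))
      = Comp ?C (AMap (NTgt t) (NComp s' x)) (NComp t (OMap (NTgt s) x))"
    using nat_trans.naturality_arr[OF t, of "NComp s' x"] by (simp add: st)
  then have "Comp ?C (Comp ?C (NComp t (OMap (NTgt s') x)) (AMap (NSrc t) (NComp s' x)))
        (AMap (NSrc t) (NComp s x))
      = Comp ?C (Comp ?C (AMap (NTgt t) (NComp s' x)) (NComp t (OMap (NTgt s) x)))
        (AMap (NSrc t) (NComp s x))"
    by simp
  then show "NComp (nhcomp (nvcomp t' t) (nvcomp s' s)) x
      = NComp (nvcomp (nhcomp t' s') (nhcomp t s)) x"
    by (simp add: st ss tt category.assoc category.comp_arr category.comp_dom category.comp_cod)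
qed (simp_all add: ss tt)

lemma CAT_two_category: "two_category CAT"
proof (rule two_category.intro)
  show "category (ucat CAT)"
    by (rule categoryI)
      (auto simp: CAT_def ucat_def fun_rules intro!: fid_functor fcomp_functor fcomp_fid_right
        fcomp_fid_left fcomp_assoc)
  show "category (vcat CAT)"
    by (rule categoryI)
      (auto simp: CAT_def vcat_def nt_rules intro!: nid_nat_trans nvcomp_nat_trans nvcomp_nid_right
        nvcomp_nid_left nvcomp_assoc)
  show "category (hcat CAT)"
    by (rule categoryI)
      (auto simp: CAT_def hcat_def nt_rules intro!: nid_nat_trans fid_functor nhcomp_nat_trans
        nhcomp_nid_right nhcomp_nid_left nhcomp_assoc)
qed (auto simp: CAT_def nt_rules nhcomp_nid nat_interchange)

lemma CAT_simps [simp]: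
  "Cell0 CAT = {C. category C}" "Cell1 CAT = {F. cat_functor F}" "Cell2 CAT = {t. nat_trans t}"
  "Dom1 CAT = Src" "Cod1 CAT = Tgt" "Dom2 CAT = NSrc" "Cod2 CAT = NTgt"
  "Id1 CAT = fid" "Id2 CAT = nid" "Comp1 CAT = fcomp" "VComp CAT = nvcomp" "HComp CAT = nhcomp"
  by (simp_all add: CAT_def)

text \<open>Componentwise inverses of a natural transformation are automatically natural.\<close>

lemma nat_iso_invertible2:
  assumes t: "nat_trans t"
    and inv: "\<And>x. x \<in> Obj (Src (NSrc t)) \<Longrightarrow> d x \<in> Arr (Tgt (NSrc t)) \<and>
      Dom (Tgt (NSrc t)) (d x) = OMap (NTgt t) x \<and> Cod (Tgt (NSrc t)) (d x) = OMap (NSrc t) x \<and>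
      Comp (Tgt (NSrc t)) (d x) (NComp t x) = Ide (Tgt (NSrc t)) (OMap (NSrc t) x) \<and>
      Comp (Tgt (NSrc t)) (NComp t x) (d x) = Ide (Tgt (NSrc t)) (OMap (NTgt t) x)"
  shows "invertible2 CAT t"
proof -
  define s where "s = \<lparr>NSrc = NTgt t, NTgt = NSrc t, NComp = restrict d (Obj (Src (NSrc t)))\<rparr>"
  note [simp] = nt_rules[OF t] inv
  let ?C = "Src (NSrc t)" and ?D = "Tgt (NSrc t)"
  have s [simp]: "NSrc s = NTgt t" "NTgt s = NSrc t" "x \<in> Obj ?C \<Longrightarrow> NComp s x = d x" for x
    by (simp_all add: s_def)
  have "nat_trans s"
  proof (rule nat_transI)
    show "NComp s \<in> extensional (Obj (Src (NSrc s)))" by (simp add: s_def)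
    fix f assume f: "f \<in> Arr (Src (NSrc s))"
    let ?x = "Dom ?C f" and ?y = "Cod ?C f"
    have [simp]: "f \<in> Arr ?C" "?x \<in> Obj ?C" "?y \<in> Obj ?C"
      using f by (simp_all add: cat_boundary)
    have "Comp ?D (d ?y) (AMap (NTgt t) f)
        = Comp ?D (d ?y) (Comp ?D (AMap (NTgt t) f) (Comp ?D (NComp t ?x) (d ?x)))"
      by (simp add: category.comp_ide_dom)
    also have "\<dots> = Comp ?D (d ?y) (Comp ?D (NComp t ?y) (Comp ?D (AMap (NSrc t) f) (d ?x)))"
      using nat_trans.naturality_arr[OF t, of f]
      by (intro arg_cong[of _ _ "Comp ?D (d ?y)"] category.square_comp) simp_all
    also have "\<dots> = Comp ?D (Comp ?D (d ?y) (NComp t ?y)) (Comp ?D (AMap (NSrc t) f) (d ?x))"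
      by (rule category.assoc[symmetric]) (simp_all add: cat_boundary)
    also have "\<dots> = Comp ?D (AMap (NSrc t) f) (d ?x)"
      by (simp add: category.comp_ide_cod cat_boundary)
    finally show "Comp (Tgt (NSrc s)) (NComp s (Cod (Src (NSrc s)) f)) (AMap (NSrc s) f)
        = Comp (Tgt (NSrc s)) (AMap (NTgt s) f) (NComp s (Dom (Src (NSrc s)) f))"
      by simp
  qed simp_all
  moreover have "nvcomp s t = nid (NSrc t)" "nvcomp t s = nid (NTgt t)"
    using t \<open>nat_trans s\<close> by (auto intro!: nat_trans_eqI nvcomp_nat_trans nid_nat_trans)
  ultimately show ?thesis
    using t unfolding invertible2_def by (auto intro!: exI[of _ s])
qed


section \<open>The 2-category of fibrations\<close>

text \<open>The 1-cells and 2-cells of \<open>FIBc\<close>, as predicates.\<close>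

definition cartesian_morphism :: "('e, 'u, 'd, 'v) square \<Rightarrow> bool" where
  "cartesian_morphism S \<longleftrightarrow> comm_square S \<and> fibration (SqSrc S) \<and> fibration (SqTgt S) \<and>
     (\<forall>u. cartesian (SqSrc S) u \<longrightarrow> cartesian (SqTgt S) (AMap (SqTop S) u))"

definition cartesian_cell :: "('e, 'u, 'd, 'v) square2 \<Rightarrow> bool" where
  "cartesian_cell t \<longleftrightarrow> square_cell t \<and> cartesian_morphism (Sq2Src t) \<and> cartesian_morphism (Sq2Tgt t)"

lemma FIBc_simps [simp]:
  "Cell0 FIBc = {Q. fibration Q}" "Cell1 FIBc = {S. cartesian_morphism S}"
  "Cell2 FIBc = {t. cartesian_cell t}"
  "Dom1 FIBc = SqSrc" "Cod1 FIBc = SqTgt" "Dom2 FIBc = Sq2Src" "Cod2 FIBc = Sq2Tgt"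
  "Id1 FIBc = sq_id" "Id2 FIBc = sq2_id" "Comp1 FIBc = sq_comp" "VComp FIBc = sq2_vcomp"
  "HComp FIBc = sq2_hcomp"
  by (auto simp: FIBc_def CAT2_def Let_def cartesian_morphism_def cartesian_cell_def)

lemma square_sel_simps [simp]:
  "SqSrc (sq_id Q) = Q" "SqTgt (sq_id Q) = Q" "SqTop (sq_id Q) = fid (Src Q)"
  "SqBot (sq_id Q) = fid (Tgt Q)"
  "SqSrc (sq_comp T S) = SqSrc S" "SqTgt (sq_comp T S) = SqTgt T"
  "SqTop (sq_comp T S) = fcomp (SqTop T) (SqTop S)" "SqBot (sq_comp T S) = fcomp (SqBot T) (SqBot S)"
  "Sq2Src (sq2_id S) = S" "Sq2Tgt (sq2_id S) = S" "Sq2Top (sq2_id S) = nid (SqTop S)"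
  "Sq2Bot (sq2_id S) = nid (SqBot S)"
  "Sq2Src (sq2_vcomp t s) = Sq2Src s" "Sq2Tgt (sq2_vcomp t s) = Sq2Tgt t"
  "Sq2Top (sq2_vcomp t s) = nvcomp (Sq2Top t) (Sq2Top s)"
  "Sq2Bot (sq2_vcomp t s) = nvcomp (Sq2Bot t) (Sq2Bot s)"
  "Sq2Src (sq2_hcomp t s) = sq_comp (Sq2Src t) (Sq2Src s)"
  "Sq2Tgt (sq2_hcomp t s) = sq_comp (Sq2Tgt t) (Sq2Tgt s)"
  "Sq2Top (sq2_hcomp t s) = nhcomp (Sq2Top t) (Sq2Top s)"
  "Sq2Bot (sq2_hcomp t s) = nhcomp (Sq2Bot t) (Sq2Bot s)"
  by (simp_all add: sq_id_def sq_comp_def sq2_id_def sq2_vcomp_def sq2_hcomp_def)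

lemma comm_square_id: "cat_functor Q \<Longrightarrow> comm_square (sq_id Q)"
  by (simp add: comm_square_def fid_functor fun_rules fcomp_fid_right fcomp_fid_left)

lemma comm_square_comp:
  assumes S: "comm_square S" and T: "comm_square T" and ST: "SqSrc T = SqTgt S"
  shows "comm_square (sq_comp T S)"
proof -
  note s = S[unfolded comm_square_def] and t = T[unfolded comm_square_def ST]
  have "fcomp (SqTgt T) (fcomp (SqTop T) (SqTop S)) = fcomp (fcomp (SqTgt T) (SqTop T)) (SqTop S)"
    using s t by (intro fcomp_assoc) auto
  also have "\<dots> = fcomp (fcomp (SqBot T) (SqTgt S)) (SqTop S)"
    using t by simp
  also have "\<dots> = fcomp (SqBot T) (fcomp (SqTgt S) (SqTop S))"
    using s t by (intro fcomp_assoc[symmetric]) auto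
  also have "\<dots> = fcomp (SqBot T) (fcomp (SqBot S) (SqSrc S))"
    using s by simp
  also have "\<dots> = fcomp (fcomp (SqBot T) (SqBot S)) (SqSrc S)"
    using s t by (intro fcomp_assoc) auto
  finally show ?thesis using s t unfolding comm_square_def by (auto intro!: fcomp_functor)
qed

lemma square_cell_id: "comm_square S \<Longrightarrow> square_cell (sq2_id S)"
  by (auto simp: square_cell_def comm_square_def nid_nat_trans nhcomp_nid)

text \<open>Pasting of compatible pairs: whiskering with a fixed functor distributes over vertical
  composition by interchange.\<close>

lemma square_cell_vcomp:
  assumes s: "square_cell s" and t: "square_cell t" and st: "Sq2Src t = Sq2Tgt s"
  shows "square_cell (sq2_vcomp t s)"
proof -
  note s = s[unfolded square_cell_def comm_square_def] and t = t[unfolded square_cell_def comm_square_def st]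
  let ?Q = "SqSrc (Sq2Src s)" and ?Q' = "SqTgt (Sq2Src s)"
  have "nhcomp (nid ?Q') (nvcomp (Sq2Top t) (Sq2Top s))
      = nhcomp (nvcomp (nid ?Q') (nid ?Q')) (nvcomp (Sq2Top t) (Sq2Top s))"
    using s by (simp add: nvcomp_nid_left nid_nat_trans)
  also have "\<dots> = nvcomp (nhcomp (nid ?Q') (Sq2Top t)) (nhcomp (nid ?Q') (Sq2Top s))"
    using s t by (intro nat_interchange) (auto simp: nid_nat_trans)
  also have "\<dots> = nvcomp (nhcomp (Sq2Bot t) (nid ?Q)) (nhcomp (Sq2Bot s) (nid ?Q))"
    using s t by simp
  also have "\<dots> = nhcomp (nvcomp (Sq2Bot t) (Sq2Bot s)) (nvcomp (nid ?Q) (nid ?Q))"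
    using s t by (intro nat_interchange[symmetric]) (auto simp: nid_nat_trans)
  also have "\<dots> = nhcomp (nvcomp (Sq2Bot t) (Sq2Bot s)) (nid ?Q)"
    using s by (simp add: nvcomp_nid_left nid_nat_trans)
  finally show ?thesis
    using s t unfolding square_cell_def comm_square_def by (auto intro!: nvcomp_nat_trans simp: st)
qed

lemma square_cell_hcomp:
  assumes s: "square_cell s" and t: "square_cell t" and st: "SqSrc (Sq2Src t) = SqTgt (Sq2Src s)"
  shows "square_cell (sq2_hcomp t s)"
proof -
  have sq: "comm_square (Sq2Src s)" "comm_square (Sq2Tgt s)" "comm_square (Sq2Src t)"
    "comm_square (Sq2Tgt t)" "SqSrc (Sq2Tgt t) = SqTgt (Sq2Tgt s)"
    using s t st by (simp_all add: square_cell_def)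
  note s = s[unfolded square_cell_def comm_square_def]
    and t = t[unfolded square_cell_def comm_square_def st]
  let ?Q = "SqSrc (Sq2Src s)" and ?Q' = "SqTgt (Sq2Src s)" and ?Q'' = "SqTgt (Sq2Src t)"
  have "nhcomp (nid ?Q'') (nhcomp (Sq2Top t) (Sq2Top s))
      = nhcomp (nhcomp (nid ?Q'') (Sq2Top t)) (Sq2Top s)"
    using s t by (intro nhcomp_assoc) (auto simp: nid_nat_trans)
  also have "\<dots> = nhcomp (nhcomp (Sq2Bot t) (nid ?Q')) (Sq2Top s)" using t by simp
  also have "\<dots> = nhcomp (Sq2Bot t) (nhcomp (nid ?Q') (Sq2Top s))"
    using s t by (intro nhcomp_assoc[symmetric]) (auto simp: nid_nat_trans)
  also have "\<dots> = nhcomp (Sq2Bot t) (nhcomp (Sq2Bot s) (nid ?Q))" using s by simp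
  also have "\<dots> = nhcomp (nhcomp (Sq2Bot t) (Sq2Bot s)) (nid ?Q)"
    using s t by (intro nhcomp_assoc) (auto simp: nid_nat_trans)
  finally show ?thesis
    using s t st sq unfolding square_cell_def
    by (auto intro!: nhcomp_nat_trans comm_square_comp)
qed

lemma cartesian_morphism_id: "fibration Q \<Longrightarrow> cartesian_morphism (sq_id Q)"
  by (auto simp: cartesian_morphism_def fibration_def comm_square_id)
    (simp add: cartesian_def)

lemma cartesian_morphism_comp:
  assumes "cartesian_morphism S" "cartesian_morphism T" "SqSrc T = SqTgt S"
  shows "cartesian_morphism (sq_comp T S)"
proof -
  have "u \<in> Arr (Src (SqTop S))" if "cartesian (SqSrc S) u" for u
    using that assms by (simp add: cartesian_def cartesian_morphism_def comm_square_def)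
  then show ?thesis using assms by (simp add: cartesian_morphism_def comm_square_comp)
qed

lemma sq_comp_id_right: "comm_square S \<Longrightarrow> SqSrc S = Q \<Longrightarrow> sq_comp S (sq_id Q) = S"
  by (rule square.equality) (auto simp: comm_square_def fcomp_fid_right)

lemma sq_comp_id_left: "comm_square S \<Longrightarrow> SqTgt S = Q \<Longrightarrow> sq_comp (sq_id Q) S = S"
  by (rule square.equality) (auto simp: comm_square_def fcomp_fid_left)

lemma sq_comp_assoc: "comm_square R \<Longrightarrow> comm_square S \<Longrightarrow> comm_square T \<Longrightarrow> SqSrc S = SqTgt R \<Longrightarrow>
   SqSrc T = SqTgt S \<Longrightarrow> sq_comp T (sq_comp S R) = sq_comp (sq_comp T S) R"
  by (rule square.equality) (auto simp: comm_square_def intro!: fcomp_assoc)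

lemma comm_squareD:
  assumes "comm_square S"
  shows "cat_functor (SqSrc S)" "cat_functor (SqTgt S)" "cat_functor (SqTop S)"
    "cat_functor (SqBot S)" "Src (SqTop S) = Src (SqSrc S)" "Tgt (SqTop S) = Src (SqTgt S)"
    "Src (SqBot S) = Tgt (SqSrc S)" "Tgt (SqBot S) = Tgt (SqTgt S)"
  using assms by (simp_all add: comm_square_def)

lemma cartesian_morphismD:
  assumes "cartesian_morphism S"
  shows "comm_square S" "fibration (SqSrc S)" "fibration (SqTgt S)"
  using assms by (simp_all add: cartesian_morphism_def)

lemma cartesian_cellD:
  assumes "cartesian_cell t"
  shows "square_cell t" "cartesian_morphism (Sq2Src t)" "cartesian_morphism (Sq2Tgt t)"
    "comm_square (Sq2Src t)" "comm_square (Sq2Tgt t)"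
    "SqSrc (Sq2Tgt t) = SqSrc (Sq2Src t)" "SqTgt (Sq2Tgt t) = SqTgt (Sq2Src t)"
    "nat_trans (Sq2Top t)" "NSrc (Sq2Top t) = SqTop (Sq2Src t)" "NTgt (Sq2Top t) = SqTop (Sq2Tgt t)"
    "nat_trans (Sq2Bot t)" "NSrc (Sq2Bot t) = SqBot (Sq2Src t)" "NTgt (Sq2Bot t) = SqBot (Sq2Tgt t)"
  using assms by (simp_all add: cartesian_cell_def square_cell_def)

lemma cartesian_cell_id: "cartesian_morphism S \<Longrightarrow> cartesian_cell (sq2_id S)"
  by (simp add: cartesian_cell_def cartesian_morphismD square_cell_id)

lemma cartesian_cell_vcomp: "cartesian_cell s \<Longrightarrow> cartesian_cell t \<Longrightarrow> Sq2Src t = Sq2Tgt s \<Longrightarrow>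
   cartesian_cell (sq2_vcomp t s)"
  by (simp add: cartesian_cell_def square_cell_vcomp)

lemma cartesian_cell_hcomp:
  assumes "cartesian_cell s" "cartesian_cell t" "SqSrc (Sq2Src t) = SqTgt (Sq2Src s)"
  shows "cartesian_cell (sq2_hcomp t s)"
  using assms cartesian_cellD[OF assms(1)] cartesian_cellD[OF assms(2)]
  by (simp add: cartesian_cell_def square_cell_hcomp cartesian_morphism_comp)

lemma FIBc_two_category:
  "two_category (FIBc :: (('e, 'u, 'd, 'v) funct, ('e, 'u, 'd, 'v) square, _) two_cat)"
  (is "two_category ?K")
proof (rule two_category.intro)
  note cells = cartesian_cellD cartesian_morphismD comm_squareD
  show "category (ucat ?K)"
    by (rule categoryI)
      (simp_all add: ucat_def cartesian_morphism_id cartesian_morphism_comp sq_comp_id_right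
        sq_comp_id_left sq_comp_assoc cartesian_morphismD)
  show "category (vcat ?K)"
    by (rule categoryI)
      (simp_all add: vcat_def cells cartesian_cell_id cartesian_cell_vcomp square2.equality
        nvcomp_nid_right nvcomp_nid_left nvcomp_assoc)
  show "category (hcat ?K)"
    by (rule categoryI)
      (simp_all add: hcat_def cells cartesian_morphism_id cartesian_cell_id cartesian_cell_hcomp
        square2.equality sq_comp_id_right sq_comp_id_left sq_comp_assoc
        nhcomp_nid_right nhcomp_nid_left nhcomp_assoc)
  show "HComp ?K (Id2 ?K g) (Id2 ?K f) = Id2 ?K (Comp1 ?K g f)"
    if "f \<in> Cell1 ?K" "g \<in> Cell1 ?K" "Cod1 ?K f = Dom1 ?K g" for f g
    using that by (simp add: cells nhcomp_nid square2.equality)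
  show "HComp ?K (VComp ?K t' t) (VComp ?K s' s) = VComp ?K (HComp ?K t' s') (HComp ?K t s)"
    if "s \<in> Cell2 ?K" "s' \<in> Cell2 ?K" "t \<in> Cell2 ?K" "t' \<in> Cell2 ?K" "Cod2 ?K s = Dom2 ?K s'"
      "Cod2 ?K t = Dom2 ?K t'" "Cod1 ?K (Dom2 ?K s) = Dom1 ?K (Dom2 ?K t)" for s s' t t'
    using that by (simp add: cells nat_interchange square2.equality)
qed (simp_all add: cartesian_cellD)


text \<open>Compatibility of two transformations, stated in \<open>CAT2\<close> by whiskering, is an equation between
  their components. Pseudo-functors into \<open>FIBc\<close> are taken apart and built through this form.\<close>

lemma square_cell_whisker_iff:
  assumes S: "comm_square S" and T: "comm_square T" and ST: "SqSrc T = SqSrc S" "SqTgt T = SqTgt S"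
    and t: "nat_trans t" "NSrc t = SqTop S" "NTgt t = SqTop T"
    and b: "nat_trans b" "NSrc b = SqBot S" "NTgt b = SqBot T"
  shows "nhcomp (nid (SqTgt S)) t = nhcomp b (nid (SqSrc S)) \<longleftrightarrow>
    (\<forall>x\<in>Obj (Src (SqSrc S)). AMap (SqTgt S) (NComp t x) = NComp b (OMap (SqSrc S) x))"
    (is "?L = ?R \<longleftrightarrow> _")
proof -
  note [simp] = comm_squareD[OF S] comm_squareD[OF T, unfolded ST] t b nt_rules[OF t(1), unfolded t]
    nt_rules[OF b(1), unfolded b]
  note Q = fun_rules[OF comm_squareD(2)[OF S]] and Q' = fun_rules[OF comm_squareD(1)[OF S]]
  have nt: "nat_trans ?L" "nat_trans ?R" by (auto intro!: nhcomp_nat_trans nid_nat_trans)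
  have bd: "NSrc ?L = NSrc ?R" "NTgt ?L = NTgt ?R"
    using S T ST by (auto simp: comm_square_def)
  have x: "NComp ?L x = AMap (SqTgt S) (NComp t x)" "NComp ?R x = NComp b (OMap (SqSrc S) x)"
    if "x \<in> Obj (Src (SqSrc S))" for x
    using that Q Q' nt_rules[OF t(1), unfolded t] nt_rules[OF b(1), unfolded b] by (simp_all add: cat_rules)
  show ?thesis
  proof
    assume "?L = ?R" then show "\<forall>x\<in>Obj (Src (SqSrc S)). AMap (SqTgt S) (NComp t x) = NComp b (OMap (SqSrc S) x)"
      using x by metis
  next
    assume "\<forall>x\<in>Obj (Src (SqSrc S)). AMap (SqTgt S) (NComp t x) = NComp b (OMap (SqSrc S) x)"
    then show "?L = ?R" using x by (intro nat_trans_eqI nt bd) simp_all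
  qed
qed

lemma square_cell_component:
  assumes "square_cell t" "x \<in> Obj (Src (SqSrc (Sq2Src t)))"
  shows "AMap (SqTgt (Sq2Src t)) (NComp (Sq2Top t) x) = NComp (Sq2Bot t) (OMap (SqSrc (Sq2Src t)) x)"
  using assms square_cell_whisker_iff[of "Sq2Src t" "Sq2Tgt t" "Sq2Top t" "Sq2Bot t"]
  unfolding square_cell_def by blast


section \<open>Pseudo-functors into fibrations as pairs of pseudo-functors into categories\<close>

lemma invertible2_cell: "invertible2 K t \<Longrightarrow> t \<in> Cell2 K"
  by (simp add: invertible2_def)

text \<open>Strict 2-functors. The equations are imposed on all arguments, since the two projections of
  squares satisfy them by definition.\<close>

locale two_functor =
  fixes K :: "('x, 'f, 't) two_cat" and L :: "('x', 'f', 't') two_cat"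
    and T :: "('x, 'f, 't, 'x', 'f', 't') two_funct"
  assumes target: "two_category L"
    and map0: "x \<in> Cell0 K \<Longrightarrow> Map0 T x \<in> Cell0 L"
    and map1: "f \<in> Cell1 K \<Longrightarrow> Map1 T f \<in> Cell1 L \<and> Dom1 L (Map1 T f) = Map0 T (Dom1 K f)
      \<and> Cod1 L (Map1 T f) = Map0 T (Cod1 K f)"
    and map2: "t \<in> Cell2 K \<Longrightarrow> Map2 T t \<in> Cell2 L \<and> Dom2 L (Map2 T t) = Map1 T (Dom2 K t)
      \<and> Cod2 L (Map2 T t) = Map1 T (Cod2 K t)"
    and map_id1: "Map1 T (Id1 K x) = Id1 L (Map0 T x)"
    and map_comp1: "Map1 T (Comp1 K g f) = Comp1 L (Map1 T g) (Map1 T f)"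
    and map_id2: "Map2 T (Id2 K f) = Id2 L (Map1 T f)"
    and map_vcomp: "Map2 T (VComp K t s) = VComp L (Map2 T t) (Map2 T s)"
    and map_hcomp: "Map2 T (HComp K t s) = HComp L (Map2 T t) (Map2 T s)"
begin

lemma map_invertible2: "invertible2 K t \<Longrightarrow> invertible2 L (Map2 T t)"
  unfolding invertible2_def
  by (metis map2 map_id2 map_vcomp)

lemma pseudo_functor_postcomp:
  assumes "pseudo_functor C K \<Phi>"
  shows "pseudo_functor C L (ps_postcomp T \<Phi>)"
proof -
  interpret pseudo_functor C K \<Phi> by fact
  show ?thesis
  proof (rule pseudo_functor.intro)
    fix x assume "x \<in> Obj C"
    then show "invertible2 L (PsUnit (ps_postcomp T \<Phi>) x) \<and>
        Dom2 L (PsUnit (ps_postcomp T \<Phi>) x) = Id1 L (Ps0 (ps_postcomp T \<Phi>) x) \<and>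
        Cod2 L (PsUnit (ps_postcomp T \<Phi>) x) = Ps1 (ps_postcomp T \<Phi>) (Ide C x)"
      using ps_unit[of x] map2[of "PsUnit \<Phi> x"] map_invertible2[of "PsUnit \<Phi> x"]
      by (auto simp: ps_postcomp_def map_id1 dest: invertible2_cell)
  next
    fix f x y g z assume "f \<in> Hom C x y" "g \<in> Hom C y z"
    then show "invertible2 L (PsComp (ps_postcomp T \<Phi>) g f) \<and>
        Dom2 L (PsComp (ps_postcomp T \<Phi>) g f)
          = Comp1 L (Ps1 (ps_postcomp T \<Phi>) g) (Ps1 (ps_postcomp T \<Phi>) f) \<and>
        Cod2 L (PsComp (ps_postcomp T \<Phi>) g f) = Ps1 (ps_postcomp T \<Phi>) (Comp C g f)"
      using ps_comp[of f x y g z] map2[of "PsComp \<Phi> g f"] map_invertible2[of "PsComp \<Phi> g f"]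
      by (auto simp: ps_postcomp_def map_comp1 dest: invertible2_cell)
  qed (auto simp: ps_postcomp_def source_category target map0 map1 ps0 ps1
      simp flip: map_id2 map_hcomp map_vcomp simp: ps_unit_right ps_unit_left ps_assoc)
qed

end

lemma dom_two_functor: "two_functor FIBc CAT dom_2functor"
  by (rule two_functor.intro)
    (simp_all add: dom_2functor_def CAT_two_category fibration_def fun_rules cartesian_cellD
      cartesian_morphismD comm_squareD)

lemma cod_two_functor: "two_functor FIBc CAT cod_2functor"
  by (rule two_functor.intro)
    (simp_all add: cod_2functor_def CAT_two_category fibration_def fun_rules cartesian_cellD
      cartesian_morphismD comm_squareD)

text \<open>The inverses of the two parts are again compatible: whiskered with the boundary fibrations,
  they are inverse to one and the same transformation.\<close>

lemma invertible_square_cell: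
  assumes t: "cartesian_cell t" and "invertible2 CAT (Sq2Top t)" "invertible2 CAT (Sq2Bot t)"
  shows "invertible2 FIBc t"
proof -
  obtain a where a: "nat_trans a" "NSrc a = NTgt (Sq2Top t)" "NTgt a = NSrc (Sq2Top t)"
    "nvcomp a (Sq2Top t) = nid (NSrc (Sq2Top t))" "nvcomp (Sq2Top t) a = nid (NTgt (Sq2Top t))"
    using assms(2) by (auto simp: invertible2_def)
  obtain b where b: "nat_trans b" "NSrc b = NTgt (Sq2Bot t)" "NTgt b = NSrc (Sq2Bot t)"
    "nvcomp b (Sq2Bot t) = nid (NSrc (Sq2Bot t))" "nvcomp (Sq2Bot t) b = nid (NTgt (Sq2Bot t))"
    using assms(3) by (auto simp: invertible2_def)
  define s where "s = \<lparr>Sq2Src = Sq2Tgt t, Sq2Tgt = Sq2Src t, Sq2Top = a, Sq2Bot = b\<rparr>"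
  let ?Q = "SqSrc (Sq2Src t)" and ?Q' = "SqTgt (Sq2Src t)"
  note t' = cartesian_cellD[OF t] comm_squareD[OF cartesian_cellD(4)[OF t]]
    comm_squareD[OF cartesian_cellD(5)[OF t], unfolded cartesian_cellD(6,7)[OF t]]
  have whisker: "nhcomp (nid ?Q') (Sq2Top t) = nhcomp (Sq2Bot t) (nid ?Q)"
    and sq: "fcomp (SqBot (Sq2Tgt t)) ?Q = fcomp ?Q' (SqTop (Sq2Tgt t))"
      "fcomp (SqBot (Sq2Src t)) ?Q = fcomp ?Q' (SqTop (Sq2Src t))"
    using t by (auto simp: cartesian_cell_def square_cell_def comm_square_def)
  have nt: "nat_trans (nhcomp (nid ?Q') a)" "nat_trans (nhcomp b (nid ?Q))"
    "nat_trans (nhcomp (nid ?Q') (Sq2Top t))" "nat_trans (nhcomp (Sq2Bot t) (nid ?Q))"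
    using t' a b by (auto intro!: nhcomp_nat_trans nid_nat_trans)
  \<comment> \<open>Both whiskered inverses are vertical inverses of the same transformation.\<close>
  have 1: "nvcomp (nhcomp (nid ?Q') a) (nhcomp (nid ?Q') (Sq2Top t))
      = nid (fcomp ?Q' (SqTop (Sq2Src t)))"
  proof -
    have "nvcomp (nhcomp (nid ?Q') a) (nhcomp (nid ?Q') (Sq2Top t))
        = nhcomp (nvcomp (nid ?Q') (nid ?Q')) (nvcomp a (Sq2Top t))"
      using t' a by (intro nat_interchange[symmetric]) (auto simp: nid_nat_trans)
    then show ?thesis using t' a by (simp add: nvcomp_nid_left nid_nat_trans nhcomp_nid)
  qed
  have 2: "nvcomp (nhcomp (Sq2Bot t) (nid ?Q)) (nhcomp b (nid ?Q))
      = nid (fcomp (SqBot (Sq2Tgt t)) ?Q)"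
  proof -
    have "nvcomp (nhcomp (Sq2Bot t) (nid ?Q)) (nhcomp b (nid ?Q))
        = nhcomp (nvcomp (Sq2Bot t) b) (nvcomp (nid ?Q) (nid ?Q))"
      using t' b by (intro nat_interchange[symmetric]) (auto simp: nid_nat_trans)
    then show ?thesis using t' b by (simp add: nvcomp_nid_left nid_nat_trans nhcomp_nid)
  qed
  have "nhcomp (nid ?Q') a
      = nvcomp (nhcomp (nid ?Q') a) (nvcomp (nhcomp (Sq2Bot t) (nid ?Q)) (nhcomp b (nid ?Q)))"
    unfolding 2 using nt t' a by (simp add: sq nvcomp_nid_right)
  also have "\<dots> = nvcomp (nvcomp (nhcomp (nid ?Q') a) (nhcomp (Sq2Bot t) (nid ?Q))) (nhcomp b (nid ?Q))"
    using nt t' a b by (intro nvcomp_assoc) (auto simp: sq)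
  also have "\<dots> = nvcomp (nid (fcomp ?Q' (SqTop (Sq2Src t)))) (nhcomp b (nid ?Q))"
    by (simp flip: 1 add: whisker)
  also have "\<dots> = nhcomp b (nid ?Q)"
    using nt t' b by (simp add: sq nvcomp_nid_left)
  finally have "cartesian_cell s"
    using t t' a b unfolding s_def cartesian_cell_def square_cell_def by simp
  moreover have "sq2_vcomp s t = sq2_id (Sq2Src t)" "sq2_vcomp t s = sq2_id (Sq2Tgt t)"
    using t' a b by (simp_all add: s_def square2.equality)
  ultimately show ?thesis
    using t unfolding invertible2_def by (auto simp: s_def intro!: bexI[of _ s])
qed

text \<open>A law in \<open>FIBc\<close> is an equation of pairs of transformations with given boundary squares. The
  transformations agree by the laws of the two parts, and the boundaries agree because squares form
  a category.\<close>

lemma pseudo_functor_FIBcI: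
  assumes top: "pseudo_functor C CAT (ps_postcomp dom_2functor \<Xi>)"
    and bot: "pseudo_functor C CAT (ps_postcomp cod_2functor \<Xi>)"
    and obj: "\<And>x. x \<in> Obj C \<Longrightarrow> fibration (Ps0 \<Xi> x)"
    and arr: "\<And>f. f \<in> Arr C \<Longrightarrow> cartesian_morphism (Ps1 \<Xi> f) \<and>
      SqSrc (Ps1 \<Xi> f) = Ps0 \<Xi> (Dom C f) \<and> SqTgt (Ps1 \<Xi> f) = Ps0 \<Xi> (Cod C f)"
    and unit: "\<And>x. x \<in> Obj C \<Longrightarrow> cartesian_cell (PsUnit \<Xi> x) \<and>
      Sq2Src (PsUnit \<Xi> x) = sq_id (Ps0 \<Xi> x) \<and> Sq2Tgt (PsUnit \<Xi> x) = Ps1 \<Xi> (Ide C x)"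
    and comp: "\<And>f g. f \<in> Arr C \<Longrightarrow> g \<in> Arr C \<Longrightarrow> Cod C f = Dom C g \<Longrightarrow>
      cartesian_cell (PsComp \<Xi> g f) \<and> Sq2Src (PsComp \<Xi> g f) = sq_comp (Ps1 \<Xi> g) (Ps1 \<Xi> f) \<and>
      Sq2Tgt (PsComp \<Xi> g f) = Ps1 \<Xi> (Comp C g f)"
  shows "pseudo_functor C FIBc \<Xi>"
proof -
  interpret top: pseudo_functor C CAT "ps_postcomp dom_2functor \<Xi>" by fact
  interpret bot: pseudo_functor C CAT "ps_postcomp cod_2functor \<Xi>" by fact
  have C: "category C" by (fact top.source_category)
  have sq: "comm_square (Ps1 \<Xi> f)" if "f \<in> Arr C" for f
    using arr[OF that] by (simp add: cartesian_morphism_def)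
  note [simp] = ps_postcomp_def dom_2functor_def cod_2functor_def
  show ?thesis
  proof (rule pseudo_functor.intro)
    fix x assume "x \<in> Obj C"
    then show "invertible2 FIBc (PsUnit \<Xi> x) \<and> Dom2 FIBc (PsUnit \<Xi> x) = Id1 FIBc (Ps0 \<Xi> x) \<and>
        Cod2 FIBc (PsUnit \<Xi> x) = Ps1 \<Xi> (Ide C x)"
      using unit[of x] top.ps_unit[of x] bot.ps_unit[of x] by (simp add: invertible_square_cell)
  next
    fix f x y g z assume "f \<in> Hom C x y" "g \<in> Hom C y z"
    then show "invertible2 FIBc (PsComp \<Xi> g f) \<and>
        Dom2 FIBc (PsComp \<Xi> g f) = Comp1 FIBc (Ps1 \<Xi> g) (Ps1 \<Xi> f) \<and>
        Cod2 FIBc (PsComp \<Xi> g f) = Ps1 \<Xi> (Comp C g f)"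
      using comp[of f g] top.ps_comp[of f x y g z] bot.ps_comp[of f x y g z]
      by (simp add: invertible_square_cell Hom_def)
  next
    fix f x y assume f: "f \<in> Hom C x y"
    then show "VComp FIBc (PsComp \<Xi> f (Ide C x)) (HComp FIBc (Id2 FIBc (Ps1 \<Xi> f)) (PsUnit \<Xi> x))
        = Id2 FIBc (Ps1 \<Xi> f)"
      using top.ps_unit_right[OF f] bot.ps_unit_right[OF f] comp[of "Ide C x" f] unit[of x] sq[of f]
        arr[of f] cat_rules[OF C] by (intro square2.equality) (auto simp: Hom_def sq_comp_id_right)
    show "VComp FIBc (PsComp \<Xi> (Ide C y) f) (HComp FIBc (PsUnit \<Xi> y) (Id2 FIBc (Ps1 \<Xi> f)))
        = Id2 FIBc (Ps1 \<Xi> f)"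
      using f top.ps_unit_left[OF f] bot.ps_unit_left[OF f] comp[of f "Ide C y"] unit[of y] sq[of f]
        arr[of f] cat_rules[OF C] by (intro square2.equality) (auto simp: Hom_def sq_comp_id_left)
  next
    fix f w x g y h z assume fgh: "f \<in> Hom C w x" "g \<in> Hom C x y" "h \<in> Hom C y z"
    then show "VComp FIBc (PsComp \<Xi> h (Comp C g f)) (HComp FIBc (Id2 FIBc (Ps1 \<Xi> h)) (PsComp \<Xi> g f))
      = VComp FIBc (PsComp \<Xi> (Comp C h g) f) (HComp FIBc (PsComp \<Xi> h g) (Id2 FIBc (Ps1 \<Xi> f)))"
      using top.ps_assoc[OF fgh] bot.ps_assoc[OF fgh] comp[of f g] comp[of g h]
        comp[of f "Comp C h g"] comp[of "Comp C g f" h] arr[of f] arr[of g] arr[of h]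
        sq[of f] sq[of g] sq[of h] cat_rules[OF C]
      by (intro square2.equality) (auto simp: Hom_def sq_comp_assoc)
  qed (use obj arr in \<open>auto simp: C FIBc_two_category\<close>)
qed


section \<open>The Grothendieck construction of an indexed category\<close>

lemma op_cat_simps [simp]:
  "Obj (op_cat B) = Obj B" "Arr (op_cat B) = Arr B" "Dom (op_cat B) = Cod B"
  "Cod (op_cat B) = Dom B" "Ide (op_cat B) = Ide B" "Comp (op_cat B) g f = Comp B f g"
  by (simp_all add: op_cat_def)

lemma category_op_cat: "category (op_cat B) = category B"
proof -
  have *: "category (op_cat C)" if "category C" for C :: "('x, 'y) cat"
    by (rule categoryI) (simp_all add: cat_rules that)
  have "op_cat (op_cat B) = B" by (simp add: op_cat_def)
  then show ?thesis using *[of B] *[of "op_cat B"] by metis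
qed

text \<open>The laws of a pseudo-functor \<open>B\<^sup>o\<^sup>p \<rightarrow> CAT\<close> are restated here for single objects and arrows of the
  fibres, with composites written in \<open>B\<close>. Writing \<open>\<eta>\<close> and \<open>\<gamma>\<close> for the components of the structure
  cells, \<open>\<gamma> f g E\<close> goes from \<open>f\<^sup>* g\<^sup>* E\<close> to \<open>(g \<circ> f)\<^sup>* E\<close>.\<close>

locale indexed_category =
  fixes B :: "('b, 'w) cat"
    and \<Phi> :: "('b, 'w, ('o, 'a) cat, ('o, 'a, 'o, 'a) funct, ('o, 'a, 'o, 'a) nattr) psfun"
  assumes pseudo: "pseudo_functor (op_cat B) CAT \<Phi>"
begin

sublocale pseudo_functor "op_cat B" CAT \<Phi> by (fact pseudo)

sublocale B: category B using source_category by (simp add: category_op_cat)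

abbreviation \<eta> where "\<eta> A E \<equiv> NComp (PsUnit \<Phi> A) E"
abbreviation \<gamma> where "\<gamma> f g E \<equiv> NComp (PsComp \<Phi> f g) E"

lemma fibre_category: "A \<in> Obj B \<Longrightarrow> category (Ps0 \<Phi> A)"
  using ps0 by simp

lemma
  assumes "f \<in> Arr B"
  shows reindex_functor: "cat_functor (Ps1 \<Phi> f)"
    and reindex_src: "Src (Ps1 \<Phi> f) = Ps0 \<Phi> (Cod B f)"
    and reindex_tgt: "Tgt (Ps1 \<Phi> f) = Ps0 \<Phi> (Dom B f)"
  using ps1[of f] assms by auto

text \<open>The boundaries are kept as separate equations so that these rules also apply to \<open>f\<close> of
  the form \<open>Ide B A\<close> or \<open>Comp B h g\<close>, whose boundaries simplify.\<close>

lemma reindex_obj: "f \<in> Arr B \<Longrightarrow> Dom B f = A \<Longrightarrow> Cod B f = A' \<Longrightarrow> E \<in> Obj (Ps0 \<Phi> A') \<Longrightarrow>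
    OMap (Ps1 \<Phi> f) E \<in> Obj (Ps0 \<Phi> A)"
  and reindex_arr: "f \<in> Arr B \<Longrightarrow> Dom B f = A \<Longrightarrow> Cod B f = A' \<Longrightarrow> h \<in> Arr (Ps0 \<Phi> A') \<Longrightarrow>
    AMap (Ps1 \<Phi> f) h \<in> Arr (Ps0 \<Phi> A)"
  and reindex_dom: "f \<in> Arr B \<Longrightarrow> Dom B f = A \<Longrightarrow> Cod B f = A' \<Longrightarrow> h \<in> Arr (Ps0 \<Phi> A') \<Longrightarrow>
    Dom (Ps0 \<Phi> A) (AMap (Ps1 \<Phi> f) h) = OMap (Ps1 \<Phi> f) (Dom (Ps0 \<Phi> A') h)"
  and reindex_cod: "f \<in> Arr B \<Longrightarrow> Dom B f = A \<Longrightarrow> Cod B f = A' \<Longrightarrow> h \<in> Arr (Ps0 \<Phi> A') \<Longrightarrow>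
    Cod (Ps0 \<Phi> A) (AMap (Ps1 \<Phi> f) h) = OMap (Ps1 \<Phi> f) (Cod (Ps0 \<Phi> A') h)"
  and reindex_ide: "f \<in> Arr B \<Longrightarrow> Cod B f = A' \<Longrightarrow> E \<in> Obj (Ps0 \<Phi> A') \<Longrightarrow>
    AMap (Ps1 \<Phi> f) (Ide (Ps0 \<Phi> A') E) = Ide (Ps0 \<Phi> (Dom B f)) (OMap (Ps1 \<Phi> f) E)"
  and reindex_comp: "f \<in> Arr B \<Longrightarrow> Cod B f = A' \<Longrightarrow> h \<in> Arr (Ps0 \<Phi> A') \<Longrightarrow> k \<in> Arr (Ps0 \<Phi> A') \<Longrightarrow>
    Cod (Ps0 \<Phi> A') h = Dom (Ps0 \<Phi> A') k \<Longrightarrow> AMap (Ps1 \<Phi> f) (Comp (Ps0 \<Phi> A') k h)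
      = Comp (Ps0 \<Phi> (Dom B f)) (AMap (Ps1 \<Phi> f) k) (AMap (Ps1 \<Phi> f) h)"
  using fun_rules[OF reindex_functor[of f]] by (auto simp: reindex_src reindex_tgt)

lemma unit_nat_trans:
  assumes "A \<in> Obj B"
  shows "nat_trans (PsUnit \<Phi> A)" "NSrc (PsUnit \<Phi> A) = fid (Ps0 \<Phi> A)"
    "NTgt (PsUnit \<Phi> A) = Ps1 \<Phi> (Ide B A)"
  using ps_unit[of A] assms by (auto dest: invertible2_cell)

lemma unit:
  assumes "A \<in> Obj B" "E \<in> Obj (Ps0 \<Phi> A)"
  shows unit_arr: "\<eta> A E \<in> Arr (Ps0 \<Phi> A)"
    and unit_dom: "Dom (Ps0 \<Phi> A) (\<eta> A E) = E"
    and unit_cod: "Cod (Ps0 \<Phi> A) (\<eta> A E) = OMap (Ps1 \<Phi> (Ide B A)) E"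
  using assms nt_rules[OF unit_nat_trans(1)[OF assms(1)]] by (simp_all add: unit_nat_trans)

lemma unit_natural:
  assumes "A \<in> Obj B" "h \<in> Arr (Ps0 \<Phi> A)"
  shows "Comp (Ps0 \<Phi> A) (\<eta> A (Cod (Ps0 \<Phi> A) h)) h
    = Comp (Ps0 \<Phi> A) (AMap (Ps1 \<Phi> (Ide B A)) h) (\<eta> A (Dom (Ps0 \<Phi> A) h))"
  using assms nat_trans.naturality_arr[OF unit_nat_trans(1)[OF assms(1)], of h]
  by (simp add: unit_nat_trans)

lemma comp_nat_trans:
  assumes "f \<in> Arr B" "g \<in> Arr B" "Cod B f = Dom B g"
  shows "nat_trans (PsComp \<Phi> f g)" "NSrc (PsComp \<Phi> f g) = fcomp (Ps1 \<Phi> f) (Ps1 \<Phi> g)"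
    "NTgt (PsComp \<Phi> f g) = Ps1 \<Phi> (Comp B g f)" "invertible2 CAT (PsComp \<Phi> f g)"
  using ps_comp[of g "Cod B g" "Dom B g" f "Dom B f"] assms
  by (auto simp: Hom_def dest: invertible2_cell)

lemma comp_cell:
  assumes "f \<in> Arr B" "g \<in> Arr B" "Cod B f = Dom B g" "Dom B f = A" "E \<in> Obj (Ps0 \<Phi> (Cod B g))"
  shows comp_cell_arr: "\<gamma> f g E \<in> Arr (Ps0 \<Phi> A)"
    and comp_cell_dom: "Dom (Ps0 \<Phi> A) (\<gamma> f g E) = OMap (Ps1 \<Phi> f) (OMap (Ps1 \<Phi> g) E)"
    and comp_cell_cod: "Cod (Ps0 \<Phi> A) (\<gamma> f g E) = OMap (Ps1 \<Phi> (Comp B g f)) E"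
  using assms nt_rules[OF comp_nat_trans(1)[OF assms(1-3)]]
  by (auto simp: comp_nat_trans reindex_src reindex_tgt)

lemma comp_cell_natural:
  assumes "f \<in> Arr B" "g \<in> Arr B" "Cod B f = Dom B g" "k \<in> Arr (Ps0 \<Phi> (Cod B g))"
  shows "Comp (Ps0 \<Phi> (Dom B f)) (\<gamma> f g (Cod (Ps0 \<Phi> (Cod B g)) k)) (AMap (Ps1 \<Phi> f) (AMap (Ps1 \<Phi> g) k))
    = Comp (Ps0 \<Phi> (Dom B f)) (AMap (Ps1 \<Phi> (Comp B g f)) k) (\<gamma> f g (Dom (Ps0 \<Phi> (Cod B g)) k))"
  using assms nat_trans.naturality_arr[OF comp_nat_trans(1)[OF assms(1-3)], of k]
  by (simp add: comp_nat_trans reindex_src reindex_tgt)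

lemma comp_cell_inverse:
  assumes "f \<in> Arr B" "g \<in> Arr B" "Cod B f = Dom B g" "E \<in> Obj (Ps0 \<Phi> (Cod B g))"
  obtains \<delta> where "\<delta> \<in> Arr (Ps0 \<Phi> (Dom B f))"
    "Dom (Ps0 \<Phi> (Dom B f)) \<delta> = OMap (Ps1 \<Phi> (Comp B g f)) E"
    "Cod (Ps0 \<Phi> (Dom B f)) \<delta> = OMap (Ps1 \<Phi> f) (OMap (Ps1 \<Phi> g) E)"
    "Comp (Ps0 \<Phi> (Dom B f)) \<delta> (\<gamma> f g E) = Ide (Ps0 \<Phi> (Dom B f)) (OMap (Ps1 \<Phi> f) (OMap (Ps1 \<Phi> g) E))"
    "Comp (Ps0 \<Phi> (Dom B f)) (\<gamma> f g E) \<delta> = Ide (Ps0 \<Phi> (Dom B f)) (OMap (Ps1 \<Phi> (Comp B g f)) E)"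
proof -
  note gf = comp_nat_trans[OF assms(1-3)]
  note [simp] = assms reindex_src reindex_tgt B.comp_arr B.comp_dom B.comp_cod
  obtain s where s: "nat_trans s" "NSrc s = Ps1 \<Phi> (Comp B g f)"
    "NTgt s = fcomp (Ps1 \<Phi> f) (Ps1 \<Phi> g)" "nvcomp s (PsComp \<Phi> f g) = nid (fcomp (Ps1 \<Phi> f) (Ps1 \<Phi> g))"
    "nvcomp (PsComp \<Phi> f g) s = nid (Ps1 \<Phi> (Comp B g f))"
    using gf by (auto simp: invertible2_def)
  have "Comp (Ps0 \<Phi> (Dom B f)) (NComp s E) (\<gamma> f g E)
      = Ide (Ps0 \<Phi> (Dom B f)) (OMap (Ps1 \<Phi> f) (OMap (Ps1 \<Phi> g) E))"
    using arg_cong[OF s(4), of "\<lambda>t. NComp t E"] gf by simp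
  moreover have "Comp (Ps0 \<Phi> (Dom B f)) (\<gamma> f g E) (NComp s E)
      = Ide (Ps0 \<Phi> (Dom B f)) (OMap (Ps1 \<Phi> (Comp B g f)) E)"
    using arg_cong[OF s(5), of "\<lambda>t. NComp t E"] gf s(2) by simp
  ultimately show thesis
    using s(2,3) nt_rules[OF s(1)] by (intro that[of "NComp s E"]) simp_all
qed

lemma unit_right:
  assumes "f \<in> Arr B" "E \<in> Obj (Ps0 \<Phi> (Cod B f))"
  shows "Comp (Ps0 \<Phi> (Dom B f)) (\<gamma> f (Ide B (Cod B f)) E) (AMap (Ps1 \<Phi> f) (\<eta> (Cod B f) E))
    = Ide (Ps0 \<Phi> (Dom B f)) (OMap (Ps1 \<Phi> f) E)"
proof -
  note [simp] = assms reindex_src reindex_tgt cat_rules[OF B.category_axioms] fibre_category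
    reindex_obj reindex_arr reindex_dom reindex_cod comp_nat_trans unit_nat_trans B.category_axioms
    unit comp_cell fcomp_fid_right reindex_functor
  have "nvcomp (PsComp \<Phi> f (Ide B (Cod B f))) (nhcomp (nid (Ps1 \<Phi> f)) (PsUnit \<Phi> (Cod B f)))
      = nid (Ps1 \<Phi> f)"
    using ps_unit_right[of f "Cod B f" "Dom B f"] by (simp add: Hom_def)
  from arg_cong[OF this, of "\<lambda>t. NComp t E"] show ?thesis
    by (simp add: category.comp_ide_cod)
qed

lemma unit_left:
  assumes "f \<in> Arr B" "E \<in> Obj (Ps0 \<Phi> (Cod B f))"
  shows "Comp (Ps0 \<Phi> (Dom B f)) (\<gamma> (Ide B (Dom B f)) f E) (\<eta> (Dom B f) (OMap (Ps1 \<Phi> f) E))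
    = Ide (Ps0 \<Phi> (Dom B f)) (OMap (Ps1 \<Phi> f) E)"
proof -
  note [simp] = assms reindex_src reindex_tgt cat_rules[OF B.category_axioms] fibre_category
    reindex_obj reindex_arr reindex_dom reindex_cod comp_nat_trans unit_nat_trans B.category_axioms
    unit comp_cell fcomp_fid_left reindex_functor
  have "nvcomp (PsComp \<Phi> (Ide B (Dom B f)) f) (nhcomp (PsUnit \<Phi> (Dom B f)) (nid (Ps1 \<Phi> f)))
      = nid (Ps1 \<Phi> f)"
    using ps_unit_left[of f "Cod B f" "Dom B f"] by (simp add: Hom_def)
  from arg_cong[OF this, of "\<lambda>t. NComp t E"] show ?thesis
    by (simp add: category.comp_ide_dom category.ide_arr category.ide_dom category.ide_cod)
qed

lemma comp_cell_assoc:
  assumes "f \<in> Arr B" "g \<in> Arr B" "h \<in> Arr B" "Cod B f = Dom B g" "Cod B g = Dom B h"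
    and "E \<in> Obj (Ps0 \<Phi> (Cod B h))"
  shows "Comp (Ps0 \<Phi> (Dom B f)) (\<gamma> f (Comp B h g) E) (AMap (Ps1 \<Phi> f) (\<gamma> g h E))
    = Comp (Ps0 \<Phi> (Dom B f)) (\<gamma> (Comp B g f) h E) (\<gamma> f g (OMap (Ps1 \<Phi> h) E))"
proof -
  note [simp] = assms reindex_src reindex_tgt B.comp_arr B.comp_dom B.comp_cod fibre_category
    reindex_obj reindex_arr reindex_dom reindex_cod comp_nat_trans unit_nat_trans B.category_axioms
    comp_cell reindex_functor B.dom_obj B.cod_obj reindex_ide
  have obj: "OMap (Ps1 \<Phi> h) E \<in> Obj (Ps0 \<Phi> (Dom B h))" by simp
  have obj': "OMap (Ps1 \<Phi> (Comp B h g)) E \<in> Obj (Ps0 \<Phi> (Dom B g))" using reindex_obj[of "Comp B h g"] by simp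
  have "nvcomp (PsComp \<Phi> f (Comp B h g)) (nhcomp (nid (Ps1 \<Phi> f)) (PsComp \<Phi> g h))
      = nvcomp (PsComp \<Phi> (Comp B g f) h) (nhcomp (PsComp \<Phi> f g) (nid (Ps1 \<Phi> h)))"
    using ps_assoc[of h "Cod B h" "Dom B h" g "Dom B g" f "Dom B f"] by (simp add: Hom_def)
  from arg_cong[OF this, of "\<lambda>t. NComp t E"] show ?thesis using obj obj'
    by (simp add: category.comp_ide_cod category.comp_ide_dom category.ide_arr category.ide_dom category.ide_cod)
qed

end

lemma groth_simps:
  "(A, E) \<in> Obj (groth B \<Phi>) \<longleftrightarrow> A \<in> Obj B \<and> E \<in> Obj (Ps0 \<Phi> A)"
  "(f, h, E) \<in> Arr (groth B \<Phi>) \<longleftrightarrow> f \<in> Arr B \<and> E \<in> Obj (Ps0 \<Phi> (Cod B f)) \<and>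
     h \<in> Arr (Ps0 \<Phi> (Dom B f)) \<and> Cod (Ps0 \<Phi> (Dom B f)) h = OMap (Ps1 \<Phi> f) E"
  "Dom (groth B \<Phi>) (f, h, E) = (Dom B f, Dom (Ps0 \<Phi> (Dom B f)) h)"
  "Cod (groth B \<Phi>) (f, h, E) = (Cod B f, E)"
  "Ide (groth B \<Phi>) (A, E) = (Ide B A, NComp (PsUnit \<Phi> A) E, E)"
  "Comp (groth B \<Phi>) (g, k, F) (f, h, E) = (Comp B g f,
     Comp (Ps0 \<Phi> (Dom B f)) (NComp (PsComp \<Phi> f g) F)
       (Comp (Ps0 \<Phi> (Dom B f)) (AMap (Ps1 \<Phi> f) k) h), F)"
  by (simp_all add: groth_def)

context indexed_category
begin

lemmas index_rules = B.category_axioms cat_boundary fibre_category reindex_obj reindex_arr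
  reindex_dom reindex_cod reindex_ide unit comp_cell

text \<open>Both composites contain the image of \<open>m\<close> under two successive reindexings. They agree by
  naturality of \<open>\<gamma>\<close> at \<open>m\<close> and the associativity law of \<open>\<gamma>\<close>.\<close>

lemma groth_assoc:
  assumes "(f, l, E) \<in> Arr (groth B \<Phi>)" "(g, k, G) \<in> Arr (groth B \<Phi>)" "(h, m, H) \<in> Arr (groth B \<Phi>)"
    and "Cod B f = Dom B g" "E = Dom (Ps0 \<Phi> (Dom B g)) k"
    and "Cod B g = Dom B h" "G = Dom (Ps0 \<Phi> (Dom B h)) m"
  shows "Comp (groth B \<Phi>) (h, m, H) (Comp (groth B \<Phi>) (g, k, G) (f, l, E))
    = Comp (groth B \<Phi>) (Comp (groth B \<Phi>) (h, m, H) (g, k, G)) (f, l, E)"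
proof -
  let ?A = "Ps0 \<Phi> (Dom B f)"
  note [simp] = assms(4-7) index_rules
  have [simp]: "f \<in> Arr B" "g \<in> Arr B" "h \<in> Arr B" "l \<in> Arr ?A" "k \<in> Arr (Ps0 \<Phi> (Dom B g))"
    "m \<in> Arr (Ps0 \<Phi> (Dom B h))" "H \<in> Obj (Ps0 \<Phi> (Cod B h))"
    "Cod ?A l = OMap (Ps1 \<Phi> f) (Dom (Ps0 \<Phi> (Dom B g)) k)"
    "Cod (Ps0 \<Phi> (Dom B g)) k = OMap (Ps1 \<Phi> g) (Dom (Ps0 \<Phi> (Dom B h)) m)"
    "Cod (Ps0 \<Phi> (Dom B h)) m = OMap (Ps1 \<Phi> h) H"
    using assms by (simp_all add: groth_simps)
  have [simp]: "Dom (Ps0 \<Phi> (Dom B h)) m \<in> Obj (Ps0 \<Phi> (Dom B h))"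
    "Dom (Ps0 \<Phi> (Dom B g)) k \<in> Obj (Ps0 \<Phi> (Dom B g))"
    by simp_all
  let ?r = "Comp ?A (AMap (Ps1 \<Phi> f) k) l"
  let ?gm = "AMap (Ps1 \<Phi> f) (AMap (Ps1 \<Phi> g) m)"
  have "Comp ?A (\<gamma> (Comp B g f) h H) (Comp ?A (AMap (Ps1 \<Phi> (Comp B g f)) m)
          (Comp ?A (\<gamma> f g (Dom (Ps0 \<Phi> (Dom B h)) m)) ?r))
      = Comp ?A (\<gamma> (Comp B g f) h H) (Comp ?A (\<gamma> f g (OMap (Ps1 \<Phi> h) H)) (Comp ?A ?gm ?r))"
    using comp_cell_natural[of f g m]
    by (intro arg_cong[of _ _ "Comp ?A (\<gamma> (Comp B g f) h H)"] category.square_comp) simp_all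
  also have "\<dots> = Comp ?A (\<gamma> f (Comp B h g) H) (Comp ?A (AMap (Ps1 \<Phi> f) (\<gamma> g h H)) (Comp ?A ?gm ?r))"
    using comp_cell_assoc[of f g h H] by (intro category.square_comp) simp_all
  finally show ?thesis
    by (simp add: groth_simps reindex_comp category.assoc)
qed

lemma groth_category: "category (groth B \<Phi>)"
proof (rule categoryI)
  note [simp] = groth_simps index_rules B.comp_ide_dom B.comp_ide_cod
  fix f assume f: "f \<in> Arr (groth B \<Phi>)"
  obtain p h E where fe: "f = (p, h, E)" by (cases f)
  have [simp]: "p \<in> Arr B" "E \<in> Obj (Ps0 \<Phi> (Cod B p))" "h \<in> Arr (Ps0 \<Phi> (Dom B p))"
    "Cod (Ps0 \<Phi> (Dom B p)) h = OMap (Ps1 \<Phi> p) E"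
    using f by (simp_all add: fe)
  show "Dom (groth B \<Phi>) f \<in> Obj (groth B \<Phi>)" "Cod (groth B \<Phi>) f \<in> Obj (groth B \<Phi>)"
    by (simp_all add: fe category.dom_obj)
  let ?A = "Ps0 \<Phi> (Dom B p)"
  have [simp]: "Dom ?A h \<in> Obj ?A" by (simp add: category.dom_obj)
  \<comment> \<open>Naturality of the unit moves it past \<open>h\<close>, to where the unit law applies.\<close>
  have "Comp ?A (\<gamma> (Ide B (Dom B p)) p E) (Comp ?A (AMap (Ps1 \<Phi> (Ide B (Dom B p))) h) (\<eta> (Dom B p) (Dom ?A h)))
     = Comp ?A (Comp ?A (\<gamma> (Ide B (Dom B p)) p E) (\<eta> (Dom B p) (OMap (Ps1 \<Phi> p) E))) h"
    using unit_natural[of "Dom B p" h] by (simp add: category.assoc)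
  also have "\<dots> = h" by (simp add: unit_left category.comp_ide_cod)
  finally show "Comp (groth B \<Phi>) f (Ide (groth B \<Phi>) (Dom (groth B \<Phi>) f)) = f"
    by (simp add: fe)
  have "Comp ?A (\<gamma> p (Ide B (Cod B p)) E) (Comp ?A (AMap (Ps1 \<Phi> p) (\<eta> (Cod B p) E)) h)
     = Comp ?A (Comp ?A (\<gamma> p (Ide B (Cod B p)) E) (AMap (Ps1 \<Phi> p) (\<eta> (Cod B p) E))) h"
    by (simp add: category.assoc)
  also have "\<dots> = h" by (simp add: unit_right category.comp_ide_cod)
  finally show "Comp (groth B \<Phi>) (Ide (groth B \<Phi>) (Cod (groth B \<Phi>) f)) f = f"
    by (simp add: fe)
next
  fix x assume "x \<in> Obj (groth B \<Phi>)"
  then show "Ide (groth B \<Phi>) x \<in> Arr (groth B \<Phi>) \<and> Dom (groth B \<Phi>) (Ide (groth B \<Phi>) x) = x \<and>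
      Cod (groth B \<Phi>) (Ide (groth B \<Phi>) x) = x"
    by (cases x) (simp add: groth_simps index_rules)
next
  fix f g assume fg: "f \<in> Arr (groth B \<Phi>)" "g \<in> Arr (groth B \<Phi>)"
    "Cod (groth B \<Phi>) f = Dom (groth B \<Phi>) g"
  obtain p h E where f: "f = (p, h, E)" by (cases f)
  obtain q k G where g: "g = (q, k, G)" by (cases g)
  show "Comp (groth B \<Phi>) g f \<in> Arr (groth B \<Phi>) \<and>
      Dom (groth B \<Phi>) (Comp (groth B \<Phi>) g f) = Dom (groth B \<Phi>) f \<and>
      Cod (groth B \<Phi>) (Comp (groth B \<Phi>) g f) = Cod (groth B \<Phi>) g"
    using fg by (simp add: f g groth_simps index_rules)
next
  fix f g h assume "f \<in> Arr (groth B \<Phi>)" "g \<in> Arr (groth B \<Phi>)" "h \<in> Arr (groth B \<Phi>)"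
    "Cod (groth B \<Phi>) f = Dom (groth B \<Phi>) g" "Cod (groth B \<Phi>) g = Dom (groth B \<Phi>) h"
  then show "Comp (groth B \<Phi>) h (Comp (groth B \<Phi>) g f)
      = Comp (groth B \<Phi>) (Comp (groth B \<Phi>) h g) f"
    by (cases f, cases g, cases h) (auto simp: groth_simps(3,4) intro: groth_assoc)
qed

lemma groth_proj_simps [simp]:
  "Src (groth_proj B \<Phi>) = groth B \<Phi>" "Tgt (groth_proj B \<Phi>) = B"
  "x \<in> Obj (groth B \<Phi>) \<Longrightarrow> OMap (groth_proj B \<Phi>) x = fst x"
  "f \<in> Arr (groth B \<Phi>) \<Longrightarrow> AMap (groth_proj B \<Phi>) f = fst f"
  by (simp_all add: groth_proj_def)

lemma groth_proj_functor: "cat_functor (groth_proj B \<Phi>)"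
proof -
  interpret G: category "groth B \<Phi>" by (fact groth_category)
  show ?thesis
  proof (rule cat_functorI)
    show "OMap (groth_proj B \<Phi>) \<in> extensional (Obj (Src (groth_proj B \<Phi>)))"
      "AMap (groth_proj B \<Phi>) \<in> extensional (Arr (Src (groth_proj B \<Phi>)))"
      by (simp_all add: groth_proj_def)
  qed (auto simp: G.category_axioms B.category_axioms G.dom_obj G.cod_obj G.ide_arr G.comp_arr,
      auto simp: groth_simps)
qed

text \<open>The lift of \<open>f\<close> at \<open>E\<close> is \<open>(f, id, E)\<close>; factoring through it only inverts a structure cell.\<close>

lemma groth_proj_fibration: "fibration (groth_proj B \<Phi>)"
proof -
  note [simp] = groth_simps index_rules
  have "cartesian (groth_proj B \<Phi>) (f, Ide (Ps0 \<Phi> (Dom B f)) (OMap (Ps1 \<Phi> f) E), E)"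
    if [simp]: "f \<in> Arr B" "E \<in> Obj (Ps0 \<Phi> (Cod B f))" for f E
  proof -
    let ?u = "(f, Ide (Ps0 \<Phi> (Dom B f)) (OMap (Ps1 \<Phi> f) E), E)"
    have u [simp]: "?u \<in> Arr (groth B \<Phi>)" by simp
    show ?thesis
      unfolding cartesian_def groth_proj_simps
    proof (intro conjI ballI impI u)
      fix v w assume v: "v \<in> Arr (groth B \<Phi>)"
        and w: "w \<in> Hom B (OMap (groth_proj B \<Phi>) (Dom (groth B \<Phi>) v))
            (OMap (groth_proj B \<Phi>) (Dom (groth B \<Phi>) ?u))"
        and vw: "Cod (groth B \<Phi>) v = Cod (groth B \<Phi>) ?u \<and>
          Comp B (AMap (groth_proj B \<Phi>) ?u) w = AMap (groth_proj B \<Phi>) v"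
      obtain g k E' where ve: "v = (g, k, E')" by (cases v)
      from v w vw have [simp]: "E' = E" "g = Comp B f w" "w \<in> Arr B"
        "Cod B w = Dom B f" "k \<in> Arr (Ps0 \<Phi> (Dom B w))"
        and k: "Cod (Ps0 \<Phi> (Dom B w)) k = OMap (Ps1 \<Phi> (Comp B f w)) E"
        by (auto simp: ve Hom_def category.dom_obj)
      let ?A = "Ps0 \<Phi> (Dom B w)"
      obtain \<delta> where \<delta> [simp]: "\<delta> \<in> Arr ?A" "Dom ?A \<delta> = OMap (Ps1 \<Phi> (Comp B f w)) E"
        "Cod ?A \<delta> = OMap (Ps1 \<Phi> w) (OMap (Ps1 \<Phi> f) E)"
        "Comp ?A \<delta> (\<gamma> w f E) = Ide ?A (OMap (Ps1 \<Phi> w) (OMap (Ps1 \<Phi> f) E))"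
        "Comp ?A (\<gamma> w f E) \<delta> = Ide ?A (OMap (Ps1 \<Phi> (Comp B f w)) E)"
        using comp_cell_inverse[of w f E] by auto
      have eq: "(l \<in> Arr ?A \<and> Cod ?A l = OMap (Ps1 \<Phi> w) (OMap (Ps1 \<Phi> f) E) \<and> Comp ?A (\<gamma> w f E) l = k)
          \<longleftrightarrow> l = Comp ?A \<delta> k" for l
      proof (intro iffI conjI)
        assume l: "l \<in> Arr ?A \<and> Cod ?A l = OMap (Ps1 \<Phi> w) (OMap (Ps1 \<Phi> f) E) \<and> Comp ?A (\<gamma> w f E) l = k"
        then have "Comp ?A \<delta> k = Comp ?A (Comp ?A \<delta> (\<gamma> w f E)) l"
          by (auto simp: category.assoc simp del: \<delta>(4))
        then show "l = Comp ?A \<delta> k" using l by (simp add: category.comp_ide_cod)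
      next
        assume [simp]: "l = Comp ?A \<delta> k"
        show "l \<in> Arr ?A" "Cod ?A l = OMap (Ps1 \<Phi> w) (OMap (Ps1 \<Phi> f) E)" using k by simp_all
        have "Comp ?A (\<gamma> w f E) l = Comp ?A (Comp ?A (\<gamma> w f E) \<delta>) k"
          using k by (simp add: category.assoc del: \<delta>(5))
        then show "Comp ?A (\<gamma> w f E) l = k" using k by (simp add: category.comp_ide_cod)
      qed
      define x where "x = (w, Comp ?A \<delta> k, OMap (Ps1 \<Phi> f) E)"
      have l: "Comp ?A \<delta> k \<in> Arr ?A" "Cod ?A (Comp ?A \<delta> k) = OMap (Ps1 \<Phi> w) (OMap (Ps1 \<Phi> f) E)"
        "Dom ?A (Comp ?A \<delta> k) = Dom ?A k"
        "Comp ?A (\<gamma> w f E) (Comp ?A \<delta> k) = k"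
        using eq[of "Comp ?A \<delta> k"] k by simp_all
      show "\<exists>!x. x \<in> Hom (groth B \<Phi>) (Dom (groth B \<Phi>) v) (Dom (groth B \<Phi>) ?u) \<and>
          AMap (groth_proj B \<Phi>) x = w \<and> Comp (groth B \<Phi>) ?u x = v"
      proof (rule ex1I)
        show "x \<in> Hom (groth B \<Phi>) (Dom (groth B \<Phi>) v) (Dom (groth B \<Phi>) ?u) \<and>
          AMap (groth_proj B \<Phi>) x = w \<and> Comp (groth B \<Phi>) ?u x = v"
          using l by (simp add: x_def Hom_def ve category.comp_ide_cod)
        fix y assume y: "y \<in> Hom (groth B \<Phi>) (Dom (groth B \<Phi>) v) (Dom (groth B \<Phi>) ?u) \<and>
          AMap (groth_proj B \<Phi>) y = w \<and> Comp (groth B \<Phi>) ?u y = v"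
        obtain w' l' E'' where "y = (w', l', E'')" by (cases y)
        moreover have "y \<in> Arr (groth B \<Phi>)" using y by (simp add: Hom_def)
        ultimately show "y = x"
          using y eq[of l'] by (auto simp: x_def Hom_def ve category.comp_ide_cod)
      qed
    qed
  qed
  moreover have "(f, Ide (Ps0 \<Phi> (Dom B f)) (OMap (Ps1 \<Phi> f) E), E) \<in> Arr (groth B \<Phi>)"
    if "f \<in> Arr B" "E \<in> Obj (Ps0 \<Phi> (Cod B f))" for f E
    using that by simp
  ultimately show ?thesis
    unfolding fibration_def using groth_proj_functor by fastforce
qed

end


section \<open>The total fibration of an indexed fibration\<close>

lemma cartesianI:
  assumes "u \<in> Arr (Src Q)"
    and "\<And>v w. v \<in> Arr (Src Q) \<Longrightarrow> Cod (Src Q) v = Cod (Src Q) u \<Longrightarrow> w \<in> Arr (Tgt Q) \<Longrightarrow>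
      Dom (Tgt Q) w = OMap Q (Dom (Src Q) v) \<Longrightarrow> Cod (Tgt Q) w = OMap Q (Dom (Src Q) u) \<Longrightarrow>
      Comp (Tgt Q) (AMap Q u) w = AMap Q v \<Longrightarrow>
      \<exists>!x. x \<in> Arr (Src Q) \<and> Dom (Src Q) x = Dom (Src Q) v \<and> Cod (Src Q) x = Dom (Src Q) u \<and>
        AMap Q x = w \<and> Comp (Src Q) u x = v"
  shows "cartesian Q u"
  using assms unfolding cartesian_def Hom_def by (auto simp: conj_assoc)

lemma cartesian_arr: "cartesian Q u \<Longrightarrow> u \<in> Arr (Src Q)"
  by (simp add: cartesian_def)

lemma cartesian_factor:
  assumes "cartesian Q u" "v \<in> Arr (Src Q)" "Cod (Src Q) v = Cod (Src Q) u" "w \<in> Arr (Tgt Q)"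
    and "Dom (Tgt Q) w = OMap Q (Dom (Src Q) v)" "Cod (Tgt Q) w = OMap Q (Dom (Src Q) u)"
    and "Comp (Tgt Q) (AMap Q u) w = AMap Q v"
  shows "\<exists>!x. x \<in> Arr (Src Q) \<and> Dom (Src Q) x = Dom (Src Q) v \<and> Cod (Src Q) x = Dom (Src Q) u \<and>
        AMap Q x = w \<and> Comp (Src Q) u x = v"
  using assms unfolding cartesian_def Hom_def by (auto simp: conj_assoc)

lemma fibrationI:
  assumes "cat_functor Q"
    and "\<And>y f. y \<in> Obj (Src Q) \<Longrightarrow> f \<in> Arr (Tgt Q) \<Longrightarrow> Cod (Tgt Q) f = OMap Q y \<Longrightarrow>
      \<exists>u. cartesian Q u \<and> Cod (Src Q) u = y \<and> AMap Q u = f"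
  shows "fibration Q"
  using assms by (simp add: fibration_def)

lemma fibration_lift:
  assumes "fibration Q" "y \<in> Obj (Src Q)" "f \<in> Arr (Tgt Q)" "Cod (Tgt Q) f = OMap Q y"
  obtains u where "cartesian Q u" "Cod (Src Q) u = y" "AMap Q u = f"
  using assms unfolding fibration_def by blast

text \<open>A strict transformation of indexed categories whose components are fibrations and whose
  naturality squares preserve Cartesian arrows: the elementwise form of a pseudo-functor into \<open>FIBc\<close>.\<close>

locale indexed_fibration = E: indexed_category B \<Phi> + D: indexed_category B \<Psi>
  for B :: "('b, 'w) cat"
    and \<Phi> :: "('b, 'w, ('e, 'u) cat, ('e, 'u, 'e, 'u) funct, ('e, 'u, 'e, 'u) nattr) psfun"
    and \<Psi> :: "('b, 'w, ('d, 'v) cat, ('d, 'v, 'd, 'v) funct, ('d, 'v, 'd, 'v) nattr) psfun"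
    and \<tau> :: "'b \<Rightarrow> ('e, 'u, 'd, 'v) funct" +
  assumes component: "A \<in> Obj B \<Longrightarrow> fibration (\<tau> A)"
    and component_src: "A \<in> Obj B \<Longrightarrow> Src (\<tau> A) = Ps0 \<Phi> A"
    and component_tgt: "A \<in> Obj B \<Longrightarrow> Tgt (\<tau> A) = Ps0 \<Psi> A"
    and strict: "f \<in> Arr B \<Longrightarrow> fcomp (\<tau> (Dom B f)) (Ps1 \<Phi> f) = fcomp (Ps1 \<Psi> f) (\<tau> (Cod B f))"
    and reindex_cartesian: "f \<in> Arr B \<Longrightarrow> cartesian (\<tau> (Cod B f)) h \<Longrightarrow>
      cartesian (\<tau> (Dom B f)) (AMap (Ps1 \<Phi> f) h)"
    and strict_unit: "A \<in> Obj B \<Longrightarrow> x \<in> Obj (Ps0 \<Phi> A) \<Longrightarrow>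
      AMap (\<tau> A) (E.\<eta> A x) = D.\<eta> A (OMap (\<tau> A) x)"
    and strict_comp: "f \<in> Arr B \<Longrightarrow> g \<in> Arr B \<Longrightarrow> Cod B f = Dom B g \<Longrightarrow> x \<in> Obj (Ps0 \<Phi> (Cod B g)) \<Longrightarrow>
      AMap (\<tau> (Dom B f)) (E.\<gamma> f g x) = D.\<gamma> f g (OMap (\<tau> (Cod B g)) x)"
begin

lemma component_functor: "A \<in> Obj B \<Longrightarrow> cat_functor (\<tau> A)"
  using component by (simp add: fibration_def)

lemma component_obj: "A \<in> Obj B \<Longrightarrow> x \<in> Obj (Ps0 \<Phi> A) \<Longrightarrow> OMap (\<tau> A) x \<in> Obj (Ps0 \<Psi> A)"
  and component_arr: "A \<in> Obj B \<Longrightarrow> h \<in> Arr (Ps0 \<Phi> A) \<Longrightarrow> AMap (\<tau> A) h \<in> Arr (Ps0 \<Psi> A)"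
  and component_dom: "A \<in> Obj B \<Longrightarrow> h \<in> Arr (Ps0 \<Phi> A) \<Longrightarrow>
    Dom (Ps0 \<Psi> A) (AMap (\<tau> A) h) = OMap (\<tau> A) (Dom (Ps0 \<Phi> A) h)"
  and component_cod: "A \<in> Obj B \<Longrightarrow> h \<in> Arr (Ps0 \<Phi> A) \<Longrightarrow>
    Cod (Ps0 \<Psi> A) (AMap (\<tau> A) h) = OMap (\<tau> A) (Cod (Ps0 \<Phi> A) h)"
  and component_ide: "A \<in> Obj B \<Longrightarrow> x \<in> Obj (Ps0 \<Phi> A) \<Longrightarrow>
    AMap (\<tau> A) (Ide (Ps0 \<Phi> A) x) = Ide (Ps0 \<Psi> A) (OMap (\<tau> A) x)"
  and component_comp: "A \<in> Obj B \<Longrightarrow> h \<in> Arr (Ps0 \<Phi> A) \<Longrightarrow> k \<in> Arr (Ps0 \<Phi> A) \<Longrightarrow>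
    Cod (Ps0 \<Phi> A) h = Dom (Ps0 \<Phi> A) k \<Longrightarrow>
    AMap (\<tau> A) (Comp (Ps0 \<Phi> A) k h) = Comp (Ps0 \<Psi> A) (AMap (\<tau> A) k) (AMap (\<tau> A) h)"
  using fun_rules[OF component_functor[of A]] by (auto simp: component_src component_tgt)

lemma strict_obj: "f \<in> Arr B \<Longrightarrow> Dom B f = A \<Longrightarrow> x \<in> Obj (Ps0 \<Phi> (Cod B f)) \<Longrightarrow>
    OMap (\<tau> A) (OMap (Ps1 \<Phi> f) x) = OMap (Ps1 \<Psi> f) (OMap (\<tau> (Cod B f)) x)"
  and strict_arr: "f \<in> Arr B \<Longrightarrow> Dom B f = A \<Longrightarrow> h \<in> Arr (Ps0 \<Phi> (Cod B f)) \<Longrightarrow>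
    AMap (\<tau> A) (AMap (Ps1 \<Phi> f) h) = AMap (Ps1 \<Psi> f) (AMap (\<tau> (Cod B f)) h)"
  using arg_cong[OF strict[of f], of "\<lambda>F. OMap F x"] arg_cong[OF strict[of f], of "\<lambda>F. AMap F h"]
  by (auto simp: E.reindex_src component_src E.B.cod_obj)

lemmas component_rules = component_obj component_arr component_dom component_cod component_ide
  strict_obj strict_arr strict_unit strict_comp

abbreviation T where "T \<equiv> groth_map B \<Phi> \<Psi> \<tau>"

lemma groth_map_simps [simp]:
  "Src T = groth B \<Phi>" "Tgt T = groth B \<Psi>"
  "(A, x) \<in> Obj (groth B \<Phi>) \<Longrightarrow> OMap T (A, x) = (A, OMap (\<tau> A) x)"
  "(f, h, x) \<in> Arr (groth B \<Phi>) \<Longrightarrow>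
    AMap T (f, h, x) = (f, AMap (\<tau> (Dom B f)) h, OMap (\<tau> (Cod B f)) x)"
  by (auto simp: groth_map_def)

lemma groth_map_functor: "cat_functor T"
proof (rule cat_functorI)
  show "OMap T \<in> extensional (Obj (Src T))" "AMap T \<in> extensional (Arr (Src T))"
    by (simp_all add: groth_map_def)
  show "category (Src T)" "category (Tgt T)"
    by (simp_all add: E.groth_category D.groth_category)
  note [simp] = groth_simps E.index_rules D.index_rules component_rules
  show "OMap T x \<in> Obj (Tgt T)" if "x \<in> Obj (Src T)" for x
    using that by (cases x) auto
  show "AMap T a \<in> Arr (Tgt T) \<and> Dom (Tgt T) (AMap T a) = OMap T (Dom (Src T) a) \<and>
      Cod (Tgt T) (AMap T a) = OMap T (Cod (Src T) a)" if "a \<in> Arr (Src T)" for a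
    using that by (cases a) auto
  show "AMap T (Ide (Src T) x) = Ide (Tgt T) (OMap T x)" if "x \<in> Obj (Src T)" for x
    using that by (cases x) auto
  fix a b assume ab: "a \<in> Arr (Src T)" "b \<in> Arr (Src T)" "Cod (Src T) a = Dom (Src T) b"
  obtain f h x where a: "a = (f, h, x)" by (cases a)
  obtain g k y where b: "b = (g, k, y)" by (cases b)
  have "AMap (\<tau> (Dom B f)) (Comp (Ps0 \<Phi> (Dom B f)) (AMap (Ps1 \<Phi> f) k) h)
      = Comp (Ps0 \<Psi> (Dom B f)) (AMap (Ps1 \<Psi> f) (AMap (\<tau> (Cod B f)) k)) (AMap (\<tau> (Dom B f)) h)"
    using ab by (simp add: a b component_comp)
  then show "AMap T (Comp (Src T) b a) = Comp (Tgt T) (AMap T b) (AMap T a)"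
    using ab by (simp add: a b component_comp)
qed

text \<open>An arrow whose fibre part is Cartesian in its fibre is Cartesian: a factorisation problem is
  moved into a single fibre by inverting a structure cell, and solved there because reindexing
  preserves Cartesian arrows.\<close>

lemma groth_map_cartesian:
  assumes "(f, h, x) \<in> Arr (groth B \<Phi>)" and h: "cartesian (\<tau> (Dom B f)) h"
  shows "cartesian T (f, h, x)"
proof (rule cartesianI)
  note [simp] = groth_simps E.index_rules D.index_rules component_rules
  show "(f, h, x) \<in> Arr (Src T)" using assms(1) by simp
  fix v w assume v: "v \<in> Arr (Src T)" "Cod (Src T) v = Cod (Src T) (f, h, x)"
    and w: "w \<in> Arr (Tgt T)" "Dom (Tgt T) w = OMap T (Dom (Src T) v)"
      "Cod (Tgt T) w = OMap T (Dom (Src T) (f, h, x))"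
    and vw: "Comp (Tgt T) (AMap T (f, h, x)) w = AMap T v"
  have [simp]: "f \<in> Arr B" "x \<in> Obj (Ps0 \<Phi> (Cod B f))" "h \<in> Arr (Ps0 \<Phi> (Dom B f))"
    "Cod (Ps0 \<Phi> (Dom B f)) h = OMap (Ps1 \<Phi> f) x"
    using assms(1) by simp_all
  obtain g k x' where ve: "v = (g, k, x')" by (cases v)
  obtain p l z where we: "w = (p, l, z)" by (cases w)
  let ?C = "Ps0 \<Phi> (Dom B p)" and ?C' = "Ps0 \<Psi> (Dom B p)"
  have [simp]: "x' = x" "p \<in> Arr B" "Cod B p = Dom B f" "g = Comp B f p" "k \<in> Arr ?C"
    "z = OMap (\<tau> (Dom B f)) (Dom (Ps0 \<Phi> (Dom B f)) h)" "l \<in> Arr ?C'"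
    "Dom ?C' l = OMap (\<tau> (Dom B p)) (Dom ?C k)"
    "Cod ?C k = OMap (Ps1 \<Phi> (Comp B f p)) x" "Cod ?C' l = OMap (Ps1 \<Psi> p) z"
    using v w vw by (auto simp: ve we)
  have lk: "Comp ?C' (D.\<gamma> p f (OMap (\<tau> (Cod B f)) x)) (Comp ?C' (AMap (Ps1 \<Psi> p) (AMap (\<tau> (Dom B f)) h)) l)
      = AMap (\<tau> (Dom B p)) k"
    using v w vw by (auto simp: ve we)
  obtain \<delta> where \<delta>: "\<delta> \<in> Arr ?C" "Dom ?C \<delta> = OMap (Ps1 \<Phi> (Comp B f p)) x"
    "Cod ?C \<delta> = OMap (Ps1 \<Phi> p) (OMap (Ps1 \<Phi> f) x)"
    "Comp ?C \<delta> (E.\<gamma> p f x) = Ide ?C (OMap (Ps1 \<Phi> p) (OMap (Ps1 \<Phi> f) x))"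
    "Comp ?C (E.\<gamma> p f x) \<delta> = Ide ?C (OMap (Ps1 \<Phi> (Comp B f p)) x)"
    using E.comp_cell_inverse[of p f x] by auto
  note [simp] = \<delta>(1-3)
  let ?ph = "AMap (Ps1 \<Phi> p) h" and ?k = "Comp ?C \<delta> k"
  \<comment> \<open>Being a factor of \<open>v\<close> in the total category is the same as being a factor of \<open>?k\<close> in one fibre.\<close>
  have eq: "Comp ?C (E.\<gamma> p f x) (Comp ?C ?ph y) = k \<longleftrightarrow> Comp ?C ?ph y = ?k"
    if [simp]: "y \<in> Arr ?C" "Cod ?C y = OMap (Ps1 \<Phi> p) (Dom (Ps0 \<Phi> (Dom B f)) h)" for y
  proof
    assume "Comp ?C (E.\<gamma> p f x) (Comp ?C ?ph y) = k"
    then have "?k = Comp ?C (Comp ?C \<delta> (E.\<gamma> p f x)) (Comp ?C ?ph y)"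
      by (auto simp: category.assoc)
    then show "Comp ?C ?ph y = ?k" by (simp add: \<delta> category.comp_ide_cod)
  next
    assume "Comp ?C ?ph y = ?k"
    then have "Comp ?C (E.\<gamma> p f x) (Comp ?C ?ph y) = Comp ?C (Comp ?C (E.\<gamma> p f x) \<delta>) k"
      by (auto simp: category.assoc)
    then show "Comp ?C (E.\<gamma> p f x) (Comp ?C ?ph y) = k" by (simp add: \<delta> category.comp_ide_cod)
  qed
  \<comment> \<open>\<open>l\<close> solves the problem downstairs, since \<open>\<tau>\<close> commutes with the structure cells.\<close>
  have "Comp ?C' (AMap (\<tau> (Dom B p)) ?ph) l = AMap (\<tau> (Dom B p)) ?k"
  proof -
    have "AMap (\<tau> (Dom B p)) ?k = Comp ?C' (AMap (\<tau> (Dom B p)) \<delta>)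
        (Comp ?C' (AMap (\<tau> (Dom B p)) (E.\<gamma> p f x)) (Comp ?C' (AMap (\<tau> (Dom B p)) ?ph) l))"
      by (simp add: component_comp lk)
    also have "\<dots> = Comp ?C' (AMap (\<tau> (Dom B p)) (Comp ?C \<delta> (E.\<gamma> p f x)))
        (Comp ?C' (AMap (\<tau> (Dom B p)) ?ph) l)"
      by (simp add: component_comp category.assoc)
    also have "\<dots> = Comp ?C' (AMap (\<tau> (Dom B p)) ?ph) l"
      by (simp add: \<delta> category.comp_ide_cod)
    finally show ?thesis by simp
  qed
  moreover have "cartesian (\<tau> (Dom B p)) ?ph"
    using reindex_cartesian[of p h] h by simp
  ultimately have "\<exists>!y. y \<in> Arr ?C \<and> Dom ?C y = Dom ?C k \<and>
      Cod ?C y = OMap (Ps1 \<Phi> p) (Dom (Ps0 \<Phi> (Dom B f)) h) \<and>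
      AMap (\<tau> (Dom B p)) y = l \<and> Comp ?C ?ph y = ?k"
    using cartesian_factor[of "\<tau> (Dom B p)" ?ph ?k l] by (simp add: component_src component_tgt)
  then obtain y where y: "y \<in> Arr ?C" "Dom ?C y = Dom ?C k"
      "Cod ?C y = OMap (Ps1 \<Phi> p) (Dom (Ps0 \<Phi> (Dom B f)) h)"
      "AMap (\<tau> (Dom B p)) y = l" "Comp ?C ?ph y = ?k"
    and y_unique: "\<And>y'. y' \<in> Arr ?C \<Longrightarrow> Dom ?C y' = Dom ?C k \<Longrightarrow>
      Cod ?C y' = OMap (Ps1 \<Phi> p) (Dom (Ps0 \<Phi> (Dom B f)) h) \<Longrightarrow>
      AMap (\<tau> (Dom B p)) y' = l \<Longrightarrow> Comp ?C ?ph y' = ?k \<Longrightarrow> y' = y"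
    by metis
  show "\<exists>!X. X \<in> Arr (Src T) \<and> Dom (Src T) X = Dom (Src T) v \<and>
      Cod (Src T) X = Dom (Src T) (f, h, x) \<and> AMap T X = w \<and> Comp (Src T) (f, h, x) X = v"
  proof (rule ex1I)
    show "(p, y, Dom (Ps0 \<Phi> (Dom B f)) h) \<in> Arr (Src T) \<and>
        Dom (Src T) (p, y, Dom (Ps0 \<Phi> (Dom B f)) h) = Dom (Src T) v \<and>
        Cod (Src T) (p, y, Dom (Ps0 \<Phi> (Dom B f)) h) = Dom (Src T) (f, h, x) \<and>
        AMap T (p, y, Dom (Ps0 \<Phi> (Dom B f)) h) = w \<and>
        Comp (Src T) (f, h, x) (p, y, Dom (Ps0 \<Phi> (Dom B f)) h) = v"
      using y eq[of y] by (simp add: ve we)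
    fix X assume X: "X \<in> Arr (Src T) \<and> Dom (Src T) X = Dom (Src T) v \<and>
      Cod (Src T) X = Dom (Src T) (f, h, x) \<and> AMap T X = w \<and> Comp (Src T) (f, h, x) X = v"
    obtain p' y' z' where Xe: "X = (p', y', z')" by (cases X)
    have [simp]: "p' = p" "z' = Dom (Ps0 \<Phi> (Dom B f)) h" using X by (auto simp: Xe we)
    have "y' \<in> Arr ?C" "Dom ?C y' = Dom ?C k" "AMap (\<tau> (Dom B p)) y' = l"
      "Cod ?C y' = OMap (Ps1 \<Phi> p) (Dom (Ps0 \<Phi> (Dom B f)) h)"
      "Comp ?C (E.\<gamma> p f x) (Comp ?C ?ph y') = k"
      using X by (auto simp: Xe we ve)
    then show "X = (p, y, Dom (Ps0 \<Phi> (Dom B f)) h)"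
      using y_unique[of y'] eq[of y'] by (simp add: Xe)
  qed
qed

text \<open>Only the fibre part of an arrow has to be lifted, and this happens within one fibre.\<close>

lemma groth_map_fibration: "fibration T"
proof (rule fibrationI)
  note [simp] = groth_simps E.index_rules D.index_rules component_rules
  fix y a assume y: "y \<in> Obj (Src T)" and a: "a \<in> Arr (Tgt T)" and ya: "Cod (Tgt T) a = OMap T y"
  obtain A x where ye: "y = (A, x)" by (cases y)
  obtain f k z where ae: "a = (f, k, z)" by (cases a)
  have [simp]: "f \<in> Arr B" "Cod B f = A" "x \<in> Obj (Ps0 \<Phi> A)" "k \<in> Arr (Ps0 \<Psi> (Dom B f))"
    "z = OMap (\<tau> A) x" "Cod (Ps0 \<Psi> (Dom B f)) k = OMap (Ps1 \<Psi> f) (OMap (\<tau> A) x)"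
    using y a ya by (auto simp: ye ae)
  obtain h where h: "cartesian (\<tau> (Dom B f)) h" "Cod (Ps0 \<Phi> (Dom B f)) h = OMap (Ps1 \<Phi> f) x"
    "AMap (\<tau> (Dom B f)) h = k"
    using fibration_lift[OF component, of "Dom B f" "OMap (Ps1 \<Phi> f) x" k]
    by (auto simp: component_src component_tgt)
  have "h \<in> Arr (Ps0 \<Phi> (Dom B f))" using cartesian_arr[OF h(1)] by (simp add: component_src)
  then have "cartesian T (f, h, x) \<and> Cod (Src T) (f, h, x) = y \<and> AMap T (f, h, x) = a"
    using h groth_map_cartesian[of f h x] by (simp add: ye ae)
  then show "\<exists>u. cartesian T u \<and> Cod (Src T) u = y \<and> AMap T u = a" by blast
qed (fact groth_map_functor)

end

text \<open>Compatibility of a structure cell with the two fibrations that it connects says that the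
  transformation from the domain part to the codomain part commutes strictly with structure cells.\<close>

lemma pseudo_functor_indexed_fibration:
  assumes "pseudo_functor (op_cat B) FIBc \<Xi>"
  shows "indexed_fibration B (ps_postcomp dom_2functor \<Xi>) (ps_postcomp cod_2functor \<Xi>) (Ps0 \<Xi>)"
proof -
  interpret \<Xi>: pseudo_functor "op_cat B" FIBc \<Xi> by fact
  interpret B: category B using \<Xi>.source_category by (simp add: category_op_cat)
  have arr: "cartesian_morphism (Ps1 \<Xi> f)" "SqSrc (Ps1 \<Xi> f) = Ps0 \<Xi> (Cod B f)"
    "SqTgt (Ps1 \<Xi> f) = Ps0 \<Xi> (Dom B f)" if "f \<in> Arr B" for f
    using \<Xi>.ps1[of f] that by simp_all
  have unit: "cartesian_cell (PsUnit \<Xi> A)" "Sq2Src (PsUnit \<Xi> A) = sq_id (Ps0 \<Xi> A)" if "A \<in> Obj B" for A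
    using \<Xi>.ps_unit[of A] that by (auto dest: invertible2_cell)
  have comp: "cartesian_cell (PsComp \<Xi> f g)"
    "Sq2Src (PsComp \<Xi> f g) = sq_comp (Ps1 \<Xi> f) (Ps1 \<Xi> g)"
    if "f \<in> Arr B" "g \<in> Arr B" "Cod B f = Dom B g" for f g
    using \<Xi>.ps_comp[of g "Cod B g" "Dom B g" f "Dom B f"] that
    by (auto simp: Hom_def dest: invertible2_cell)
  show ?thesis
  proof (intro indexed_fibration.intro indexed_category.intro indexed_fibration_axioms.intro)
    show "pseudo_functor (op_cat B) CAT (ps_postcomp dom_2functor \<Xi>)"
      by (rule two_functor.pseudo_functor_postcomp[OF dom_two_functor]) fact
    show "pseudo_functor (op_cat B) CAT (ps_postcomp cod_2functor \<Xi>)"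
      by (rule two_functor.pseudo_functor_postcomp[OF cod_two_functor]) fact
  next
    fix A x assume "A \<in> Obj B" "x \<in> Obj (Ps0 (ps_postcomp dom_2functor \<Xi>) A)"
    then show "AMap (Ps0 \<Xi> A) (NComp (PsUnit (ps_postcomp dom_2functor \<Xi>) A) x)
        = NComp (PsUnit (ps_postcomp cod_2functor \<Xi>) A) (OMap (Ps0 \<Xi> A) x)"
      using unit[of A] square_cell_component[of "PsUnit \<Xi> A" x]
      by (simp add: ps_postcomp_def dom_2functor_def cod_2functor_def cartesian_cellD)
  next
    fix f g x assume "f \<in> Arr B" "g \<in> Arr B" "Cod B f = Dom B g"
      "x \<in> Obj (Ps0 (ps_postcomp dom_2functor \<Xi>) (Cod B g))"
    then show "AMap (Ps0 \<Xi> (Dom B f)) (NComp (PsComp (ps_postcomp dom_2functor \<Xi>) f g) x)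
        = NComp (PsComp (ps_postcomp cod_2functor \<Xi>) f g) (OMap (Ps0 \<Xi> (Cod B g)) x)"
      using comp[of f g] arr[of f] arr[of g] square_cell_component[of "PsComp \<Xi> f g" x]
      by (simp add: ps_postcomp_def dom_2functor_def cod_2functor_def cartesian_cellD)
  next
    fix f assume f: "f \<in> Arr B"
    show "fcomp (Ps0 \<Xi> (Dom B f)) (Ps1 (ps_postcomp dom_2functor \<Xi>) f)
        = fcomp (Ps1 (ps_postcomp cod_2functor \<Xi>) f) (Ps0 \<Xi> (Cod B f))"
      using arr[OF f]
      by (auto simp: ps_postcomp_def dom_2functor_def cod_2functor_def cartesian_morphism_def comm_square_def)
    fix h assume "cartesian (Ps0 \<Xi> (Cod B f)) h"
    then show "cartesian (Ps0 \<Xi> (Dom B f)) (AMap (Ps1 (ps_postcomp dom_2functor \<Xi>) f) h)"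
      using arr[OF f] by (simp add: ps_postcomp_def dom_2functor_def cartesian_morphism_def)
  qed (use \<Xi>.ps0 in \<open>simp_all add: ps_postcomp_def dom_2functor_def cod_2functor_def\<close>)
qed

lemma groth_composable_fibrations:
  assumes "pseudo_functor (op_cat B) FIBc \<Xi>"
  shows "composable_fibrations B (Q_of B \<Xi>) (P_of B \<Xi>)"
proof -
  interpret indexed_fibration B "ps_postcomp dom_2functor \<Xi>" "ps_postcomp cod_2functor \<Xi>" "Ps0 \<Xi>"
    by (rule pseudo_functor_indexed_fibration) fact
  show ?thesis
    using groth_map_fibration D.groth_proj_fibration
    by (simp add: composable_fibrations_def Q_of_def P_of_def)
qed


section \<open>The indexed category of fibres of a cloven fibration\<close>

lemma fibre_simps [simp]:
  "y \<in> Obj (fibre P A) \<longleftrightarrow> y \<in> Obj (Src P) \<and> OMap P y = A"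
  "u \<in> Arr (fibre P A) \<longleftrightarrow> u \<in> Arr (Src P) \<and> AMap P u = Ide (Tgt P) A"
  "Dom (fibre P A) = Dom (Src P)" "Cod (fibre P A) = Cod (Src P)" "Ide (fibre P A) = Ide (Src P)"
  "Comp (fibre P A) = Comp (Src P)"
  by (simp_all add: fibre_def)

text \<open>Both projections of \<open>Xi_of\<close> to \<open>CAT\<close> are of this form, for \<open>P\<close> and for the composite.\<close>

definition fibre_psfun :: "('d, 'v, 'b, 'w) funct \<Rightarrow> ('w \<Rightarrow> 'd \<Rightarrow> 'v)
    \<Rightarrow> ('b, 'w, ('d, 'v) cat, ('d, 'v, 'd, 'v) funct, ('d, 'v, 'd, 'v) nattr) psfun" where
  "fibre_psfun P c = \<lparr>Ps0 = fibre P, Ps1 = inverse_image P c, PsUnit = inverse_image_unit P c,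
     PsComp = inverse_image_comp P c\<rparr>"

locale cloven_fibration =
  fixes P :: "('d, 'v, 'b, 'w) funct" and c :: "'w \<Rightarrow> 'd \<Rightarrow> 'v"
  assumes is_functor: "cat_functor P" and cleavage: "cleavage P c"
begin

abbreviation "D \<equiv> Src P"
abbreviation "B \<equiv> Tgt P"

sublocale P: cat_functor P by (fact is_functor)
sublocale D: category D by (fact P.src_category)
sublocale B: category B by (fact P.tgt_category)

lemmas P_rules = P.omap_obj P.amap_arr P.amap_dom P.amap_cod P.amap_ide P.amap_comp_arr
  D.dom_obj D.cod_obj D.ide_arr D.ide_dom D.ide_cod D.comp_arr D.comp_dom D.comp_cod
  B.dom_obj B.cod_obj B.ide_arr B.ide_dom B.ide_cod B.comp_arr B.comp_dom B.comp_cod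
  B.comp_ide_dom B.comp_ide_cod

lemma lift:
  assumes "y \<in> Obj D" "f \<in> Arr B" "Cod B f = OMap P y"
  shows lift_cartesian: "cartesian P (c f y)"
    and lift_arr: "c f y \<in> Arr D"
    and lift_cod: "Cod D (c f y) = y"
    and lift_image: "AMap P (c f y) = f"
    and lift_dom_obj: "Dom D (c f y) \<in> Obj D"
    and lift_image_dom: "OMap P (Dom D (c f y)) = Dom B f"
proof -
  show 1: "cartesian P (c f y)" "Cod D (c f y) = y" "AMap P (c f y) = f"
    using cleavage assms unfolding cleavage_def by auto
  show 2: "c f y \<in> Arr D" using 1(1) by (rule cartesian_arr)
  show "Dom D (c f y) \<in> Obj D" "OMap P (Dom D (c f y)) = Dom B f"
    using 1 2 P.amap_dom[of "c f y"] by (simp_all add: P_rules)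
qed

lemma fibration: "fibration P"
  using is_functor lift_cartesian lift_cod lift_image by (intro fibrationI) blast+

lemma vfactor:
  assumes u: "cartesian P u" and v: "v \<in> Arr D" "Cod D v = Cod D u" "AMap P v = AMap P u"
  shows vfactor_arr: "vfactor P u v \<in> Arr D"
    and vfactor_dom: "Dom D (vfactor P u v) = Dom D v"
    and vfactor_cod: "Cod D (vfactor P u v) = Dom D u"
    and vfactor_image: "AMap P (vfactor P u v) = Ide B (OMap P (Dom D u))"
    and vfactor_comp: "Comp D u (vfactor P u v) = v"
proof -
  note u' = cartesian_arr[OF u]
  have d: "OMap P (Dom D v) = OMap P (Dom D u)"
    using v u' P.amap_dom[of v] P.amap_dom[of u] by simp
  have "Comp B (AMap P u) (Ide B (OMap P (Dom D u))) = AMap P v"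
    using u' v by (simp add: P_rules)
  then have "\<exists>!x. x \<in> Arr D \<and> Dom D x = Dom D v \<and> Cod D x = Dom D u \<and>
      AMap P x = Ide B (OMap P (Dom D u)) \<and> Comp D u x = v"
    using u' v by (intro cartesian_factor[OF u]) (simp_all add: P_rules d)
  then have "\<exists>!x. x \<in> Hom D (Dom D v) (Dom D u) \<and> AMap P x = Ide B (OMap P (Dom D u)) \<and> Comp D u x = v"
    by (simp add: Hom_def conj_assoc)
  from theI'[OF this] show "vfactor P u v \<in> Arr D" "Dom D (vfactor P u v) = Dom D v"
    "Cod D (vfactor P u v) = Dom D u" "AMap P (vfactor P u v) = Ide B (OMap P (Dom D u))"
    "Comp D u (vfactor P u v) = v"
    by (simp_all add: vfactor_def Hom_def)
qed

text \<open>The laws of the fibre pseudo-functor are equations between vertical arrows into the domain of a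
  Cartesian arrow, and are checked after composing with that arrow.\<close>

lemma cartesian_cancel:
  assumes u: "cartesian P u" and "x \<in> Arr D" "y \<in> Arr D" "Dom D x = Dom D y"
    and "Cod D x = Dom D u" "Cod D y = Dom D u" "AMap P x = AMap P y" "Comp D u x = Comp D u y"
  shows "x = y"
proof -
  have "\<exists>!z. z \<in> Arr D \<and> Dom D z = Dom D (Comp D u x) \<and> Cod D z = Dom D u \<and>
      AMap P z = AMap P x \<and> Comp D u z = Comp D u x"
    using assms cartesian_arr[OF u] P.amap_cod[of x] P.amap_dom[of x]
    by (intro cartesian_factor[OF u]) (simp_all add: P_rules)
  then show ?thesis using assms cartesian_arr[OF u] by (auto simp: D.comp_dom)
qed

lemma vfactor_eqI:
  assumes u: "cartesian P u" and "x \<in> Arr D" "Cod D x = Dom D u"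
    and "AMap P x = Ide B (OMap P (Dom D u))" "Comp D u x = v"
  shows "vfactor P u v = x"
proof -
  have v: "v \<in> Arr D" "Cod D v = Cod D u" "AMap P v = AMap P u" "Dom D v = Dom D x"
    using assms cartesian_arr[OF u] by (auto simp: P_rules simp flip: assms(5))
  show ?thesis
    using assms vfactor[OF u v(1-3)] v by - (rule cartesian_cancel[OF u], simp_all)
qed

text \<open>Two Cartesian arrows over the same arrow and with the same codomain differ by a vertical
  isomorphism.\<close>

lemma vfactor_inverse:
  assumes u: "cartesian P u" and v: "cartesian P v" and "Cod D v = Cod D u" "AMap P v = AMap P u"
  shows "Comp D (vfactor P u v) (vfactor P v u) = Ide D (Dom D u)"
proof (rule cartesian_cancel[OF u])
  note u' = cartesian_arr[OF u] and v' = cartesian_arr[OF v]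
  note uv = vfactor[OF u v' assms(3,4)] and vu = vfactor[OF v u' assms(3,4)[symmetric]]
  have d: "OMap P (Dom D v) = OMap P (Dom D u)"
    using assms v' u' P.amap_dom[of v] P.amap_dom[of u] by simp
  show "AMap P (Comp D (vfactor P u v) (vfactor P v u)) = AMap P (Ide D (Dom D u))"
    using uv vu u' v' by (simp add: P_rules d)
  have "Comp D u (Comp D (vfactor P u v) (vfactor P v u)) = Comp D (Comp D u (vfactor P u v)) (vfactor P v u)"
    using uv(1-3) vu(1-3) u' by (simp add: D.assoc)
  then show "Comp D u (Comp D (vfactor P u v) (vfactor P v u)) = Comp D u (Ide D (Dom D u))"
    using uv vu u' v' by (simp add: D.comp_ide_dom)
qed (use vfactor[OF u cartesian_arr[OF v] assms(3,4)] vfactor[OF v cartesian_arr[OF u] assms(3,4)[symmetric]]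
    cartesian_arr[OF u] in \<open>simp_all add: P_rules\<close>)

lemma cartesian_comp:
  assumes u: "cartesian P u" and v: "cartesian P v" and uv: "Cod D v = Dom D u"
  shows "cartesian P (Comp D u v)"
proof (rule cartesianI)
  note u' = cartesian_arr[OF u] and v' = cartesian_arr[OF v]
  note [simp] = P_rules u' v' uv
  show "Comp D u v \<in> Arr D" by simp
  have iv: "OMap P (Dom D u) = Cod B (AMap P v)" "OMap P (Dom D v) = Dom B (AMap P v)"
    by simp_all
  fix z w assume z: "z \<in> Arr D" "Cod D z = Cod D (Comp D u v)" and w: "w \<in> Arr B"
    "Dom B w = OMap P (Dom D z)" "Cod B w = OMap P (Dom D (Comp D u v))"
    and zw: "Comp B (AMap P (Comp D u v)) w = AMap P z"
  have vw: "Comp B (AMap P u) (Comp B (AMap P v) w) = AMap P z"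
    using zw w by (simp add: B.assoc)
  have "\<exists>!x. x \<in> Arr D \<and> Dom D x = Dom D z \<and> Cod D x = Dom D u \<and>
      AMap P x = Comp B (AMap P v) w \<and> Comp D u x = z"
    using z w vw by (intro cartesian_factor[OF u]) simp_all
  then obtain x where x: "x \<in> Arr D" "Dom D x = Dom D z" "Cod D x = Dom D u"
    "AMap P x = Comp B (AMap P v) w" "Comp D u x = z" by blast
  have "\<exists>!y. y \<in> Arr D \<and> Dom D y = Dom D x \<and> Cod D y = Dom D v \<and> AMap P y = w \<and> Comp D v y = x"
    using x z w by (intro cartesian_factor[OF v]) simp_all
  then obtain y where y: "y \<in> Arr D" "Dom D y = Dom D x" "Cod D y = Dom D v" "AMap P y = w"
    "Comp D v y = x" by blast
  show "\<exists>!y. y \<in> Arr D \<and> Dom D y = Dom D z \<and> Cod D y = Dom D (Comp D u v) \<and> AMap P y = w \<and>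
      Comp D (Comp D u v) y = z"
  proof (rule ex1I[of _ y])
    show "y \<in> Arr D \<and> Dom D y = Dom D z \<and> Cod D y = Dom D (Comp D u v) \<and> AMap P y = w \<and>
        Comp D (Comp D u v) y = z"
      using x y by (simp add: D.assoc)
    fix y' assume y': "y' \<in> Arr D \<and> Dom D y' = Dom D z \<and> Cod D y' = Dom D (Comp D u v) \<and>
      AMap P y' = w \<and> Comp D (Comp D u v) y' = z"
    have "Comp D v y' = x"
      using x y' w by - (rule cartesian_cancel[OF u], simp_all flip: D.assoc)
    then show "y' = y" using x y y' by - (rule cartesian_cancel[OF v], simp_all)
  qed
qed

lemma vertical_image:
  assumes "h \<in> Arr D" "AMap P h = Ide B A" "A \<in> Obj B"
  shows "OMap P (Dom D h) = A" "OMap P (Cod D h) = A"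
  using assms P.amap_dom[of h] P.amap_cod[of h] by (simp_all add: P_rules)

lemma fibre_category:
  assumes "A \<in> Obj B"
  shows "category (fibre P A)"
  by (rule categoryI) (auto simp: assms P_rules vertical_image[OF _ _ assms]
    D.comp_ide_dom D.comp_ide_cod D.assoc)

lemma inverse_image_simps [simp]:
  "Src (inverse_image P c f) = fibre P (Cod B f)" "Tgt (inverse_image P c f) = fibre P (Dom B f)"
  "y \<in> Obj D \<Longrightarrow> OMap P y = Cod B f \<Longrightarrow> OMap (inverse_image P c f) y = Dom D (c f y)"
  by (simp_all add: inverse_image_def)

lemma inverse_image_arr:
  assumes f: "f \<in> Arr B" and h: "h \<in> Arr D" "AMap P h = Ide B (Cod B f)"
  shows "AMap (inverse_image P c f) h \<in> Arr D"
    and "Dom D (AMap (inverse_image P c f) h) = Dom D (c f (Dom D h))"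
    and "Cod D (AMap (inverse_image P c f) h) = Dom D (c f (Cod D h))"
    and "AMap P (AMap (inverse_image P c f) h) = Ide B (Dom B f)"
    and "Comp D (c f (Cod D h)) (AMap (inverse_image P c f) h) = Comp D h (c f (Dom D h))"
proof -
  note vi = vertical_image[OF h, OF B.cod_obj[OF f]]
  have d: "Dom D h \<in> Obj D" "Cod D h \<in> Obj D" using h by (simp_all add: P_rules)
  note l = lift[OF d(1) f vi(1)[symmetric]] and l' = lift[OF d(2) f vi(2)[symmetric]]
  have v: "Comp D h (c f (Dom D h)) \<in> Arr D" "Cod D (Comp D h (c f (Dom D h))) = Cod D (c f (Cod D h))"
    "AMap P (Comp D h (c f (Dom D h))) = AMap P (c f (Cod D h))"
    using l l' h f by (simp_all add: P_rules)
  show "AMap (inverse_image P c f) h \<in> Arr D"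
    "Dom D (AMap (inverse_image P c f) h) = Dom D (c f (Dom D h))"
    "Cod D (AMap (inverse_image P c f) h) = Dom D (c f (Cod D h))"
    "AMap P (AMap (inverse_image P c f) h) = Ide B (Dom B f)"
    "Comp D (c f (Cod D h)) (AMap (inverse_image P c f) h) = Comp D h (c f (Dom D h))"
    using vfactor[OF l'(1) v] h l l' by (simp_all add: inverse_image_def D.comp_dom)
qed

lemma inverse_image_functor:
  assumes f: "f \<in> Arr B"
  shows "cat_functor (inverse_image P c f)"
proof (rule cat_functorI)
  let ?F = "inverse_image P c f"
  note [simp] = f P_rules fibre_category inverse_image_arr lift
  show "OMap ?F \<in> extensional (Obj (Src ?F))" "AMap ?F \<in> extensional (Arr (Src ?F))"
    by (simp_all add: inverse_image_def)
  show "AMap ?F h \<in> Arr (Tgt ?F) \<and> Dom (Tgt ?F) (AMap ?F h) = OMap ?F (Dom (Src ?F) h) \<and>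
      Cod (Tgt ?F) (AMap ?F h) = OMap ?F (Cod (Src ?F) h)" if "h \<in> Arr (Src ?F)" for h
    using that vertical_image[of h "Cod B f"] by simp
  show "AMap ?F (Ide (Src ?F) y) = Ide (Tgt ?F) (OMap ?F y)" if y: "y \<in> Obj (Src ?F)" for y
    using y by - (rule cartesian_cancel[OF lift_cartesian[of y f]],
      simp_all, metis D.comp_ide_cod D.comp_ide_dom D.ide_arr D.ide_cod D.ide_dom P.amap_ide
        f inverse_image_arr(5) lift_arr lift_cod)
  fix h k assume "h \<in> Arr (Src ?F)" "k \<in> Arr (Src ?F)" "Cod (Src ?F) h = Dom (Src ?F) k"
  then have [simp]: "h \<in> Arr D" "AMap P h = Ide B (Cod B f)" "k \<in> Arr D"
    "AMap P k = Ide B (Cod B f)" and hk: "Cod D h = Dom D k" by simp_all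
  have [simp]: "OMap P (Dom D h) = Cod B f" "OMap P (Dom D k) = Cod B f" "OMap P (Cod D k) = Cod B f"
    using vertical_image[of h "Cod B f"] vertical_image[of k "Cod B f"] by simp_all
  have "Comp D (c f (Cod D k)) (Comp D (AMap ?F k) (AMap ?F h))
      = Comp D (Comp D k (c f (Dom D k))) (AMap ?F h)"
    by (simp flip: D.assoc add: hk)
  also have "\<dots> = Comp D k (Comp D (c f (Dom D k)) (AMap ?F h))"
    by (simp add: D.assoc hk del: inverse_image_arr(5))
  also have "\<dots> = Comp D (Comp D k h) (c f (Dom D h))"
    using inverse_image_arr(5)[of f h] by (simp add: D.assoc hk)
  finally have "Comp D (c f (Cod D k)) (Comp D (AMap ?F k) (AMap ?F h))
    = Comp D (Comp D k h) (c f (Dom D h))" .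
  moreover have "Comp D (c f (Cod D k)) (AMap ?F (Comp D k h)) = Comp D (Comp D k h) (c f (Dom D h))"
    using inverse_image_arr(5)[of f "Comp D k h"] by (simp add: hk)
  ultimately have "AMap ?F (Comp D k h) = Comp D (AMap ?F k) (AMap ?F h)"
    by - (rule cartesian_cancel[OF lift_cartesian[of "Cod D k" f]], simp_all add: hk)
  then show "AMap ?F (Comp (Src ?F) k h) = Comp (Tgt ?F) (AMap ?F k) (AMap ?F h)" by simp
qed (simp_all add: f P_rules fibre_category lift)

lemma inverse_image_ide:
  "f \<in> Arr B \<Longrightarrow> y \<in> Obj D \<Longrightarrow> OMap P y = Cod B f \<Longrightarrow>
    AMap (inverse_image P c f) (Ide D y) = Ide D (Dom D (c f y))"
  using cat_functor.amap_ide[OF inverse_image_functor[of f], of y] by simp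

lemma inverse_image_unit_simps [simp]:
  "NSrc (inverse_image_unit P c A) = fid (fibre P A)"
  "NTgt (inverse_image_unit P c A) = inverse_image P c (Ide B A)"
  by (simp_all add: inverse_image_unit_def)

lemma inverse_image_unit_comp:
  assumes A: "A \<in> Obj B" and y: "y \<in> Obj D" "OMap P y = A"
  shows "NComp (inverse_image_unit P c A) y \<in> Arr D"
    and "Dom D (NComp (inverse_image_unit P c A) y) = y"
    and "Cod D (NComp (inverse_image_unit P c A) y) = Dom D (c (Ide B A) y)"
    and "AMap P (NComp (inverse_image_unit P c A) y) = Ide B A"
    and "Comp D (c (Ide B A) y) (NComp (inverse_image_unit P c A) y) = Ide D y"
proof -
  have l: "Ide B A \<in> Arr B" "Cod B (Ide B A) = OMap P y" using A y by (simp_all add: P_rules)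
  note l = lift[OF y(1) l]
  show "NComp (inverse_image_unit P c A) y \<in> Arr D"
    "Dom D (NComp (inverse_image_unit P c A) y) = y"
    "Cod D (NComp (inverse_image_unit P c A) y) = Dom D (c (Ide B A) y)"
    "AMap P (NComp (inverse_image_unit P c A) y) = Ide B A"
    "Comp D (c (Ide B A) y) (NComp (inverse_image_unit P c A) y) = Ide D y"
    using vfactor[OF l(1), of "Ide D y"] A y l by (simp_all add: inverse_image_unit_def P_rules)
qed

text \<open>The chosen lift of an identity is itself vertical, and it is the inverse of the unit.\<close>

lemma inverse_image_unit_nat_iso:
  assumes A: "A \<in> Obj B"
  shows inverse_image_unit_nat_trans: "nat_trans (inverse_image_unit P c A)"
    and inverse_image_unit_invertible: "invertible2 CAT (inverse_image_unit P c A)"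
proof -
  let ?t = "inverse_image_unit P c A"
  note [simp] = A P_rules fibre_category inverse_image_arr lift fid_functor inverse_image_functor
    inverse_image_unit_comp
  show t: "nat_trans ?t"
  proof (rule nat_transI)
    show "NComp ?t \<in> extensional (Obj (Src (NSrc ?t)))"
      by (simp add: inverse_image_unit_def)
    fix h assume "h \<in> Arr (Src (NSrc ?t))"
    then have h: "h \<in> Arr (fibre P A)" and [simp]: "h \<in> Arr D" "AMap P h = Ide B A" by simp_all
    have [simp]: "OMap P (Dom D h) = A" "OMap P (Cod D h) = A" using vertical_image[of h A] by simp_all
    let ?x = "Dom D h" and ?y = "Cod D h" and ?h = "AMap (inverse_image P c (Ide B A)) h"
    have "Comp D (c (Ide B A) ?y) (Comp D (NComp ?t ?y) h) = h"
      by (simp flip: D.assoc add: D.comp_ide_cod)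
    moreover have "Comp D (c (Ide B A) ?y) (Comp D ?h (NComp ?t ?x))
        = Comp D (Comp D h (c (Ide B A) ?x)) (NComp ?t ?x)"
      using inverse_image_arr(5)[of "Ide B A" h] by (simp flip: D.assoc)
    moreover have "\<dots> = h" by (simp add: D.assoc D.comp_ide_dom)
    ultimately have "Comp D (NComp ?t ?y) h = Comp D ?h (NComp ?t ?x)"
      by - (rule cartesian_cancel[OF lift_cartesian[of ?y "Ide B A"]], simp_all)
    then show "Comp (Tgt (NSrc ?t)) (NComp ?t (Cod (Src (NSrc ?t)) h)) (AMap (NSrc ?t) h)
        = Comp (Tgt (NSrc ?t)) (AMap (NTgt ?t) h) (NComp ?t (Dom (Src (NSrc ?t)) h))"
      using h by simp
  qed simp_all
  have "Comp D (NComp ?t y) (c (Ide B A) y) = Ide D (Dom D (c (Ide B A) y))"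
    if [simp]: "y \<in> Obj D" "OMap P y = A" for y
    by - (rule cartesian_cancel[OF lift_cartesian[of y "Ide B A"]],
      simp_all add: D.comp_ide_dom D.comp_ide_cod flip: D.assoc)
  then show "invertible2 CAT ?t"
    by (intro nat_iso_invertible2[OF t, where d = "c (Ide B A)"]) simp_all
qed

lemma inverse_image_comp_simps [simp]:
  "NSrc (inverse_image_comp P c f g) = fcomp (inverse_image P c f) (inverse_image P c g)"
  "NTgt (inverse_image_comp P c f g) = inverse_image P c (Comp B g f)"
  by (simp_all add: inverse_image_comp_def)

lemma inverse_image_comp_comp:
  assumes f: "f \<in> Arr B" "g \<in> Arr B" "Cod B f = Dom B g" and y: "y \<in> Obj D" "OMap P y = Cod B g"
  shows "NComp (inverse_image_comp P c f g) y \<in> Arr D"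
    and "Dom D (NComp (inverse_image_comp P c f g) y) = Dom D (c f (Dom D (c g y)))"
    and "Cod D (NComp (inverse_image_comp P c f g) y) = Dom D (c (Comp B g f) y)"
    and "AMap P (NComp (inverse_image_comp P c f g) y) = Ide B (Dom B f)"
    and "Comp D (c (Comp B g f) y) (NComp (inverse_image_comp P c f g) y)
      = Comp D (c g y) (c f (Dom D (c g y)))"
    and "vfactor P (c (Comp B g f) y) (Comp D (c g y) (c f (Dom D (c g y))))
      = NComp (inverse_image_comp P c f g) y"
proof -
  note [simp] = f y P_rules lift
  show "NComp (inverse_image_comp P c f g) y \<in> Arr D"
    "Dom D (NComp (inverse_image_comp P c f g) y) = Dom D (c f (Dom D (c g y)))"
    "Cod D (NComp (inverse_image_comp P c f g) y) = Dom D (c (Comp B g f) y)"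
    "AMap P (NComp (inverse_image_comp P c f g) y) = Ide B (Dom B f)"
    "Comp D (c (Comp B g f) y) (NComp (inverse_image_comp P c f g) y)
      = Comp D (c g y) (c f (Dom D (c g y)))"
    "vfactor P (c (Comp B g f) y) (Comp D (c g y) (c f (Dom D (c g y))))
      = NComp (inverse_image_comp P c f g) y"
    using vfactor[of "c (Comp B g f) y" "Comp D (c g y) (c f (Dom D (c g y)))"]
    by (simp_all add: inverse_image_comp_def)
qed

text \<open>A composite of chosen lifts is Cartesian over the composite arrow, so the comparison with the
  chosen lift of the composite is invertible.\<close>

lemma inverse_image_comp_nat_iso:
  assumes f: "f \<in> Arr B" "g \<in> Arr B" "Cod B f = Dom B g"
  shows inverse_image_comp_nat_trans: "nat_trans (inverse_image_comp P c f g)"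
    and inverse_image_comp_invertible: "invertible2 CAT (inverse_image_comp P c f g)"
proof -
  let ?t = "inverse_image_comp P c f g" and ?gf = "Comp B g f"
  note [simp] = f P_rules fibre_category inverse_image_arr lift fcomp_functor inverse_image_functor
    inverse_image_comp_comp
  show t: "nat_trans ?t"
  proof (rule nat_transI)
    show "NComp ?t \<in> extensional (Obj (Src (NSrc ?t)))"
      by (simp add: inverse_image_comp_def)
    fix h assume "h \<in> Arr (Src (NSrc ?t))"
    then have [simp]: "h \<in> Arr D" "AMap P h = Ide B (Cod B g)" by simp_all
    have [simp]: "OMap P (Dom D h) = Cod B g" "OMap P (Cod D h) = Cod B g"
      using vertical_image[of h "Cod B g"] by simp_all
    let ?x = "Dom D h" and ?y = "Cod D h"
    let ?gh = "AMap (inverse_image P c g) h"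
    let ?fgh = "AMap (inverse_image P c f) ?gh" and ?gfh = "AMap (inverse_image P c ?gf) h"
    have gh: "Dom D ?gh = Dom D (c g ?x)" "Cod D ?gh = Dom D (c g ?y)" by simp_all
    have fgh: "Comp D (c f (Dom D (c g ?y))) ?fgh = Comp D ?gh (c f (Dom D (c g ?x)))"
      using inverse_image_arr(5)[of f ?gh] by simp
    have fgh_bd [simp]: "?fgh \<in> Arr D" "Dom D ?fgh = Dom D (c f (Dom D (c g ?x)))"
      "Cod D ?fgh = Dom D (c f (Dom D (c g ?y)))" "AMap P ?fgh = Ide B (Dom B f)"
      using inverse_image_arr(1-4)[of f ?gh] by simp_all
    have "Comp D (c ?gf ?y) (Comp D (NComp ?t ?y) ?fgh)
        = Comp D (Comp D (c g ?y) (c f (Dom D (c g ?y)))) ?fgh"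
      by (simp flip: D.assoc)
    also have "\<dots> = Comp D (c g ?y) (Comp D ?gh (c f (Dom D (c g ?x))))"
      by (simp add: D.assoc fgh)
    also have "\<dots> = Comp D (Comp D h (c g ?x)) (c f (Dom D (c g ?x)))"
      by (simp flip: D.assoc)
    also have "\<dots> = Comp D h (Comp D (c ?gf ?x) (NComp ?t ?x))"
      by (simp add: D.assoc)
    also have "\<dots> = Comp D (Comp D (c ?gf ?y) ?gfh) (NComp ?t ?x)"
      by (simp del: inverse_image_comp_comp(5) flip: D.assoc)
    also have "\<dots> = Comp D (c ?gf ?y) (Comp D ?gfh (NComp ?t ?x))"
      by (simp add: D.assoc del: inverse_image_arr(5))
    finally have "Comp D (NComp ?t ?y) ?fgh = Comp D ?gfh (NComp ?t ?x)"
      by - (rule cartesian_cancel[OF lift_cartesian[of ?y ?gf]], simp_all)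
    then show "Comp (Tgt (NSrc ?t)) (NComp ?t (Cod (Src (NSrc ?t)) h)) (AMap (NSrc ?t) h)
        = Comp (Tgt (NSrc ?t)) (AMap (NTgt ?t) h) (NComp ?t (Dom (Src (NSrc ?t)) h))"
      by simp
  qed simp_all
  let ?l = "\<lambda>y. Comp D (c g y) (c f (Dom D (c g y)))"
  have inv: "Comp D (vfactor P (?l y) (c ?gf y)) (NComp ?t y) = Ide D (Dom D (c f (Dom D (c g y))))"
    "Comp D (NComp ?t y) (vfactor P (?l y) (c ?gf y)) = Ide D (Dom D (c ?gf y))"
    "vfactor P (?l y) (c ?gf y) \<in> Arr D" "Dom D (vfactor P (?l y) (c ?gf y)) = Dom D (c ?gf y)"
    "Cod D (vfactor P (?l y) (c ?gf y)) = Dom D (c f (Dom D (c g y)))"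
    "AMap P (vfactor P (?l y) (c ?gf y)) = Ide B (Dom B f)"
    if [simp]: "y \<in> Obj D" "OMap P y = Cod B g" for y
    using vfactor_inverse[of "?l y" "c ?gf y"] vfactor_inverse[of "c ?gf y" "?l y"]
      vfactor[of "?l y" "c ?gf y"] cartesian_comp[of "c g y" "c f (Dom D (c g y))"]
    by simp_all
  then show "invertible2 CAT ?t"
    by (intro nat_iso_invertible2[OF t, where d = "\<lambda>y. vfactor P (?l y) (c ?gf y)"]) simp_all
qed

lemma fibre_psfun_simps [simp]:
  "Ps0 (fibre_psfun P c) = fibre P" "Ps1 (fibre_psfun P c) = inverse_image P c"
  "PsUnit (fibre_psfun P c) = inverse_image_unit P c"
  "PsComp (fibre_psfun P c) = inverse_image_comp P c"
  by (simp_all add: fibre_psfun_def)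

text \<open>Each law holds because both sides become the same composite of chosen lifts and given arrows
  once the chosen lift that ends in the object at hand is composed with them.\<close>

lemma fibre_pseudo_functor: "pseudo_functor (op_cat B) CAT (fibre_psfun P c)"
proof (rule pseudo_functor.intro)
  note [simp] = Hom_def P_rules fibre_category inverse_image_arr lift fcomp_functor fid_functor
    inverse_image_functor inverse_image_comp_comp inverse_image_unit_comp
    inverse_image_unit_nat_iso inverse_image_comp_nat_iso
  have nt: "nat_trans (nid (inverse_image P c f))" if "f \<in> Arr B" for f
    using that by (simp add: nid_nat_trans)
  fix f x y assume f: "f \<in> Hom (op_cat B) x y"
  then have [simp]: "f \<in> Arr B" "Cod B f = x" "Dom B f = y" and xy [simp]: "x \<in> Obj B" "y \<in> Obj B"
    by auto
  let ?F = "inverse_image P c f"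
  show "VComp CAT (PsComp (fibre_psfun P c) f (Ide (op_cat B) x))
      (HComp CAT (Id2 CAT (Ps1 (fibre_psfun P c) f)) (PsUnit (fibre_psfun P c) x))
      = Id2 CAT (Ps1 (fibre_psfun P c) f)" (is "?L = _")
  proof (rule nat_trans_eqI)
    fix z assume "z \<in> Obj (Src (NSrc (Id2 CAT (Ps1 (fibre_psfun P c) f))))"
    then have [simp]: "z \<in> Obj D" "OMap P z = x" by simp_all
    let ?n = "NComp (inverse_image_unit P c x) z" and ?g = "NComp (inverse_image_comp P c f (Ide B x)) z"
    let ?fn = "AMap ?F ?n"
    have fn: "Comp D (c f (Dom D (c (Ide B x) z))) ?fn = Comp D ?n (c f z)"
      using inverse_image_arr(5)[of f ?n] by simp
    have [simp]: "?fn \<in> Arr D" "Dom D ?fn = Dom D (c f z)" "Cod D ?fn = Dom D (c f (Dom D (c (Ide B x) z)))"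
      "AMap P ?fn = Ide B y"
      using inverse_image_arr(1-4)[of f ?n] by simp_all
    have g: "Comp D (c f z) ?g = Comp D (c (Ide B x) z) (c f (Dom D (c (Ide B x) z)))"
      "Cod D ?g = Dom D (c f z)"
      using inverse_image_comp_comp(3,5)[of f "Ide B x" z] by simp_all
    have "Comp D (c f z) (Comp D ?g ?fn) = Comp D (Comp D (c (Ide B x) z) (c f (Dom D (c (Ide B x) z)))) ?fn"
      by (simp flip: D.assoc add: g)
    also have "\<dots> = Comp D (Comp D (c (Ide B x) z) ?n) (c f z)"
      by (simp add: D.assoc fn del: inverse_image_unit_comp(5))
    also have "\<dots> = Comp D (c f z) (Ide D (Dom D (c f z)))"
      by (simp add: D.comp_ide_cod D.comp_ide_dom)
    finally have "Comp D ?g ?fn = Ide D (Dom D (c f z))"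
      by - (rule cartesian_cancel[OF lift_cartesian[of z f]], simp_all add: g)
    then show "NComp ?L z = NComp (Id2 CAT (Ps1 (fibre_psfun P c) f)) z"
      by (simp add: D.comp_ide_cod)
  qed (simp_all add: nt nvcomp_nat_trans nhcomp_nat_trans fcomp_fid_right)
  show "VComp CAT (PsComp (fibre_psfun P c) (Ide (op_cat B) y) f)
      (HComp CAT (PsUnit (fibre_psfun P c) y) (Id2 CAT (Ps1 (fibre_psfun P c) f)))
      = Id2 CAT (Ps1 (fibre_psfun P c) f)" (is "?L = _")
  proof (rule nat_trans_eqI)
    fix z assume "z \<in> Obj (Src (NSrc (Id2 CAT (Ps1 (fibre_psfun P c) f))))"
    then have [simp]: "z \<in> Obj D" "OMap P z = x" by simp_all
    let ?n = "NComp (inverse_image_unit P c y) (Dom D (c f z))" and ?g = "NComp (inverse_image_comp P c (Ide B y) f) z"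
    have g: "Comp D (c f z) ?g = Comp D (c f z) (c (Ide B y) (Dom D (c f z)))"
      "Cod D ?g = Dom D (c f z)"
      using inverse_image_comp_comp(3,5)[of "Ide B y" f z] by simp_all
    have "Comp D (c f z) (Comp D ?g ?n) = Comp D (Comp D (c f z) (c (Ide B y) (Dom D (c f z)))) ?n"
      by (simp flip: D.assoc add: g)
    also have "\<dots> = Comp D (c f z) (Ide D (Dom D (c f z)))"
      by (simp add: D.assoc)
    finally have "Comp D ?g ?n = Ide D (Dom D (c f z))"
      by - (rule cartesian_cancel[OF lift_cartesian[of z f]], simp_all add: g)
    then show "NComp ?L z = NComp (Id2 CAT (Ps1 (fibre_psfun P c) f)) z"
      by (simp add: D.comp_ide_dom)
  qed (simp_all add: nt nvcomp_nat_trans nhcomp_nat_trans fcomp_fid_left)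
next
  note [simp] = Hom_def P_rules fibre_category inverse_image_arr lift fcomp_functor fid_functor
    inverse_image_functor inverse_image_comp_comp inverse_image_comp_nat_iso
  have nt: "nat_trans (nid (inverse_image P c f))" if "f \<in> Arr B" for f
    using that by (simp add: nid_nat_trans)
  fix h w x g y f z
  assume "h \<in> Hom (op_cat B) w x" "g \<in> Hom (op_cat B) x y" "f \<in> Hom (op_cat B) y z"
  then have [simp]: "f \<in> Arr B" "g \<in> Arr B" "h \<in> Arr B" "Cod B f = Dom B g" "Cod B g = Dom B h"
    "w = Cod B h" "x = Dom B h" "y = Dom B g" "z = Dom B f" by auto
  have assoc [simp]: "Comp B h (Comp B g f) = Comp B (Comp B h g) f" by (simp add: B.assoc)
  let ?F = "inverse_image P c f"
  let ?\<gamma> = "\<lambda>f g. NComp (inverse_image_comp P c f g)"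
  show "VComp CAT (PsComp (fibre_psfun P c) f (Comp (op_cat B) g h))
        (HComp CAT (Id2 CAT (Ps1 (fibre_psfun P c) f)) (PsComp (fibre_psfun P c) g h))
      = VComp CAT (PsComp (fibre_psfun P c) (Comp (op_cat B) f g) h)
        (HComp CAT (PsComp (fibre_psfun P c) f g) (Id2 CAT (Ps1 (fibre_psfun P c) h)))" (is "?L = ?R")
  proof (rule nat_trans_eqI)
    fix e assume "e \<in> Obj (Src (NSrc ?R))"
    then have [simp]: "e \<in> Obj D" "OMap P e = Cod B h" by simp_all
    let ?hg = "Comp B h g" and ?gf = "Comp B g f"
    let ?hge = "Dom D (c g (Dom D (c h e)))"
    let ?lh = "c h e" let ?lg = "c g (Dom D ?lh)" let ?lf = "c f (Dom D ?lg)"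
    let ?fg = "AMap ?F (?\<gamma> g h e)"
    have f\<gamma>: "Comp D (c f (Dom D (c ?hg e))) ?fg = Comp D (?\<gamma> g h e) ?lf"
      using inverse_image_arr(5)[of f "?\<gamma> g h e"] by simp
    have [simp]: "?fg \<in> Arr D" "Dom D ?fg = Dom D ?lf" "Cod D ?fg = Dom D (c f (Dom D (c ?hg e)))"
      "AMap P ?fg = Ide B (Dom B f)"
      using inverse_image_arr(1-4)[of f "?\<gamma> g h e"] by simp_all
    have 1: "Comp D (c (Comp B ?hg f) e) (?\<gamma> ?gf h e) = Comp D ?lh (c ?gf (Dom D ?lh))"
      "Cod D (?\<gamma> ?gf h e) = Dom D (c (Comp B ?hg f) e)"
      using inverse_image_comp_comp(3,5)[of ?gf h e] by simp_all
    have "Comp D (c (Comp B ?hg f) e) (Comp D (?\<gamma> f ?hg e) ?fg)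
        = Comp D (Comp D (c ?hg e) (c f (Dom D (c ?hg e)))) ?fg"
      by (simp flip: D.assoc)
    also have "\<dots> = Comp D (Comp D (c ?hg e) (?\<gamma> g h e)) ?lf"
      by (simp add: D.assoc f\<gamma> del: inverse_image_comp_comp(5))
    also have "\<dots> = Comp D ?lh (Comp D ?lg ?lf)"
      by (simp add: D.assoc)
    also have "\<dots> = Comp D ?lh (Comp D (c ?gf (Dom D ?lh)) (?\<gamma> f g (Dom D ?lh)))"
      by simp
    also have "\<dots> = Comp D (Comp D (c (Comp B ?hg f) e) (?\<gamma> ?gf h e)) (?\<gamma> f g (Dom D ?lh))"
      unfolding 1 by (simp add: D.assoc)
    also have "\<dots> = Comp D (c (Comp B ?hg f) e) (Comp D (?\<gamma> ?gf h e) (?\<gamma> f g (Dom D ?lh)))"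
      by (rule D.assoc) (simp_all add: 1)
    finally have "Comp D (?\<gamma> f ?hg e) ?fg = Comp D (?\<gamma> ?gf h e) (?\<gamma> f g (Dom D ?lh))"
      by - (rule cartesian_cancel[OF lift_cartesian[of e "Comp B ?hg f"]], simp_all add: 1)
    then show "NComp ?L e = NComp ?R e"
      by (simp add: inverse_image_ide D.comp_ide_cod D.comp_ide_dom)
  qed (simp_all add: nt nvcomp_nat_trans nhcomp_nat_trans fcomp_assoc)
next
  fix f x y g z assume "f \<in> Hom (op_cat B) x y" "g \<in> Hom (op_cat B) y z"
  then show "invertible2 CAT (PsComp (fibre_psfun P c) g f) \<and>
      Dom2 CAT (PsComp (fibre_psfun P c) g f)
        = Comp1 CAT (Ps1 (fibre_psfun P c) g) (Ps1 (fibre_psfun P c) f) \<and>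
      Cod2 CAT (PsComp (fibre_psfun P c) g f) = Ps1 (fibre_psfun P c) (Comp (op_cat B) g f)"
    by (simp add: Hom_def inverse_image_comp_nat_iso)
qed (simp_all add: category_op_cat B.category_axioms CAT_two_category fibre_category
    inverse_image_functor inverse_image_unit_nat_iso)

end


section \<open>A cloven fibration is the Grothendieck construction of its fibres\<close>

lemma cat_isoI:
  assumes F: "cat_functor F" and o: "bij_betw (OMap F) (Obj (Src F)) (Obj (Tgt F))"
    and a: "bij_betw (AMap F) (Arr (Src F)) (Arr (Tgt F))"
  shows "cat_iso F"
proof -
  interpret cat_functor F by fact
  let ?C = "Src F" and ?D = "Tgt F"
  define oi where "oi = inv_into (Obj ?C) (OMap F)"
  define ai where "ai = inv_into (Arr ?C) (AMap F)"
  have oi: "y \<in> Obj ?D \<Longrightarrow> oi y \<in> Obj ?C" "y \<in> Obj ?D \<Longrightarrow> OMap F (oi y) = y"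
    "x \<in> Obj ?C \<Longrightarrow> oi (OMap F x) = x" for x y
    using o by (auto simp: oi_def bij_betw_def inv_into_into f_inv_into_f)
  have ai: "g \<in> Arr ?D \<Longrightarrow> ai g \<in> Arr ?C" "g \<in> Arr ?D \<Longrightarrow> AMap F (ai g) = g"
    "f \<in> Arr ?C \<Longrightarrow> ai (AMap F f) = f" for f g
    using a by (auto simp: ai_def bij_betw_def inv_into_into f_inv_into_f)
  have bd: "Dom ?C (ai g) = oi (Dom ?D g)" "Cod ?C (ai g) = oi (Cod ?D g)" if "g \<in> Arr ?D" for g
    using that ai oi amap_dom[of "ai g"] amap_cod[of "ai g"] src_category
    by (metis cat_boundary(1,2))+
  define F' where "F' = \<lparr>Src = ?D, Tgt = ?C, OMap = restrict oi (Obj ?D), AMap = restrict ai (Arr ?D)\<rparr>"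
  have F' [simp]: "Src F' = ?D" "Tgt F' = ?C" "y \<in> Obj ?D \<Longrightarrow> OMap F' y = oi y"
    "g \<in> Arr ?D \<Longrightarrow> AMap F' g = ai g" for y g
    by (simp_all add: F'_def)
  note [simp] = src_category tgt_category oi ai bd omap_obj amap_arr cat_boundary
  have functor': "cat_functor F'"
  proof (rule cat_functorI)
    show "OMap F' \<in> extensional (Obj (Src F'))" "AMap F' \<in> extensional (Arr (Src F'))"
      by (simp_all add: F'_def)
    show "AMap F' (Ide (Src F') y) = Ide (Tgt F') (OMap F' y)" if "y \<in> Obj (Src F')" for y
      using that ai(3)[of "Ide ?C (oi y)"] by (simp add: amap_ide del: ai(3))
    fix f g assume fg: "f \<in> Arr (Src F')" "g \<in> Arr (Src F')" "Cod (Src F') f = Dom (Src F') g"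
    then have "AMap F (Comp ?C (ai g) (ai f)) = Comp ?D g f"
      by (simp add: amap_comp_arr)
    then show "AMap F' (Comp (Src F') g f) = Comp (Tgt F') (AMap F' g) (AMap F' f)"
      using fg ai(3)[of "Comp ?C (ai g) (ai f)"] by (simp del: ai(3))
  qed simp_all
  moreover have "fcomp F' F = fid (Src F)"
    by (rule functor_eqI) (simp_all add: fcomp_functor fid_functor F functor')
  moreover have "fcomp F F' = fid (Tgt F)"
    by (rule functor_eqI) (simp_all add: fcomp_functor fid_functor F functor')
  ultimately show ?thesis
    using F unfolding cat_iso_def by (intro conjI exI[of _ F']) simp_all
qed

text \<open>An arrow of the Grothendieck construction of the fibres is a vertical arrow into the domain of a
  chosen lift. The comparison composes the two.\<close>

definition fibre_comparison :: "('d, 'v, 'b, 'w) funct \<Rightarrow> ('w \<Rightarrow> 'd \<Rightarrow> 'v)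
    \<Rightarrow> ('b \<times> 'd, 'w \<times> 'v \<times> 'd, 'd, 'v) funct" where
  "fibre_comparison P c = \<lparr>Src = groth (Tgt P) (fibre_psfun P c), Tgt = Src P,
     OMap = restrict snd (Obj (groth (Tgt P) (fibre_psfun P c))),
     AMap = (\<lambda>(f, h, y)\<in>Arr (groth (Tgt P) (fibre_psfun P c)). Comp (Src P) (c f y) h)\<rparr>"

context cloven_fibration
begin

sublocale fibres: indexed_category B "fibre_psfun P c"
  by (rule indexed_category.intro) (fact fibre_pseudo_functor)

abbreviation G where "G \<equiv> groth B (fibre_psfun P c)"

lemma fibre_comparison_simps [simp]:
  "Src (fibre_comparison P c) = G" "Tgt (fibre_comparison P c) = D"
  "(A, y) \<in> Obj G \<Longrightarrow> OMap (fibre_comparison P c) (A, y) = y"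
  "(f, h, y) \<in> Arr G \<Longrightarrow> AMap (fibre_comparison P c) (f, h, y) = Comp D (c f y) h"
  by (simp_all add: fibre_comparison_def)

lemma groth_fibres_arr:
  "(f, h, y) \<in> Arr G \<longleftrightarrow> f \<in> Arr B \<and> y \<in> Obj D \<and> OMap P y = Cod B f \<and> h \<in> Arr D \<and>
    AMap P h = Ide B (Dom B f) \<and> Cod D h = Dom D (c f y)"
  by (auto simp: groth_simps)

lemma fibre_comparison_functor: "cat_functor (fibre_comparison P c)"
proof (rule cat_functorI)
  let ?K = "fibre_comparison P c"
  show "OMap ?K \<in> extensional (Obj (Src ?K))" "AMap ?K \<in> extensional (Arr (Src ?K))"
    by (simp_all add: fibre_comparison_def)
  show "category (Src ?K)" "category (Tgt ?K)"
    by (simp_all add: fibres.groth_category D.category_axioms)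
  note [simp] = P_rules lift
  show "OMap ?K x \<in> Obj (Tgt ?K)" if "x \<in> Obj (Src ?K)" for x
    using that by (cases x) (simp add: groth_simps)
  show "AMap ?K (Ide (Src ?K) x) = Ide (Tgt ?K) (OMap ?K x)" if x: "x \<in> Obj (Src ?K)" for x
  proof (cases x)
    case (Pair A y)
    then have "A \<in> Obj B" "y \<in> Obj D" "OMap P y = A" using x by (simp_all add: groth_simps)
    moreover have "Ide G (A, y) \<in> Arr G"
      using x Pair category.ide_arr[OF fibres.groth_category] by simp
    ultimately show ?thesis
      using Pair inverse_image_unit_comp(5)[of A y] x by (simp add: groth_simps(1,5))
  qed
  show "AMap ?K a \<in> Arr (Tgt ?K) \<and> Dom (Tgt ?K) (AMap ?K a) = OMap ?K (Dom (Src ?K) a) \<and>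
      Cod (Tgt ?K) (AMap ?K a) = OMap ?K (Cod (Src ?K) a)" if a: "a \<in> Arr (Src ?K)" for a
  proof (cases a)
    case (fields f h y)
    then have "Dom G (f, h, y) \<in> Obj G" "Cod G (f, h, y) \<in> Obj G"
      using a fibres.groth_category category.dom_obj category.cod_obj by fastforce+
    then show ?thesis using a by (simp add: fields groth_fibres_arr groth_simps(3,4))
  qed
  fix a b assume ab: "a \<in> Arr (Src ?K)" "b \<in> Arr (Src ?K)" "Cod (Src ?K) a = Dom (Src ?K) b"
  obtain f h y where a: "a = (f, h, y)" by (cases a)
  obtain g k z where b: "b = (g, k, z)" by (cases b)
  have ba: "Comp G b a \<in> Arr G" using ab fibres.groth_category by (simp add: category.comp_arr)
  have [simp]: "f \<in> Arr B" "h \<in> Arr D" "AMap P h = Ide B (Dom B f)" "Cod D h = Dom D (c f (Dom D k))"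
    "g \<in> Arr B" "z \<in> Obj D" "OMap P z = Cod B g" "k \<in> Arr D" "AMap P k = Ide B (Dom B g)"
    "Cod D k = Dom D (c g z)" "Cod B f = Dom B g" "y = Dom D k" "OMap P (Dom D k) = Dom B g"
    using ab by (auto simp: a b groth_fibres_arr groth_simps(3,4))
  let ?\<gamma> = "NComp (inverse_image_comp P c f g) z" and ?fk = "AMap (inverse_image P c f) k"
  note [simp] = inverse_image_comp_comp
  have fk [simp]: "?fk \<in> Arr D" "Dom D ?fk = Dom D (c f (Dom D k))"
    "Cod D ?fk = Dom D (c f (Dom D (c g z)))" "AMap P ?fk = Ide B (Dom B f)"
    and fk_comp: "Comp D (c f (Dom D (c g z))) ?fk = Comp D k (c f (Dom D k))"
    using inverse_image_arr[of f k] by simp_all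
  have "Comp D (c (Comp B g f) z) (Comp D ?\<gamma> (Comp D ?fk h))
      = Comp D (Comp D (c g z) (c f (Dom D (c g z)))) (Comp D ?fk h)"
    by (simp flip: D.assoc)
  also have "\<dots> = Comp D (c g z) (Comp D (Comp D (c f (Dom D (c g z))) ?fk) h)"
    by (simp add: D.assoc)
  also have "\<dots> = Comp D (Comp D (c g z) k) (Comp D (c f (Dom D k)) h)"
    unfolding fk_comp by (simp add: D.assoc)
  finally have "Comp D (c (Comp B g f) z) (Comp D ?\<gamma> (Comp D ?fk h))
      = Comp D (Comp D (c g z) k) (Comp D (c f (Dom D k)) h)" .
  then show "AMap ?K (Comp (Src ?K) b a) = Comp (Tgt ?K) (AMap ?K b) (AMap ?K a)"
    using ab ba by (simp add: a b groth_simps(6))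
qed

text \<open>Objects \<open>(A, y)\<close> are determined by \<open>y\<close>, and an arrow over \<open>f\<close> factors uniquely as a
  vertical arrow followed by the chosen lift of \<open>f\<close>.\<close>

lemma fibre_comparison_iso: "cat_iso (fibre_comparison P c)"
proof (rule cat_isoI)
  let ?K = "fibre_comparison P c"
  note [simp] = P_rules lift
  show "bij_betw (OMap ?K) (Obj (Src ?K)) (Obj (Tgt ?K))"
    by (rule bij_betw_byWitness[where f' = "\<lambda>y. (OMap P y, y)"]) (auto simp: groth_simps)
  let ?inv = "\<lambda>u. (AMap P u, vfactor P (c (AMap P u) (Cod D u)) u, Cod D u)"
  have inv: "?inv u \<in> Arr G" "AMap ?K (?inv u) = u" if u: "u \<in> Arr D" for u
  proof -
    note [simp] = vfactor[of "c (AMap P u) (Cod D u)" u]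
    show "?inv u \<in> Arr G" using u by (simp add: groth_fibres_arr)
    then show "AMap ?K (?inv u) = u" using u by simp
  qed
  have inv': "?inv (AMap ?K a) = a" "AMap ?K a \<in> Arr D" if a: "a \<in> Arr G" for a
  proof -
    obtain f h y where ae: "a = (f, h, y)" by (cases a)
    have [simp]: "f \<in> Arr B" "y \<in> Obj D" "OMap P y = Cod B f" "h \<in> Arr D"
      "AMap P h = Ide B (Dom B f)" "Cod D h = Dom D (c f y)"
      using a by (simp_all add: ae groth_fibres_arr)
    have "vfactor P (c f y) (Comp D (c f y) h) = h"
      by (rule vfactor_eqI) simp_all
    then show "?inv (AMap ?K a) = a" "AMap ?K a \<in> Arr D" using a by (simp_all add: ae)
  qed
  show "bij_betw (AMap ?K) (Arr (Src ?K)) (Arr (Tgt ?K))"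
    by (rule bij_betw_byWitness[where f' = ?inv]) (use inv inv' in \<open>auto simp del: fibre_comparison_simps(4)\<close>)
qed (fact fibre_comparison_functor)

lemma fibre_comparison_proj: "fcomp P (fibre_comparison P c) = groth_proj B (fibre_psfun P c)"
proof (rule functor_eqI)
  let ?K = "fibre_comparison P c"
  note [simp] = P_rules lift
  show "OMap (fcomp P ?K) x = OMap (groth_proj B (fibre_psfun P c)) x"
    if "x \<in> Obj (Src (groth_proj B (fibre_psfun P c)))" for x
    using that by (cases x) (simp add: groth_simps)
  show "AMap (fcomp P ?K) a = AMap (groth_proj B (fibre_psfun P c)) a"
    if "a \<in> Arr (Src (groth_proj B (fibre_psfun P c)))" for a
    using that by (cases a) (simp, simp add: groth_fibres_arr)
qed (simp_all add: fcomp_functor is_functor fibre_comparison_functor fibres.groth_proj_functor)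

end


section \<open>The pseudo-functor of a composable pair of cloven fibrations\<close>

context cloven_fibration
begin

text \<open>The factor of \<open>v\<close> through \<open>i\<close> can only be \<open>j \<circ> v\<close>, and this lies over the prescribed arrow.\<close>

lemma iso_cartesian:
  assumes "i \<in> Arr D" "j \<in> Arr D" "Dom D j = Cod D i" "Cod D j = Dom D i"
    and ij: "Comp D i j = Ide D (Dom D j)" and ji: "Comp D j i = Ide D (Dom D i)"
  shows "cartesian P i"
proof (rule cartesianI)
  note [simp] = P_rules assms(1-4)
  have Pji: "Comp B (AMap P j) (AMap P i) = Ide B (OMap P (Dom D i))"
    using arg_cong[OF ji, of "AMap P"] by simp
  show "i \<in> Arr D" by fact
  fix v w assume [simp]: "v \<in> Arr D" "Cod D v = Cod D i" "w \<in> Arr B" "Dom B w = OMap P (Dom D v)"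
    "Cod B w = OMap P (Dom D i)" and iw: "Comp B (AMap P i) w = AMap P v"
  show "\<exists>!x. x \<in> Arr D \<and> Dom D x = Dom D v \<and> Cod D x = Dom D i \<and> AMap P x = w \<and> Comp D i x = v"
  proof (rule ex1I[of _ "Comp D j v"])
    have "AMap P (Comp D j v) = Comp B (Comp B (AMap P j) (AMap P i)) w"
      by (simp add: B.assoc iw)
    then have "AMap P (Comp D j v) = w" by (simp only: Pji) simp
    moreover have "Comp D i (Comp D j v) = v"
      by (simp flip: D.assoc add: ij D.comp_ide_cod)
    ultimately show "Comp D j v \<in> Arr D \<and> Dom D (Comp D j v) = Dom D v \<and> Cod D (Comp D j v) = Dom D i \<and>
        AMap P (Comp D j v) = w \<and> Comp D i (Comp D j v) = v"
      by simp
    fix x assume x: "x \<in> Arr D \<and> Dom D x = Dom D v \<and> Cod D x = Dom D i \<and> AMap P x = w \<and> Comp D i x = v"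
    then have "Comp D j v = Comp D (Comp D j i) x" by (auto simp: D.assoc)
    then show "x = Comp D j v" using x by (simp add: ji D.comp_ide_cod)
  qed
qed

lemma cartesian_comp_cancel:
  assumes u: "cartesian P u" and x: "x \<in> Arr D" "Cod D x = Dom D u"
    and ux: "cartesian P (Comp D u x)"
  shows "cartesian P x"
proof (rule cartesianI)
  note u' = cartesian_arr[OF u]
  note [simp] = P_rules u' x
  show "x \<in> Arr D" by fact
  fix v w assume v [simp]: "v \<in> Arr D" "Cod D v = Cod D x" and w [simp]: "w \<in> Arr B"
    "Dom B w = OMap P (Dom D v)" "Cod B w = OMap P (Dom D x)" and xw: "Comp B (AMap P x) w = AMap P v"
  have "\<exists>!y. y \<in> Arr D \<and> Dom D y = Dom D (Comp D u v) \<and> Cod D y = Dom D (Comp D u x) \<and> AMap P y = w \<and>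
      Comp D (Comp D u x) y = Comp D u v"
    by (rule cartesian_factor[OF ux]) (simp_all add: B.assoc xw)
  then obtain y where y: "y \<in> Arr D" "Dom D y = Dom D v" "Cod D y = Dom D x" "AMap P y = w"
    "Comp D (Comp D u x) y = Comp D u v" by auto
  have xy: "Comp D x y = v"
    using y xw by - (rule cartesian_cancel[OF u], simp_all add: D.assoc)
  show "\<exists>!y. y \<in> Arr D \<and> Dom D y = Dom D v \<and> Cod D y = Dom D x \<and> AMap P y = w \<and> Comp D x y = v"
  proof (rule ex1I[of _ y])
    show "y \<in> Arr D \<and> Dom D y = Dom D v \<and> Cod D y = Dom D x \<and> AMap P y = w \<and> Comp D x y = v"
      using y xy by simp
    fix y' assume y': "y' \<in> Arr D \<and> Dom D y' = Dom D v \<and> Cod D y' = Dom D x \<and> AMap P y' = w \<and> Comp D x y' = v"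
    then show "y' = y"
      using y xy by - (rule cartesian_cancel[OF ux], simp_all add: D.assoc)
  qed
qed

end

locale cloven_pair = P: cloven_fibration P cP + Q: cloven_fibration Q cQ
  for Q :: "('e, 'u, 'd, 'v) funct" and P :: "('d, 'v, 'b, 'w) funct" and cP cQ +
  assumes composable: "Tgt Q = Src P"
begin

abbreviation R where "R \<equiv> fcomp P Q"
abbreviation cR where "cR \<equiv> comp_cleavage Q cP cQ"
abbreviation E where "E \<equiv> Src Q"

lemma R_functor: "cat_functor R"
  by (simp add: fcomp_functor P.is_functor Q.is_functor composable)

lemmas QP_rules = P.P_rules Q.P_rules[unfolded composable]

text \<open>A factorisation is found in two stages: first in the base of \<open>Q\<close>, through \<open>Q u\<close>, and then
  in the total category, over the factor just found.\<close>

lemma composite_cartesian: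
  assumes u: "cartesian Q u" and Qu: "cartesian P (AMap Q u)"
  shows "cartesian R u"
proof (rule cartesianI)
  note u' = cartesian_arr[OF u]
  note [simp] = QP_rules u' composable
  show "u \<in> Arr (Src R)" by simp
  fix v w assume v: "v \<in> Arr (Src R)" "Cod (Src R) v = Cod (Src R) u" and w: "w \<in> Arr (Tgt R)"
    "Dom (Tgt R) w = OMap R (Dom (Src R) v)" "Cod (Tgt R) w = OMap R (Dom (Src R) u)"
    and vw: "Comp (Tgt R) (AMap R u) w = AMap R v"
  have [simp]: "v \<in> Arr E" "Cod E v = Cod E u" "w \<in> Arr P.B" "Dom P.B w = OMap P (OMap Q (Dom E v))"
    "Cod P.B w = OMap P (OMap Q (Dom E u))"
    using v w by simp_all
  have "\<exists>!x. x \<in> Arr P.D \<and> Dom P.D x = Dom P.D (AMap Q v) \<and> Cod P.D x = Dom P.D (AMap Q u) \<and>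
      AMap P x = w \<and> Comp P.D (AMap Q u) x = AMap Q v"
    using vw by (intro cartesian_factor[OF Qu]) simp_all
  then obtain x where x: "x \<in> Arr P.D" "Dom P.D x = OMap Q (Dom E v)" "Cod P.D x = OMap Q (Dom E u)"
    "AMap P x = w" "Comp P.D (AMap Q u) x = AMap Q v" by auto
  have "\<exists>!y. y \<in> Arr E \<and> Dom E y = Dom E v \<and> Cod E y = Dom E u \<and> AMap Q y = x \<and> Comp E u y = v"
    using x by (intro cartesian_factor[OF u]) simp_all
  then obtain y where y: "y \<in> Arr E" "Dom E y = Dom E v" "Cod E y = Dom E u" "AMap Q y = x"
    "Comp E u y = v" by blast
  show "\<exists>!y. y \<in> Arr (Src R) \<and> Dom (Src R) y = Dom (Src R) v \<and> Cod (Src R) y = Dom (Src R) u \<and>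
      AMap R y = w \<and> Comp (Src R) u y = v"
  proof (rule ex1I[of _ y])
    show "y \<in> Arr (Src R) \<and> Dom (Src R) y = Dom (Src R) v \<and> Cod (Src R) y = Dom (Src R) u \<and>
        AMap R y = w \<and> Comp (Src R) u y = v"
      using x y by simp
    fix y' assume "y' \<in> Arr (Src R) \<and> Dom (Src R) y' = Dom (Src R) v \<and> Cod (Src R) y' = Dom (Src R) u \<and>
      AMap R y' = w \<and> Comp (Src R) u y' = v"
    then have y': "y' \<in> Arr E" "Dom E y' = Dom E v" "Cod E y' = Dom E u" "AMap P (AMap Q y') = w"
      "Comp E u y' = v" by auto
    have "Comp P.D (AMap Q u) (AMap Q y') = AMap Q v"
      using y' Q.P.amap_comp_arr[of y' u] by simp
    then have "AMap Q y' = x"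
      using x y' by - (rule P.cartesian_cancel[OF Qu], simp_all)
    then show "y' = y"
      using y y' by - (rule Q.cartesian_cancel[OF u], simp_all)
  qed
qed

lemma comp_lift:
  assumes "y \<in> Obj E" "f \<in> Arr P.B" "OMap P (OMap Q y) = Cod P.B f"
  shows comp_lift_cartesian: "cartesian Q (cR f y)"
    and comp_lift_image: "AMap Q (cR f y) = cP f (OMap Q y)"
    and comp_lift_arr: "cR f y \<in> Arr E"
    and comp_lift_cod: "Cod E (cR f y) = y"
    and comp_lift_dom_obj: "Dom E (cR f y) \<in> Obj E"
    and comp_lift_image_dom: "OMap Q (Dom E (cR f y)) = Dom P.D (cP f (OMap Q y))"
proof -
  have Qy: "OMap Q y \<in> Obj P.D" using assms Q.P.omap_obj[of y] by (simp add: composable)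
  note l = P.lift[OF Qy assms(2) assms(3)[symmetric]]
  show "cartesian Q (cR f y)" "AMap Q (cR f y) = cP f (OMap Q y)" "cR f y \<in> Arr E"
    "Cod E (cR f y) = y" "Dom E (cR f y) \<in> Obj E"
    "OMap Q (Dom E (cR f y)) = Dom P.D (cP f (OMap Q y))"
    using Q.lift[of y "cP f (OMap Q y)"] assms l by (simp_all add: comp_cleavage_def composable)
qed

lemma comp_cleavage_is_cleavage: "cleavage R cR"
  unfolding cleavage_def
proof (intro ballI impI)
  fix y f assume "y \<in> Obj (Src R)" "f \<in> Arr (Tgt R)" "Cod (Tgt R) f = OMap R y"
  then have y: "y \<in> Obj E" "f \<in> Arr P.B" "OMap P (OMap Q y) = Cod P.B f" by simp_all
  moreover have "OMap Q y \<in> Obj P.D" using y Q.P.omap_obj[of y] by (simp add: composable)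
  ultimately show "cartesian R (cR f y) \<and> Cod (Src R) (cR f y) = y \<and> AMap R (cR f y) = f"
    using comp_lift[OF y] composite_cartesian[of "cR f y"] P.lift[of "OMap Q y" f] by simp
qed

sublocale R: cloven_fibration R cR
  by (rule cloven_fibration.intro) (fact R_functor comp_cleavage_is_cleavage)+

text \<open>\<open>Q\<close> carries factorisations in the composite to factorisations in \<open>P\<close>; this one fact makes the
  inverse image squares commute and makes their structure cells compatible.\<close>

lemma image_vfactor:
  assumes u: "cartesian R u" and Qu: "cartesian P (AMap Q u)"
    and v: "v \<in> Arr E" "Cod E v = Cod E u" "AMap R v = AMap R u"
  shows "AMap Q (vfactor R u v) = vfactor P (AMap Q u) (AMap Q v)"
proof -
  note u' = cartesian_arr[OF u]
  note [simp] = QP_rules composable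
  have [simp]: "u \<in> Arr E" using u' by simp
  note f = R.vfactor[OF u, unfolded fcomp_simps(1,2), OF v]
  show ?thesis
    using f v Q.P.amap_comp_arr[of "vfactor R u v" u]
    by (intro P.vfactor_eqI[OF Qu, symmetric]) simp_all
qed


abbreviation F where "F A \<equiv> fibre_functor Q P A"

lemma fibre_functor_simps [simp]:
  "Src (F A) = fibre R A" "Tgt (F A) = fibre P A"
  "y \<in> Obj E \<Longrightarrow> OMap P (OMap Q y) = A \<Longrightarrow> OMap (F A) y = OMap Q y"
  "h \<in> Arr E \<Longrightarrow> AMap P (AMap Q h) = Ide P.B A \<Longrightarrow> AMap (F A) h = AMap Q h"
  by (simp_all add: fibre_functor_def)

lemma fibre_functor_functor:
  assumes A: "A \<in> Obj P.B"
  shows "cat_functor (F A)"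
proof (rule cat_functorI)
  note [simp] = QP_rules composable A
  show "OMap (F A) \<in> extensional (Obj (Src (F A)))" "AMap (F A) \<in> extensional (Arr (Src (F A)))"
    by (simp_all add: fibre_functor_def)
  show "category (Src (F A))" "category (Tgt (F A))"
    using R.fibre_category[of A] P.fibre_category[of A] by simp_all
  fix f g assume fg: "f \<in> Arr (Src (F A))" "g \<in> Arr (Src (F A))" "Cod (Src (F A)) f = Dom (Src (F A)) g"
  then have [simp]: "f \<in> Arr E" "AMap P (AMap Q f) = Ide P.B A" "g \<in> Arr E"
    "AMap P (AMap Q g) = Ide P.B A" "Cod E f = Dom E g"
    by auto
  have "AMap Q (Comp E g f) = Comp P.D (AMap Q g) (AMap Q f)"
    using Q.P.amap_comp_arr[of f g] by simp
  then show "AMap (F A) (Comp (Src (F A)) g f) = Comp (Tgt (F A)) (AMap (F A) g) (AMap (F A) f)"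
    by simp
next
  note [simp] = QP_rules composable A
  show "AMap (F A) h \<in> Arr (Tgt (F A)) \<and>
      Dom (Tgt (F A)) (AMap (F A) h) = OMap (F A) (Dom (Src (F A)) h) \<and>
      Cod (Tgt (F A)) (AMap (F A) h) = OMap (F A) (Cod (Src (F A)) h)" if "h \<in> Arr (Src (F A))" for h
  proof -
    have [simp]: "h \<in> Arr E" "AMap P (AMap Q h) = Ide P.B A" using that by auto
    show ?thesis using R.vertical_image[of h A] by simp
  qed
qed (auto simp: QP_rules composable A)

text \<open>The factor of a vertical arrow over a vertical arrow is vertical, so the factorisations of
  \<open>Q\<close> already take place in the fibre.\<close>

lemma cartesian_fibre_functor:
  assumes A: "A \<in> Obj P.B" and u: "cartesian Q u" and Ru: "AMap P (AMap Q u) = Ide P.B A"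
  shows "cartesian (F A) u"
proof (rule cartesianI)
  note u' = cartesian_arr[OF u]
  note [simp] = QP_rules composable A u' Ru
  have vi [simp]: "OMap P (OMap Q (Dom E h)) = A" "OMap P (OMap Q (Cod E h)) = A"
    if "h \<in> Arr E" "AMap P (AMap Q h) = Ide P.B A" for h
    using R.vertical_image[of h A] that by simp_all
  show "u \<in> Arr (Src (F A))" by simp
  fix v w assume v: "v \<in> Arr (Src (F A))" "Cod (Src (F A)) v = Cod (Src (F A)) u"
    and w: "w \<in> Arr (Tgt (F A))" "Dom (Tgt (F A)) w = OMap (F A) (Dom (Src (F A)) v)"
      "Cod (Tgt (F A)) w = OMap (F A) (Dom (Src (F A)) u)"
    and vw: "Comp (Tgt (F A)) (AMap (F A) u) w = AMap (F A) v"
  have [simp]: "v \<in> Arr E" "AMap P (AMap Q v) = Ide P.B A" "Cod E v = Cod E u" "w \<in> Arr P.D"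
    and Pw: "AMap P w = Ide P.B A"
    using v w by (auto simp del: fcomp_simps(4) simp: fcomp_simps(4)[of v Q P])
  have "\<exists>!x. x \<in> Arr E \<and> Dom E x = Dom E v \<and> Cod E x = Dom E u \<and> AMap Q x = w \<and> Comp E u x = v"
    using v w vw by (intro cartesian_factor[OF u]) simp_all
  then show "\<exists>!x. x \<in> Arr (Src (F A)) \<and> Dom (Src (F A)) x = Dom (Src (F A)) v \<and>
      Cod (Src (F A)) x = Dom (Src (F A)) u \<and> AMap (F A) x = w \<and> Comp (Src (F A)) u x = v"
    using Pw by - (erule back_subst[of Ex1], auto simp: fun_eq_iff)
qed

text \<open>The cleavage of \<open>Q\<close> restricts to the fibres, since an arrow lying over a vertical arrow is itself
  vertical for the composite.\<close>

lemma fibre_functor_cloven: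
  assumes A: "A \<in> Obj P.B"
  shows "cloven_fibration (F A) cQ"
proof (rule cloven_fibration.intro)
  show "cleavage (F A) cQ"
    unfolding cleavage_def
  proof (intro ballI impI)
    fix y f assume "y \<in> Obj (Src (F A))" "f \<in> Arr (Tgt (F A))" "Cod (Tgt (F A)) f = OMap (F A) y"
    then have [simp]: "y \<in> Obj E" "OMap P (OMap Q y) = A" "f \<in> Arr P.D" "AMap P f = Ide P.B A"
      "Cod P.D f = OMap Q y" by auto
    note l = Q.lift[of y f, simplified composable, simplified]
    show "cartesian (F A) (cQ f y) \<and> Cod (Src (F A)) (cQ f y) = y \<and> AMap (F A) (cQ f y) = f"
      using l by (simp add: cartesian_fibre_functor A)
  qed
qed (rule fibre_functor_functor[OF A])

text \<open>Conversely, a Cartesian arrow of a fibre differs by a vertical isomorphism from the chosen lift,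
  which is Cartesian in the total category.\<close>

lemma fibre_cartesian_cartesian:
  assumes A: "A \<in> Obj P.B" and u: "cartesian (F A) u"
  shows "cartesian Q u"
proof -
  interpret FA: cloven_fibration "F A" cQ by (rule fibre_functor_cloven) fact
  note [simp] = QP_rules composable A
  have u' [simp]: "u \<in> Arr E" "AMap P (AMap Q u) = Ide P.B A" using cartesian_arr[OF u] by auto
  have [simp]: "OMap P (OMap Q (Dom E u)) = A" "OMap P (OMap Q (Cod E u)) = A"
    using R.vertical_image[of u A] by simp_all
  let ?c = "cQ (AMap Q u) (Cod E u)"
  note c = Q.lift[of "Cod E u" "AMap Q u", simplified]
  have Fc: "cartesian (F A) ?c" using c by (intro cartesian_fibre_functor) simp_all
  let ?i = "vfactor (F A) ?c u" and ?j = "vfactor (F A) u ?c"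
  note i = FA.vfactor[OF Fc, of u, simplified] and j = FA.vfactor[OF u, of ?c, simplified]
  have "cartesian Q ?i"
    using i j c FA.vfactor_inverse[OF u Fc] FA.vfactor_inverse[OF Fc u]
    by (intro Q.iso_cartesian[of ?i ?j]) simp_all
  then have "cartesian Q (Comp E ?c ?i)"
    using c i by (intro Q.cartesian_comp) simp_all
  then show ?thesis using i c by simp
qed

lemma Xi_sq_simps [simp]:
  "SqSrc (Xi_sq Q P cP cQ f) = F (Cod P.B f)" "SqTgt (Xi_sq Q P cP cQ f) = F (Dom P.B f)"
  "SqTop (Xi_sq Q P cP cQ f) = inverse_image R cR f" "SqBot (Xi_sq Q P cP cQ f) = inverse_image P cP f"
  by (simp_all add: Xi_sq_def)

lemma image_inverse_image:
  assumes f: "f \<in> Arr P.B" and h: "h \<in> Arr E" "AMap P (AMap Q h) = Ide P.B (Cod P.B f)"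
  shows "AMap Q (AMap (inverse_image R cR f) h) = AMap (inverse_image P cP f) (AMap Q h)"
proof -
  note [simp] = QP_rules composable f h comp_lift P.lift
  have [simp]: "OMap P (OMap Q (Dom E h)) = Cod P.B f" "OMap P (OMap Q (Cod E h)) = Cod P.B f"
    using R.vertical_image[of h "Cod P.B f"] by simp_all
  have "cartesian R (cR f (Cod E h))" using R.lift_cartesian[of "Cod E h" f] by simp
  then have "AMap Q (vfactor R (cR f (Cod E h)) (Comp E h (cR f (Dom E h))))
      = vfactor P (cP f (OMap Q (Cod E h))) (Comp P.D (AMap Q h) (cP f (OMap Q (Dom E h))))"
    using image_vfactor[of "cR f (Cod E h)" "Comp E h (cR f (Dom E h))"]
      Q.P.amap_comp_arr[of "cR f (Dom E h)" h] by simp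
  then show ?thesis by (simp add: inverse_image_def)
qed

text \<open>The square defining \<open>f\<^sup>* u\<close> has the chosen lifts as two sides. These are \<open>Q\<close>-Cartesian by the
  choice of the composite cleavage, so if \<open>u\<close> is Cartesian then the fourth side is Cartesian by
  cancellation.\<close>

lemma inverse_image_cartesian:
  assumes f: "f \<in> Arr P.B" and u: "cartesian (F (Cod P.B f)) u"
  shows "cartesian (F (Dom P.B f)) (AMap (inverse_image R cR f) u)"
proof -
  note [simp] = QP_rules composable f comp_lift P.lift
  have [simp]: "u \<in> Arr E" "AMap P (AMap Q u) = Ide P.B (Cod P.B f)" using cartesian_arr[OF u] by auto
  have [simp]: "OMap P (OMap Q (Dom E u)) = Cod P.B f" "OMap P (OMap Q (Cod E u)) = Cod P.B f"
    using R.vertical_image[of u "Cod P.B f"] by simp_all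
  have Qu: "cartesian Q u" using fibre_cartesian_cartesian[OF _ u] by simp
  note i = R.inverse_image_arr[of f u, simplified]
  have "cartesian Q (Comp E u (cR f (Dom E u)))"
    using Qu by (intro Q.cartesian_comp) simp_all
  then have "cartesian Q (AMap (inverse_image R cR f) u)"
    using i by - (rule Q.cartesian_comp_cancel[of "cR f (Cod E u)"], simp_all)
  then show ?thesis using i by (intro cartesian_fibre_functor) simp_all
qed

lemma fibre_functor_fibration: "A \<in> Obj P.B \<Longrightarrow> fibration (F A)"
  by (rule cloven_fibration.fibration[OF fibre_functor_cloven])

lemma Xi_sq_cartesian:
  assumes f: "f \<in> Arr P.B"
  shows "cartesian_morphism (Xi_sq Q P cP cQ f)"
proof -
  note [simp] = QP_rules composable f comp_lift P.lift fibre_functor_functor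
  have [simp]: "cat_functor (inverse_image R cR f)" "cat_functor (inverse_image P cP f)"
    using R.inverse_image_functor[of f] P.inverse_image_functor[of f] by simp_all
  have [simp]: "Src (inverse_image R cR f) = fibre R (Cod P.B f)"
    "Tgt (inverse_image R cR f) = fibre R (Dom P.B f)"
    using R.inverse_image_simps(1,2)[of f] by simp_all
  have "fcomp (F (Dom P.B f)) (inverse_image R cR f) = fcomp (inverse_image P cP f) (F (Cod P.B f))"
  proof (rule functor_eqI)
    fix y assume "y \<in> Obj (Src (fcomp (inverse_image P cP f) (F (Cod P.B f))))"
    then have [simp]: "y \<in> Obj E" "OMap P (OMap Q y) = Cod P.B f" by auto
    show "OMap (fcomp (F (Dom P.B f)) (inverse_image R cR f)) y
        = OMap (fcomp (inverse_image P cP f) (F (Cod P.B f))) y"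
      using R.inverse_image_simps(3)[of y f] by simp
  next
    fix h assume "h \<in> Arr (Src (fcomp (inverse_image P cP f) (F (Cod P.B f))))"
    then have [simp]: "h \<in> Arr E" "AMap P (AMap Q h) = Ide P.B (Cod P.B f)" by auto
    show "AMap (fcomp (F (Dom P.B f)) (inverse_image R cR f)) h
        = AMap (fcomp (inverse_image P cP f) (F (Cod P.B f))) h"
      using R.inverse_image_arr[of f h] image_inverse_image[of f h] by simp
  qed (simp_all add: fcomp_functor)
  then have "comm_square (Xi_sq Q P cP cQ f)"
    by (simp add: comm_square_def)
  then show ?thesis
    using inverse_image_cartesian[OF f] by (simp add: cartesian_morphism_def fibre_functor_fibration)
qed

abbreviation \<Xi> where "\<Xi> \<equiv> Xi_of Q P cP cQ"

lemma Xi_dom: "ps_postcomp dom_2functor \<Xi> = fibre_psfun R cR"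
  by (simp add: ps_postcomp_def dom_2functor_def Xi_of_def fibre_psfun_def)

lemma Xi_cod: "ps_postcomp cod_2functor \<Xi> = fibre_psfun P cP"
  by (simp add: ps_postcomp_def cod_2functor_def Xi_of_def fibre_psfun_def)

lemma Xi_simps [simp]:
  "Ps0 \<Xi> = fibre_functor Q P" "Ps1 \<Xi> = Xi_sq Q P cP cQ"
  "Sq2Src (PsUnit \<Xi> A) = sq_id (F A)" "Sq2Tgt (PsUnit \<Xi> A) = Xi_sq Q P cP cQ (Ide P.B A)"
  "Sq2Top (PsUnit \<Xi> A) = inverse_image_unit R cR A" "Sq2Bot (PsUnit \<Xi> A) = inverse_image_unit P cP A"
  "Sq2Src (PsComp \<Xi> f g) = sq_comp (Xi_sq Q P cP cQ f) (Xi_sq Q P cP cQ g)"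
  "Sq2Tgt (PsComp \<Xi> f g) = Xi_sq Q P cP cQ (Comp P.B g f)"
  "Sq2Top (PsComp \<Xi> f g) = inverse_image_comp R cR f g"
  "Sq2Bot (PsComp \<Xi> f g) = inverse_image_comp P cP f g"
  by (simp_all add: Xi_of_def)

lemma Xi_unit_cell:
  assumes A: "A \<in> Obj P.B"
  shows "cartesian_cell (PsUnit \<Xi> A)"
proof -
  note [simp] = QP_rules composable A comp_lift P.lift fibre_functor_fibration
  have sq: "cartesian_morphism (sq_id (F A))" "cartesian_morphism (Xi_sq Q P cP cQ (Ide P.B A))"
    by (simp_all add: cartesian_morphism_id Xi_sq_cartesian)
  have nt: "nat_trans (inverse_image_unit R cR A)" "nat_trans (inverse_image_unit P cP A)"
    using R.inverse_image_unit_nat_trans[of A] P.inverse_image_unit_nat_trans[of A] by simp_all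
  have bd: "NSrc (inverse_image_unit R cR A) = fid (fibre R A)"
    "NTgt (inverse_image_unit R cR A) = inverse_image R cR (Ide P.B A)"
    using R.inverse_image_unit_simps[of A] by simp_all
  have "AMap (F A) (NComp (inverse_image_unit R cR A) y) = NComp (inverse_image_unit P cP A) (OMap (F A) y)"
    if "y \<in> Obj (fibre R A)" for y
  proof -
    have [simp]: "y \<in> Obj E" "OMap P (OMap Q y) = A" using that by auto
    have "cartesian R (cR (Ide P.B A) y)" using R.lift_cartesian[of y "Ide P.B A"] by simp
    then have "AMap Q (NComp (inverse_image_unit R cR A) y) = NComp (inverse_image_unit P cP A) (OMap Q y)"
      using image_vfactor[of "cR (Ide P.B A) y" "Ide E y"] by (simp add: inverse_image_unit_def)
    then show ?thesis using R.inverse_image_unit_comp[of A y] by simp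
  qed
  then show ?thesis
    using sq nt bd square_cell_whisker_iff[of "sq_id (F A)" "Xi_sq Q P cP cQ (Ide P.B A)"
        "inverse_image_unit R cR A" "inverse_image_unit P cP A"]
    by (simp add: cartesian_cell_def square_cell_def cartesian_morphismD)
qed

lemma Xi_comp_cell:
  assumes f: "f \<in> Arr P.B" "g \<in> Arr P.B" "Cod P.B f = Dom P.B g"
  shows "cartesian_cell (PsComp \<Xi> f g)"
proof -
  note [simp] = QP_rules composable f comp_lift P.lift
  let ?S = "sq_comp (Xi_sq Q P cP cQ f) (Xi_sq Q P cP cQ g)" and ?T = "Xi_sq Q P cP cQ (Comp P.B g f)"
  have sq: "cartesian_morphism ?S" "cartesian_morphism ?T"
    by (simp_all add: cartesian_morphism_comp Xi_sq_cartesian)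
  have nt: "nat_trans (inverse_image_comp R cR f g)" "nat_trans (inverse_image_comp P cP f g)"
    using R.inverse_image_comp_nat_trans[of f g] P.inverse_image_comp_nat_trans[of f g] by simp_all
  have bd: "NSrc (inverse_image_comp R cR f g) = fcomp (inverse_image R cR f) (inverse_image R cR g)"
    "NTgt (inverse_image_comp R cR f g) = inverse_image R cR (Comp P.B g f)"
    using R.inverse_image_comp_simps[of f g] by simp_all
  have "AMap (F (Dom P.B f)) (NComp (inverse_image_comp R cR f g) y)
      = NComp (inverse_image_comp P cP f g) (OMap (F (Cod P.B g)) y)"
    if "y \<in> Obj (fibre R (Cod P.B g))" for y
  proof -
    have [simp]: "y \<in> Obj E" "OMap P (OMap Q y) = Cod P.B g" using that by auto
    let ?v = "Comp E (cR g y) (cR f (Dom E (cR g y)))"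
    have "AMap Q ?v = Comp P.D (cP g (OMap Q y)) (cP f (Dom P.D (cP g (OMap Q y))))"
      using Q.P.amap_comp_arr[of "cR f (Dom E (cR g y))" "cR g y"] by simp
    moreover have "cartesian R (cR (Comp P.B g f) y)"
      using R.lift_cartesian[of y "Comp P.B g f"] by simp
    ultimately have "AMap Q (NComp (inverse_image_comp R cR f g) y)
        = NComp (inverse_image_comp P cP f g) (OMap Q y)"
      using image_vfactor[of "cR (Comp P.B g f) y" ?v] by (simp add: inverse_image_comp_def)
    then show ?thesis using R.inverse_image_comp_comp[of f g y] by simp
  qed
  then show ?thesis
    using sq nt bd square_cell_whisker_iff[of ?S ?T
        "inverse_image_comp R cR f g" "inverse_image_comp P cP f g"]
    by (simp add: cartesian_cell_def square_cell_def cartesian_morphismD)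
qed

lemma Xi_pseudo_functor: "pseudo_functor (op_cat P.B) FIBc \<Xi>"
proof (rule pseudo_functor_FIBcI)
  show "pseudo_functor (op_cat P.B) CAT (ps_postcomp dom_2functor \<Xi>)"
    using R.fibre_pseudo_functor by (simp add: Xi_dom)
  show "pseudo_functor (op_cat P.B) CAT (ps_postcomp cod_2functor \<Xi>)"
    using P.fibre_pseudo_functor by (simp add: Xi_cod)
qed (simp_all add: fibre_functor_fibration Xi_sq_cartesian Xi_unit_cell Xi_comp_cell)

lemma Q_of_Xi: "Q_of P.B \<Xi> = groth_map P.B (fibre_psfun R cR) (fibre_psfun P cP) (fibre_functor Q P)"
  by (simp add: Q_of_def Xi_dom Xi_cod)

text \<open>\<open>Q\<close> sends the chosen lift of \<open>f\<close> at \<open>y\<close> to the chosen lift of \<open>f\<close> at \<open>Q y\<close>.\<close>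

lemma comparison_square:
  "fcomp (fibre_comparison P cP) (Q_of P.B \<Xi>) = fcomp Q (fibre_comparison R cR)"
proof (rule functor_eqI)
  interpret X: indexed_fibration P.B "fibre_psfun R cR" "fibre_psfun P cP" "fibre_functor Q P"
    using pseudo_functor_indexed_fibration[OF Xi_pseudo_functor] by (simp add: Xi_dom Xi_cod)
  note [simp] = QP_rules composable comp_lift P.lift X.groth_map_functor Q.is_functor
    P.fibre_comparison_functor R.fibre_comparison_functor
  note K = R.fibre_comparison_simps[unfolded fcomp_simps(1,2)]
  show "cat_functor (fcomp (fibre_comparison P cP) (Q_of P.B \<Xi>))"
    "cat_functor (fcomp Q (fibre_comparison R cR))"
    by (simp_all add: Q_of_Xi fcomp_functor K)
  show "Src (fcomp (fibre_comparison P cP) (Q_of P.B \<Xi>)) = Src (fcomp Q (fibre_comparison R cR))"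
    "Tgt (fcomp (fibre_comparison P cP) (Q_of P.B \<Xi>)) = Tgt (fcomp Q (fibre_comparison R cR))"
    by (simp_all add: Q_of_Xi K)
  show "OMap (fcomp (fibre_comparison P cP) (Q_of P.B \<Xi>)) x = OMap (fcomp Q (fibre_comparison R cR)) x"
    if "x \<in> Obj (Src (fcomp Q (fibre_comparison R cR)))" for x
  proof -
    obtain A y where x: "x = (A, y)" by (cases x)
    have G: "(A, y) \<in> Obj (groth P.B (fibre_psfun R cR))" using that by (simp add: x K)
    then have "(A, OMap (F A) y) \<in> Obj (groth P.B (fibre_psfun P cP))"
      using cat_functor.omap_obj[OF X.groth_map_functor, of "(A, y)"] by simp
    then show ?thesis
      using G by (auto simp: Q_of_Xi x K groth_simps(1))
  qed
  show "AMap (fcomp (fibre_comparison P cP) (Q_of P.B \<Xi>)) a = AMap (fcomp Q (fibre_comparison R cR)) a"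
    if "a \<in> Arr (Src (fcomp Q (fibre_comparison R cR)))" for a
  proof -
    obtain f h y where a: "a = (f, h, y)" by (cases a)
    have G: "(f, h, y) \<in> Arr (groth P.B (fibre_psfun R cR))" using that by (simp add: a K)
    then have G': "(f, AMap (F (Dom P.B f)) h, OMap (F (Cod P.B f)) y) \<in> Arr (groth P.B (fibre_psfun P cP))"
      using cat_functor.amap_arr[OF X.groth_map_functor, of "(f, h, y)"] by simp
    have [simp]: "f \<in> Arr P.B" "y \<in> Obj E" "OMap P (OMap Q y) = Cod P.B f" "h \<in> Arr E"
      "AMap P (AMap Q h) = Ide P.B (Dom P.B f)" "Cod E h = Dom E (cR f y)"
      using G R.groth_fibres_arr[of f h y] by auto
    have "AMap Q (Comp E (cR f y) h) = Comp P.D (cP f (OMap Q y)) (AMap Q h)"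
      using Q.P.amap_comp_arr[of h "cR f y"] by simp
    then show ?thesis
      using G G' by (simp add: Q_of_Xi a K)
  qed
qed

lemma comparison_isomorphic_pairs: "isomorphic_pairs (Q_of P.B \<Xi>) (P_of P.B \<Xi>) Q P"
proof -
  have P_of: "P_of P.B \<Xi> = groth_proj P.B (fibre_psfun P cP)"
    by (simp add: P_of_def Xi_cod)
  have "cat_iso (fibre_comparison R cR)" "cat_iso (fibre_comparison P cP)"
    by (fact R.fibre_comparison_iso P.fibre_comparison_iso)+
  moreover have "Src (Q_of P.B \<Xi>) = groth P.B (fibre_psfun R cR)"
    by (simp add: Q_of_Xi groth_map_def)
  ultimately show ?thesis
    unfolding isomorphic_pairs_def
    using comparison_square P.fibre_comparison_proj R.fibre_comparison_simps(1,2)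
    by (intro exI[of _ "fibre_comparison R cR"] exI[of _ "fibre_comparison P cP"]) (simp add: P_of)
qed

end

theorem proposition2p1p50:
  fixes B :: "('b, 'w) cat"
  assumes "category B"
  shows
    "(\<forall>\<Xi> :: ('b, 'w, ('e, 'u, 'd, 'v) funct, ('e, 'u, 'd, 'v) square, ('e, 'u, 'd, 'v) square2) psfun.
        pseudo_functor (op_cat B) FIBc \<Xi> \<longrightarrow>
        composable_fibrations B (Q_of B \<Xi>) (P_of B \<Xi>)) \<and>
     (\<forall>(Q :: ('e, 'u, 'd, 'v) funct) (P :: ('d, 'v, 'b, 'w) funct) cP cQ.
        composable_fibrations B Q P \<and> cleavage P cP \<and> cleavage Q cQ \<longrightarrow>
        pseudo_functor (op_cat B) FIBc (Xi_of Q P cP cQ) \<and>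
        isomorphic_pairs (Q_of B (Xi_of Q P cP cQ)) (P_of B (Xi_of Q P cP cQ)) Q P)"
proof (intro conjI allI impI; (elim conjE)?)
  fix \<Xi> :: "('b, 'w, ('e, 'u, 'd, 'v) funct, ('e, 'u, 'd, 'v) square, ('e, 'u, 'd, 'v) square2) psfun"
  assume "pseudo_functor (op_cat B) FIBc \<Xi>"
  then show "composable_fibrations B (Q_of B \<Xi>) (P_of B \<Xi>)" by (rule groth_composable_fibrations)
next
  fix Q :: "('e, 'u, 'd, 'v) funct" and P :: "('d, 'v, 'b, 'w) funct" and cP cQ
  assume QP: "composable_fibrations B Q P" and "cleavage P cP" "cleavage Q cQ"
  then interpret cloven_pair Q P cP cQ
    by (intro cloven_pair.intro cloven_fibration.intro cloven_pair_axioms.intro)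
      (simp_all add: composable_fibrations_def fibration_def)
  have B: "Tgt P = B" using QP by (simp add: composable_fibrations_def)
  show "pseudo_functor (op_cat B) FIBc (Xi_of Q P cP cQ)"
    using Xi_pseudo_functor by (simp add: B)
  show "isomorphic_pairs (Q_of B (Xi_of Q P cP cQ)) (P_of B (Xi_of Q P cP cQ)) Q P"
    using comparison_isomorphic_pairs by (simp add: B)
qed

end
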